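(* Let $\ell$ be a prime. Let $X$ be a multigraph (finite, connected, with no vertex of valency one and nonzero Euler characteristic) with vertices $v_1,\dots,v_g$, let $S$ be a choice of one orientation of each undirected edge of $X$, and let $\alpha:S\to\mathbb{Z}_\ell$ be a function with $\alpha(S)\subseteq\mathbb{Z}$ such that all derived multigraphs $X_n=X(\mathbb{Z}/\ell^n\mathbb{Z},S,\alpha_n)$, $n\ge1$, are connected. Let $\kappa_n$ be the number of spanning trees of $X_n$. Let $f(T)=\det M(T)\in\mathbb{Z}[T,T^{-1}]$, let $b\ge0$ be the least integer with $U(T):=T^bf(T)\in\mathbb{Z}[T]$, and let $\omega(m)$ denote the number of distinct prime factors of a positive integer $m$. Then $$\lim_{n\to\infty}\omega(\kappa_n)=\infty$$ if and only if $U(T)$ has a root in $\overline{\mathbb{Q}}$ that is not a root of unity.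
   Context: Multigraphs: $X$ has vertex set $V_X$, undirected edge set $E_X$, and directed edge set $\vec E_X$ (each undirected edge, including each loop, gives two opposite directed edges), with incidence map $\mathrm{inc}:\vec E_X\to V_X\times V_X$ sending a directed edge to (origin, terminus). The Euler characteristic is $|V_X|-|E_X|$. $S\subseteq\vec E_X$ contains exactly one orientation of each undirected edge. For $\alpha:S\to\mathbb{Z}_\ell$, $\alpha_n:S\to\mathbb{Z}/\ell^n\mathbb{Z}$ is its reduction mod $\ell^n$. The derived multigraph $X(\mathbb{Z}/\ell^n\mathbb{Z},S,\alpha_n)$ has vertex set $V_X\times\mathbb{Z}/\ell^n\mathbb{Z}$ and, for each $s\in S$ with $\mathrm{inc}(s)=(v,w)$ and each $\sigma$, one edge joining $(v,\sigma)$ and $(w,\sigma+\alpha_n(s))$. $M(T)$ is the $g\times g$ matrix with $(i,j)$ entry $D_{ij}-\Big(\sum_{s\in S,\ \mathrm{inc}(s)=(v_i,v_j)}T^{\alpha(s)}+\sum_{s\in S,\ \mathrm{inc}(s)=(v_j,v_i)}T^{-\alpha(s)}\Big)$, where $D$ is the diagonal valency matrix (a loop contributes $2$); since $\alpha(S)\subseteq\mathbb{Z}$ its entries lie in $\mathbb{Z}[T,T^{-1}]$. *)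

theory Defs
  imports
    Complex_Main
    "HOL-Library.Poly_Mapping"
    "HOL-Computational_Algebra.Computational_Algebra"
    "Graph_Theory.Graph_Theory"
    "Jordan_Normal_Form.Determinant"
begin

text \<open>
  A multigraph is a digraph \<open>X\<close> of directed edges together with a fixed-point free
  involution \<open>r\<close> reversing them (locale \<open>bidirected_digraph\<close>). The undirected edges are the
  orbits of \<open>r\<close>. A loop yields two directed edges, so the valency of a vertex, loops counted
  twice, is \<open>out_degree\<close>.
\<close>

definition uedges :: "('a, 'b) pre_digraph \<Rightarrow> ('b \<Rightarrow> 'b) \<Rightarrow> 'b set set" where
  "uedges X r = (\<lambda>e. {e, r e}) ` arcs X"

definition euler_char :: "('a, 'b) pre_digraph \<Rightarrow> ('b \<Rightarrow> 'b) \<Rightarrow> int" where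
  "euler_char X r = int (card (verts X)) - int (card (uedges X r))"

definition orientation :: "('a, 'b) pre_digraph \<Rightarrow> ('b \<Rightarrow> 'b) \<Rightarrow> 'b set \<Rightarrow> bool" where
  "orientation X r S \<longleftrightarrow> S \<subseteq> arcs X \<and> (\<forall>e\<in>arcs X. e \<in> S \<longleftrightarrow> r e \<notin> S)"

text \<open>
  The library's \<open>tree\<close> forbids directed cycles, among them an edge followed by its own
  reversal, which is not a cycle of the undirected multigraph; it is exempted here.
\<close>

definition multigraph_tree :: "('a, 'b) pre_digraph \<Rightarrow> ('b \<Rightarrow> 'b) \<Rightarrow> bool" where
  "multigraph_tree H r \<longleftrightarrow> Digraph_Component.connected H \<and>
     \<not> (\<exists>p. pre_digraph.cycle H p \<and> (\<forall>e\<in>set p. r e \<notin> set p))"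

definition num_spanning_trees :: "('a, 'b) pre_digraph \<Rightarrow> ('b \<Rightarrow> 'b) \<Rightarrow> nat" where
  "num_spanning_trees X r =
     card {F. F \<subseteq> uedges X r \<and> multigraph_tree (X\<lparr>arcs := \<Union>F\<rparr>) r}"

text \<open>
  Derived multigraph over \<open>\<int>/N\<close>, the residues being represented by \<open>{0..<N}\<close>. For \<open>s \<in> S\<close>,
  \<open>(s, \<sigma>)\<close> is the edge from \<open>(v, \<sigma>)\<close> to \<open>(w, \<sigma> + \<alpha> s)\<close> where \<open>s\<close> goes from \<open>v\<close> to \<open>w\<close>, and
  \<open>(r s, \<sigma>)\<close> is its reversal. The reversal map is the identity outside the edge set, as
  required by \<open>bidirected_digraph\<close>.
\<close>

definition derived ::
  "('a, 'b) pre_digraph \<Rightarrow> ('b \<Rightarrow> 'b) \<Rightarrow> nat \<Rightarrow> 'b set \<Rightarrow> ('b \<Rightarrow> int) \<Rightarrow> ('a \<times> int, 'b \<times> int) pre_digraph"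
where
  "derived X r N S \<alpha> =
     \<lparr> verts = verts X \<times> {0..<int N},
       arcs = arcs X \<times> {0..<int N},
       tail = (\<lambda>(e, \<sigma>). (tail X e, if e \<in> S then \<sigma> else (\<sigma> + \<alpha> (r e)) mod int N)),
       head = (\<lambda>(e, \<sigma>). (head X e, if e \<in> S then (\<sigma> + \<alpha> e) mod int N else \<sigma>)) \<rparr>"

definition derived_rev :: "('b \<Rightarrow> 'b) \<Rightarrow> nat \<Rightarrow> 'b \<times> int \<Rightarrow> 'b \<times> int" where
  "derived_rev r N = (\<lambda>(e, \<sigma>). (if \<sigma> \<in> {0..<int N} then r e else e, \<sigma>))"

lemma bidirected_digraph_derived:
  assumes "bidirected_digraph X r" and "orientation X r S" and "N > 0"
  shows "bidirected_digraph (derived X r N S \<alpha>) (derived_rev r N)"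
proof -
  interpret bidirected_digraph X r by fact
  show ?thesis
    using assms(2,3)
    by unfold_locales
       (auto simp: derived_def derived_rev_def orientation_def arev_dom split: if_splits)
qed

text \<open>
  The Laurent polynomial ring \<open>\<int>[T, T\<inverse>]\<close> is the group ring of \<open>\<int>\<close>, that is, the finitely
  supported functions from \<open>int\<close> to \<open>int\<close> under convolution.
\<close>

type_synonym laurent = "int \<Rightarrow>\<^sub>0 int"

definition T_pow :: "int \<Rightarrow> laurent" where
  "T_pow k = Poly_Mapping.single k 1"

definition laurent_of_poly :: "int poly \<Rightarrow> laurent" where
  "laurent_of_poly p = (\<Sum>i\<le>degree p. Poly_Mapping.single (int i) (coeff p i))"

definition voltage_matrix ::
  "('a, 'b) pre_digraph \<Rightarrow> 'b set \<Rightarrow> ('b \<Rightarrow> int) \<Rightarrow> nat \<Rightarrow> (nat \<Rightarrow> 'a) \<Rightarrow> laurent mat"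
where
  "voltage_matrix X S \<alpha> g v = mat g g (\<lambda>(i, j).
     of_nat (if i = j then out_degree X (v i) else 0) -
     ((\<Sum>s | s \<in> S \<and> arc_to_ends X s = (v i, v j). T_pow (\<alpha> s)) +
      (\<Sum>s | s \<in> S \<and> arc_to_ends X s = (v j, v i). T_pow (- \<alpha> s))))"

end

theory Submission
  imports Defs "HOL-Number_Theory.Cong" "Jordan_Normal_Form.Char_Poly"
begin

text \<open>
  The matrix-tree theorem, in the form \<open>det (L + t J) = t n\<^sup>2 \<kappa>\<close> with \<open>J\<close> the all-ones matrix, and the
  discrete Fourier transform over \<open>\<int>/l\<^sup>n\<close> give \<open>l\<^sup>n \<kappa>\<^sub>n = \<kappa>(X) \<Prod> |N\<^sub>k(U)|\<close>, \<open>1 \<le> k \<le> n\<close>, where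
  \<open>N\<^sub>k(F)\<close> is the integer \<open>\<Prod> F(\<zeta>)\<close> over the \<open>\<zeta>\<close> of exact order \<open>l\<^sup>k\<close>.

  If all roots of \<open>U\<close> are roots of unity, then \<open>U\<close> divides some \<open>c (T\<^sup>s - 1)\<^sup>d\<close>, and \<open>N\<^sub>k(T\<^sup>s - 1)\<close> is,
  up to sign, a power of \<open>l\<close> for large \<open>k\<close>; so only finitely many primes occur.

  Conversely suppose that only finitely many primes occur and let \<open>W\<close> be the primitive part of \<open>U\<close>. For
  each prime \<open>p\<close> two powers of \<open>T\<close> agree modulo \<open>(p, W)\<close>, so \<open>W\<close> divides some \<open>T\<^sup>a (T\<^sup>s - 1)\<close> modulo
  \<open>p\<close>. It follows that \<open>p\<close> does not divide \<open>N\<^sub>k(W)\<close> for large \<open>k\<close> if \<open>p \<noteq> l\<close>, and that the exponent of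
  \<open>l\<close> in \<open>N\<^sub>k(W)\<close> is bounded. So \<open>|N\<^sub>k(W)|\<close> is bounded. It equals \<open>|a|\<close> to the number of \<open>\<zeta>\<close>, times
  the product of \<open>|\<Phi>\<^sub>k(r)|\<close> over the roots \<open>r\<close> of \<open>W\<close>, where \<open>a\<close> is the leading coefficient and \<open>\<Phi>\<^sub>k\<close> the
  cyclotomic polynomial of order \<open>l\<^sup>k\<close>. If \<open>|a| > 1\<close> or some root lies outside the unit
  circle, then for every large \<open>k\<close> one of the finitely many roots \<open>r\<close> on the circle must make \<open>\<Phi>\<^sub>k(r)\<close>
  small; but then \<open>r\<close> cannot do so again for a long time, and the pigeonhole principle gives a
  contradiction. Otherwise Kronecker's theorem shows that all roots are roots of unity.
\<close>

section \<open>The matrix-tree theorem\<close>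

text \<open>The Laplacian of a derived multigraph is singular, so its Fourier factors multiply to 0.
  Adding the all-ones matrix repairs this and changes only the factor of the trivial character.
  Norms are handled as determinants of integer matrices, so that integrality and congruences modulo
  p can be read off the entries. The prime l needs its own argument because N_k(T^s - 1) is itself a
  power of l. The relation is W Q = T^a (x - 1) - l C with x = T^s. At primitive roots of large
  order, l is a multiple of (x - 1)^2, so the error is absorbed: W Q = (x - 1) G with the norm of G
  prime to l. The l-part of N_k(W) thus divides that of N_k(x - 1), which does not depend on k.
  Roots r on the unit circle obstruct growth, since Phi_k(r) may be tiny. Instead of a lower bound
  at a single k, smallness at one k is played against the size at the following ones. The root 0 is
  not a root of unity, so U(0) must be shown nonzero. Minimality of b gives this if b > 0. If b = 0,
  the symmetry f(1/T) = f(T) makes f constant, and f(1) = 0 then contradicts the positivity of the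
  tree numbers.\<close>

lemma det_row_linear:
  fixes c :: "nat \<Rightarrow> nat \<Rightarrow> 'a :: comm_ring_1"
  assumes k: "k < n"
  shows "det (mat n n (\<lambda>(i,j). if i = k then x * f j + y * h j else c i j)) =
    x * det (mat n n (\<lambda>(i,j). if i = k then f j else c i j)) +
    y * det (mat n n (\<lambda>(i,j). if i = k then h j else c i j))"
proof -
  define M where "M = (\<lambda>f. mat n n (\<lambda>(i,j). if i = k then f j else c i j))"
  have cof: "cofactor (M f) k j = cofactor (M h) k j" for f h j
  proof -
    have "mat_delete (M f) k j = mat_delete (M h) k j"
      by (rule eq_matI) (auto simp: M_def mat_delete_def)
    then show ?thesis by (simp add: cofactor_def)
  qed
  have lap: "det (M f) = (\<Sum>j<n. f j * cofactor (M (\<lambda>_. 0)) k j)" for f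
  proof -
    have "det (M f) = (\<Sum>j<n. M f $$ (k,j) * cofactor (M f) k j)"
      by (rule laplace_expansion_row[OF _ k]) (simp add: M_def)
    also have "\<dots> = (\<Sum>j<n. f j * cofactor (M (\<lambda>_. 0)) k j)"
      using k cof[of f _ "\<lambda>_. 0"] by (intro sum.cong refl) (auto simp: M_def)
    finally show ?thesis .
  qed
  have "det (M (\<lambda>j. x * f j + y * h j)) = x * det (M f) + y * det (M h)"
    by (simp add: lap sum.distrib sum_distrib_left algebra_simps)
  then show ?thesis by (simp add: M_def)
qed

lemma det_add_multiple_of_row:
  fixes c :: "nat \<Rightarrow> nat \<Rightarrow> 'a :: comm_ring_1"
  assumes "k < n" "m < n" "k \<noteq> m"
  shows "det (mat n n (\<lambda>(i,j). if i = k then c k j + t * c m j else c i j)) =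
    det (mat n n (\<lambda>(i,j). c i j))"
proof -
  have "mat n n (\<lambda>(i,j). if i = k then c k j + t * c m j else c i j) =
      addrow t k m (mat n n (\<lambda>(i,j). c i j))"
    using assms by (intro eq_matI) (auto simp: mat_addrow_def algebra_simps)
  then show ?thesis using assms by (simp add: det_addrow[of _ n])
qed

lemma det_eq_0_if_row_sums_zero:
  fixes c :: "nat \<Rightarrow> nat \<Rightarrow> 'a :: idom"
  assumes "\<And>i. i < n \<Longrightarrow> (\<Sum>j<n. c i j * w j) = 0" and "q < n" "w q \<noteq> 0"
  shows "det (mat n n (\<lambda>(i,j). c i j)) = 0"
proof -
  let ?A = "mat n n (\<lambda>(i,j). c i j)"
  have "?A *\<^sub>v vec n w = 0\<^sub>v n"
    using assms(1) by (intro eq_vecI) (auto simp: scalar_prod_def lessThan_atLeast0)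
  moreover have "vec n w \<noteq> 0\<^sub>v n"
    using assms(2,3) by (metis index_vec index_zero_vec(1))
  ultimately show ?thesis
    by (subst det_0_iff_vec_prod_zero[of _ n]) (auto intro!: exI[of _ "vec n w"])
qed

section \<open>Deletion and contraction for forests with prescribed roots\<close>

definition edge_rel :: "('e \<Rightarrow> 'v) \<Rightarrow> ('e \<Rightarrow> 'v) \<Rightarrow> 'e set \<Rightarrow> ('v \<times> 'v) set" where
  "edge_rel a b F = (\<Union>e\<in>F. {(a e, b e), (b e, a e)})"

definition reach :: "('e \<Rightarrow> 'v) \<Rightarrow> ('e \<Rightarrow> 'v) \<Rightarrow> 'e set \<Rightarrow> 'v set \<Rightarrow> 'v set" where
  "reach a b F R = (edge_rel a b F)\<^sup>* `` R"

text \<open>Spanning forests with exactly one root in each component. The count replaces acyclicity: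
  merging \<open>R\<close> to one vertex leaves a connected graph on \<open>card (V - R) + 1\<close>
  vertices with \<open>card (V - R)\<close> edges, that is, a tree. Contraction becomes an
  enlargement of \<open>R\<close>, so the vertex set never changes.\<close>

definition rooted_forests :: "('e \<Rightarrow> 'v) \<Rightarrow> ('e \<Rightarrow> 'v) \<Rightarrow> 'v set \<Rightarrow> 'v set \<Rightarrow> 'e set \<Rightarrow> 'e set set" where
  "rooted_forests a b V R E = {F. F \<subseteq> E \<and> card F = card (V - R) \<and> V \<subseteq> reach a b F R}"

lemma reach_induct [consumes 1, case_names root step]:
  assumes "x \<in> reach a b F R" "\<And>x. x \<in> R \<Longrightarrow> P x"
    "\<And>x y. x \<in> reach a b F R \<Longrightarrow> P x \<Longrightarrow> (x, y) \<in> edge_rel a b F \<Longrightarrow> P y"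
  shows "P x"
proof -
  obtain y where y: "y \<in> R" "(y, x) \<in> (edge_rel a b F)\<^sup>*"
    using assms(1) by (auto simp: reach_def)
  from y(2) show ?thesis
    by (induction) (use y(1) assms(2,3) in \<open>auto simp: reach_def\<close>)
qed

lemma reach_root: "x \<in> R \<Longrightarrow> x \<in> reach a b F R"
  by (auto simp: reach_def)

lemma reach_step: "x \<in> reach a b F R \<Longrightarrow> (x, y) \<in> edge_rel a b F \<Longrightarrow> y \<in> reach a b F R"
  by (auto simp: reach_def intro: rtrancl_into_rtrancl)

lemma reach_subsetI:
  assumes "R \<subseteq> C" "\<And>x y. x \<in> C \<Longrightarrow> (x, y) \<in> edge_rel a b F \<Longrightarrow> y \<in> C"
  shows "reach a b F R \<subseteq> C"
proof
  fix x assume "x \<in> reach a b F R" then show "x \<in> C"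
    by (induction rule: reach_induct) (use assms in auto)
qed

lemma edge_rel_mono: "F \<subseteq> G \<Longrightarrow> edge_rel a b F \<subseteq> edge_rel a b G"
  by (auto simp: edge_rel_def)

lemma sym_edge_rel: "sym (edge_rel a b F)"
  by (auto simp: sym_def edge_rel_def)

text \<open>The edge joins \<open>R\<close> to \<open>y\<close>, so contracting it is the same as making \<open>y\<close> a root.\<close>
lemma reach_contract:
  assumes "e \<in> F" "x \<in> R" "(x, y) \<in> edge_rel a b {e}"
  shows "reach a b F R = reach a b (F - {e}) (insert y R)"
proof
  show "reach a b F R \<subseteq> reach a b (F - {e}) (insert y R)"
  proof (rule reach_subsetI)
    fix u w assume u: "u \<in> reach a b (F - {e}) (insert y R)" and uw: "(u, w) \<in> edge_rel a b F"
    show "w \<in> reach a b (F - {e}) (insert y R)"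
    proof (cases "(u, w) \<in> edge_rel a b (F - {e})")
      case True then show ?thesis using u by (blast intro: reach_step)
    next
      case False
      then have "(u, w) \<in> edge_rel a b {e}" using uw by (auto simp: edge_rel_def)
      then have "w = x \<or> w = y" using assms(3) by (auto simp: edge_rel_def)
      then show ?thesis using assms(2) by (auto intro: reach_root)
    qed
  qed (auto intro: reach_root)
  have "y \<in> reach a b F R"
    using assms edge_rel_mono[of "{e}" F a b] by (blast intro: reach_root reach_step)
  then show "reach a b (F - {e}) (insert y R) \<subseteq> reach a b F R"
    using edge_rel_mono[of "F - {e}" F a b]
    by (intro reach_subsetI) (auto intro: reach_root reach_step)
qed

lemma crossing_edge:
  assumes "V \<subseteq> reach a b F R" "\<not> V \<subseteq> R"
  obtains e x y where "e \<in> F" "x \<in> R" "y \<notin> R" "(x, y) \<in> edge_rel a b {e}"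
proof -
  have "\<exists>x y. x \<in> R \<and> y \<notin> R \<and> (x, y) \<in> edge_rel a b F"
  proof (rule ccontr)
    assume "\<not> ?thesis"
    then have "reach a b F R \<subseteq> R" by (intro reach_subsetI) auto
    then show False using assms by auto
  qed
  then obtain x y where xy: "x \<in> R" "y \<notin> R" "(x, y) \<in> edge_rel a b F" by blast
  then obtain e where "e \<in> F" "(x, y) \<in> edge_rel a b {e}" by (auto simp: edge_rel_def)
  then show ?thesis using that xy by blast
qed

lemma rooted_forests_finite: "finite E \<Longrightarrow> finite (rooted_forests a b V R E)"
  by (auto simp: rooted_forests_def)

text \<open>Deletion and contraction. Forests without \<open>e\<close> give the first summand;
  removing \<open>e\<close> from the others makes \<open>y\<close> one more root, and the required
  number of edges drops by one along with \<open>card (V - R)\<close>.\<close>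

lemma rooted_forests_edge:
  assumes fin: "finite E" "finite V" and e: "e \<in> E" and x: "x \<in> R" and y: "y \<in> V" "y \<notin> R"
    and xy: "(x, y) \<in> edge_rel a b {e}"
  shows "card (rooted_forests a b V R E) =
    card (rooted_forests a b V R (E - {e})) + card (rooted_forests a b V (insert y R) (E - {e}))"
proof -
  let ?A = "rooted_forests a b V R (E - {e})"
  let ?B = "rooted_forests a b V (insert y R) (E - {e})"
  have card: "card (V - R) = Suc (card (V - insert y R))"
    using y fin by (metis Diff_iff Diff_insert card_Suc_Diff1 finite_Diff)
  have "rooted_forests a b V R E = ?A \<union> insert e ` ?B"
  proof (intro Set.set_eqI iffI)
    fix F assume F: "F \<in> rooted_forests a b V R E"
    have finF: "finite F" using F fin by (auto simp: rooted_forests_def intro: finite_subset)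
    show "F \<in> ?A \<union> insert e ` ?B"
    proof (cases "e \<in> F")
      case True
      then have "F - {e} \<in> ?B"
        using F card finF reach_contract[OF True x xy]
        by (auto simp: rooted_forests_def)
      then show ?thesis using True by (metis UnI2 imageI insert_Diff)
    qed (use F in \<open>auto simp: rooted_forests_def\<close>)
  next
    fix F assume "F \<in> ?A \<union> insert e ` ?B"
    then consider "F \<in> ?A" | G where "G \<in> ?B" "F = insert e G" by auto
    then show "F \<in> rooted_forests a b V R E"
    proof cases
      case 2
      then have "finite G" "e \<notin> G" using fin by (auto simp: rooted_forests_def intro: finite_subset)
      moreover have "reach a b F R = reach a b G (insert y R)"
        using reach_contract[of e F x R y a b] 2 x xy \<open>e \<notin> G\<close> by simp
      ultimately show ?thesis using 2 card e by (auto simp: rooted_forests_def)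
    qed (auto simp: rooted_forests_def)
  qed
  moreover have "?A \<inter> insert e ` ?B = {}" by (auto simp: rooted_forests_def)
  moreover have "inj_on (insert e) ?B" by (auto simp: inj_on_def rooted_forests_def)
  ultimately show ?thesis
    using rooted_forests_finite[of "E - {e}" a b V] fin
    by (simp add: card_Un_disjoint card_image)
qed

text \<open>The graph Laplacian as a sum over the edges of squares of signed incidence vectors, so
  that deleting an edge subtracts one term of rank at most one. A loop contributes 0.\<close>

definition laplace_entry :: "('e \<Rightarrow> 'v) \<Rightarrow> ('e \<Rightarrow> 'v) \<Rightarrow> 'e set \<Rightarrow> 'v \<Rightarrow> 'v \<Rightarrow> int" where
  "laplace_entry a b E i j =
     (\<Sum>e\<in>E. (of_bool (i = a e) - of_bool (i = b e)) * (of_bool (j = a e) - of_bool (j = b e)))"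

lemma laplace_entry_sym: "laplace_entry a b E i j = laplace_entry a b E j i"
  by (simp add: laplace_entry_def mult.commute)

lemma laplace_entry_row_sum:
  assumes "a ` E \<subseteq> V" "b ` E \<subseteq> V" "finite V"
  shows "(\<Sum>j\<in>V. laplace_entry a b E i j) = 0"
proof -
  have "(\<Sum>j\<in>V. laplace_entry a b E i j) =
      (\<Sum>e\<in>E. (of_bool (i = a e) - of_bool (i = b e)) *
        (\<Sum>j\<in>V. of_bool (j = a e) - of_bool (j = b e)))"
    unfolding laplace_entry_def by (subst sum.swap) (simp add: sum_distrib_left)
  also have "\<dots> = 0"
  proof (intro sum.neutral ballI)
    fix e assume "e \<in> E"
    then have "V \<inter> {j. j = a e} = {a e}" "V \<inter> {j. j = b e} = {b e}" using assms by auto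
    then show "(of_bool (i = a e) - of_bool (i = b e)) *
        (\<Sum>j\<in>V. of_bool (j = a e) - of_bool (j = b e)) = (0::int)"
      using assms(3) by (simp add: sum_subtractf)
  qed
  finally show ?thesis .
qed

text \<open>With the rows of the roots replaced by unit vectors, the determinant is the principal minor
  obtained by deleting the roots.\<close>

definition rooted_laplacian :: "nat \<Rightarrow> ('e \<Rightarrow> nat) \<Rightarrow> ('e \<Rightarrow> nat) \<Rightarrow> 'e set \<Rightarrow> nat set \<Rightarrow> int mat" where
  "rooted_laplacian n a b E R =
     mat n n (\<lambda>(i, j). if i \<in> R then of_bool (i = j) else laplace_entry a b E i j)"

text \<open>Both sides obey the same recurrence along an edge joining a root to a non-root. The
  recursion ends when every vertex is a root, with value 1, or when non-roots remain and no edge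
  leaves \<open>R\<close>, with value 0.\<close>

theorem det_rooted_laplacian:
  assumes "finite E" "a ` E \<subseteq> {..<n}" "b ` E \<subseteq> {..<n}" "R \<subseteq> {..<n}"
  shows "det (rooted_laplacian n a b E R) = int (card (rooted_forests a b {..<n} R E))"
  using assms
proof (induction E arbitrary: R rule: finite_psubset_induct)
  case (psubset E)
  note ends = psubset.prems(1,2)
  show ?case
  proof (cases "{..<n} \<subseteq> R")
    case True
    then have R: "R = {..<n}" using psubset.prems by auto
    have "rooted_laplacian n a b E R = 1\<^sub>m n"
      by (rule eq_matI) (auto simp: rooted_laplacian_def R)
    moreover have "rooted_forests a b {..<n} R E = {{}}"
      using psubset.hyps
      by (auto simp: rooted_forests_def R card_eq_0_iff intro: finite_subset reach_root)
    ultimately show ?thesis by simp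
  next
    case nR: False
    show ?thesis
    proof (cases "\<exists>e x y. e \<in> E \<and> x \<in> R \<and> y \<notin> R \<and> (x, y) \<in> edge_rel a b {e}")
      case False
      then have "rooted_forests a b {..<n} R E = {}"
        proof -
        have "\<not> {..<n} \<subseteq> reach a b F R" if "F \<subseteq> E" for F
          using crossing_edge[OF _ nR, of a b F] False that by (metis subsetD)
        then show ?thesis by (auto simp: rooted_forests_def)
      qed
      moreover have "det (rooted_laplacian n a b E R) = 0"
      proof -
        obtain q where q: "q < n" "q \<notin> R" using nR by auto
        \<comment> \<open>The indicator of the non-roots is a kernel vector: no edge joins the two
          sides, so the root columns vanish in the rows of non-roots, and these rows still sum to
          0.\<close>
        have "(\<Sum>j<n. (if i \<in> R then of_bool (i = j) else laplace_entry a b E i j) *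
            of_bool (j \<notin> R)) = 0" if "i < n" for i
        proof (cases "i \<in> R")
          case False
          have "laplace_entry a b E i j = 0" if "j \<in> R" for j
            unfolding laplace_entry_def
          proof (intro sum.neutral ballI)
            fix e assume "e \<in> E"
            then show "(of_bool (i = a e) - of_bool (i = b e)) *
                (of_bool (j = a e) - of_bool (j = b e)) = (0::int)"
              using \<open>\<not> (\<exists>e x y. e \<in> E \<and> x \<in> R \<and> y \<notin> R \<and> (x, y) \<in> edge_rel a b {e})\<close> that False
              by (auto simp: edge_rel_def of_bool_def)
          qed
          then have "(\<Sum>j<n. (if i \<in> R then of_bool (i = j) else laplace_entry a b E i j) *
              of_bool (j \<notin> R)) = (\<Sum>j<n. laplace_entry a b E i j)"
            using False by (intro sum.cong) auto
          then show ?thesis using laplace_entry_row_sum[of a E "{..<n}" b i] ends by simp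
        qed (auto intro!: sum.neutral)
        then show ?thesis unfolding rooted_laplacian_def
          by (rule det_eq_0_if_row_sums_zero[OF _ q(1)]) (use q in auto)
      qed
      ultimately show ?thesis by simp
    next
      case True
      then obtain e x y where e: "e \<in> E" "x \<in> R" "y \<notin> R" "(x, y) \<in> edge_rel a b {e}" by blast
      have y: "y < n" and x: "x < n" and xy: "x \<noteq> y"
        using e ends by (auto simp: edge_rel_def)
      let ?E = "E - {e}"
      define c where "c i j = (if i \<in> R then of_bool (i = j) else laplace_entry a b ?E i j)" for i j
      have lap: "laplace_entry a b E i j = laplace_entry a b ?E i j +
          (of_bool (i = x) - of_bool (i = y)) * (of_bool (j = x) - of_bool (j = y))" for i j
        unfolding laplace_entry_def using e psubset.hyps
        by (subst sum.remove[of E e]) (auto simp: edge_rel_def algebra_simps)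
      \<comment> \<open>The row of the root \<open>x\<close> does not see the edge; only row
        \<open>y\<close> changes, by the term of \<open>e\<close>.\<close>
      have "rooted_laplacian n a b E R =
          mat n n (\<lambda>(i,j). if i = y then 1 * c y j + 1 * (of_bool (j = y) - of_bool (j = x)) else c i j)"
        using e by (intro eq_matI) (auto simp: rooted_laplacian_def c_def lap)
      then have "det (rooted_laplacian n a b E R) =
          det (mat n n (\<lambda>(i,j). if i = y then c y j else c i j)) +
          det (mat n n (\<lambda>(i,j). if i = y then of_bool (j = y) - of_bool (j = x) else c i j))"
        using det_row_linear[OF y, of 1 "c y" 1 "\<lambda>j. of_bool (j = y) - of_bool (j = x)" c] by simp
      moreover have "mat n n (\<lambda>(i,j). if i = y then c y j else c i j) = rooted_laplacian n a b ?E R"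
        by (intro eq_matI) (auto simp: rooted_laplacian_def c_def)
      moreover have "det (mat n n (\<lambda>(i,j). if i = y then of_bool (j = y) - of_bool (j = x) else c i j)) =
          det (rooted_laplacian n a b ?E (insert y R))"
      proof -
        define d where "d i j = (if i = y then of_bool (j = y) - of_bool (j = x) else c i j)" for i j
        \<comment> \<open>Row \<open>x\<close> is the unit vector of the root \<open>x\<close>;
          adding it to row \<open>y\<close> leaves the unit vector of \<open>y\<close>, as if
          \<open>y\<close> were a root.\<close>
        have "det (mat n n (\<lambda>(i,j). d i j)) =
            det (mat n n (\<lambda>(i,j). if i = y then d y j + 1 * d x j else d i j))"
          using det_add_multiple_of_row[OF y x, of d 1] xy by simp
        also have "mat n n (\<lambda>(i,j). if i = y then d y j + 1 * d x j else d i j) =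
            rooted_laplacian n a b ?E (insert y R)"
          using xy e by (intro eq_matI) (auto simp: rooted_laplacian_def c_def d_def)
        finally show ?thesis by (simp add: d_def)
      qed
      ultimately have "det (rooted_laplacian n a b E R) =
          det (rooted_laplacian n a b ?E R) + det (rooted_laplacian n a b ?E (insert y R))"
        by simp
      also have "\<dots> = int (card (rooted_forests a b {..<n} R E))"
      proof -
        have E: "?E \<subset> E" "a ` ?E \<subseteq> {..<n}" "b ` ?E \<subseteq> {..<n}" using e(1) ends by auto
        show ?thesis
          using psubset.IH[OF E psubset.prems(3)] psubset.IH[OF E, of "insert y R"] y psubset.prems(3)
            rooted_forests_edge[OF psubset.hyps(1) _ e(1,2) _ e(3,4), of "{..<n}"]
          by simp
      qed
      finally show ?thesis .
    qed
  qed
qed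

text \<open>Adding all rows to row 0 makes it constant \<open>n t\<close>, as the columns of
  \<open>c\<close> sum to 0. With \<open>n t\<close> factored out, multiples of the row of ones
  remove \<open>t\<close> from the other rows. Finally the row of ones is \<open>n\<close> times the
  first unit vector plus a row summing to 0, and with the latter as row 0 the matrix is
  singular.\<close>

lemma det_add_const:
  fixes c :: "nat \<Rightarrow> nat \<Rightarrow> 'a :: idom"
  assumes n: "0 < n" and rows: "\<And>i. i < n \<Longrightarrow> (\<Sum>j<n. c i j) = 0"
    and cols: "\<And>j. j < n \<Longrightarrow> (\<Sum>i<n. c i j) = 0"
  shows "det (mat n n (\<lambda>(i,j). c i j + t)) =
    t * of_nat n ^ 2 * det (mat n n (\<lambda>(i,j). if i = 0 then of_bool (j = 0) else c i j))"
proof -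
  let ?P = "mat n n (\<lambda>(i,j). if i = 0 then 1 else of_bool (i = j) :: 'a)"
  let ?Q = "mat n n (\<lambda>(i,j). if j = 0 \<and> i \<noteq> 0 then t else of_bool (i = j) :: 'a)"
  let ?A = "mat n n (\<lambda>(i,j). c i j + t)"
  let ?B = "mat n n (\<lambda>(i,j). if i = 0 then of_nat n * t * 1 + 0 * 0 else c i j + t)"
  let ?B' = "mat n n (\<lambda>(i,j). if i = 0 then 1 else c i j + t)"
  let ?C = "mat n n (\<lambda>(i,j). if i = 0 then 1 else c i j)"
  have "det ?P = 1"
    by (subst det_upper_triangular[of _ n]) (auto simp: prod_list_diag_prod intro!: prod.neutral)
  moreover have "?P * ?A = ?B"
  proof (intro eq_matI)
    fix i j assume "i < dim_row ?B" "j < dim_col ?B"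
    then have ij: "i < n" "j < n" by auto
    have "(?P * ?A) $$ (i, j) = (\<Sum>k<n. (if i = 0 then 1 else of_bool (i = k)) * (c k j + t))"
      using ij by (simp add: scalar_prod_def lessThan_atLeast0)
    also have "\<dots> = ?B $$ (i, j)"
    proof (cases "i = 0")
      case False
      have "(\<Sum>k<n. (if i = 0 then 1 else of_bool (i = k)) * (c k j + t)) =
          (\<Sum>k<n. if k = i then c k j + t else 0)"
        using False by (intro sum.cong) auto
      then show ?thesis using ij False by simp
    qed (use ij n cols in \<open>simp add: sum.distrib\<close>)
    finally show "(?P * ?A) $$ (i, j) = ?B $$ (i, j)" .
  qed auto
  ultimately have "det ?A = det ?B"
    using det_mult[of ?P n ?A] by simp
  also have "\<dots> = of_nat n * t * det ?B'"
    using det_row_linear[OF n, of "of_nat n * t" "\<lambda>_. 1" 0 "\<lambda>_. 0" "\<lambda>i j. c i j + t"] by simp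
  also have "det ?B' = det ?C"
  proof -
    have "det ?Q = 1"
      by (subst det_lower_triangular[of n]) (auto simp: prod_list_diag_prod intro!: prod.neutral)
    moreover have "?Q * ?C = ?B'"
    proof (intro eq_matI)
      fix i j assume "i < dim_row ?B'" "j < dim_col ?B'"
      then have ij: "i < n" "j < n" by auto
      have "(?Q * ?C) $$ (i, j) = (\<Sum>k<n. (if k = 0 \<and> i \<noteq> 0 then t else of_bool (i = k)) *
          (if k = 0 then 1 else c k j))"
        using ij by (simp add: scalar_prod_def lessThan_atLeast0)
      also have "\<dots> = (\<Sum>k<n. (if k = 0 \<and> i \<noteq> 0 then t else 0)) +
          (\<Sum>k<n. if k = i then (if k = 0 then 1 else c k j) else 0)"
        by (subst sum.distrib[symmetric]) (intro sum.cong, auto)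
      also have "\<dots> = ?B' $$ (i, j)"
        using ij n by (cases "i = 0") (auto simp: sum.delta)
      finally show "(?Q * ?C) $$ (i, j) = ?B' $$ (i, j)" .
    qed auto
    ultimately show ?thesis using det_mult[of ?Q n ?C] by simp
  qed
  also have "det ?C = of_nat n * det (mat n n (\<lambda>(i,j). if i = 0 then of_bool (j = 0) else c i j))"
  proof -
    define w :: "nat \<Rightarrow> 'a" where "w j = 1 - of_nat n * of_bool (j = 0)" for j
    have "det (mat n n (\<lambda>(i,j). if i = 0 then w j else c i j)) = 0"
    proof (rule det_eq_0_if_row_sums_zero[where w = "\<lambda>_. 1", OF _ n])
      fix i assume "i < n"
      have "(\<Sum>j<n. w j) = 0"
      proof -
        have "{..<n} \<inter> {j. j = 0} = {0}" using n by auto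
        then show ?thesis by (simp add: w_def sum_subtractf sum_distrib_left[symmetric])
      qed
      then show "(\<Sum>j<n. (if i = 0 then w j else c i j) * 1) = 0"
        using rows[OF \<open>i < n\<close>] by (cases "i = 0") auto
    qed simp
    moreover have "of_nat n * of_bool (j = 0) + 1 * w j = 1" for j by (simp add: w_def)
    ultimately show ?thesis
      using det_row_linear[OF n, of "of_nat n" "\<lambda>j. of_bool (j = 0)" 1 w c] by (simp cong: if_cong)
  qed
  finally show ?thesis by (simp add: power2_eq_square mult_ac)
qed

text \<open>Greedy growth: an edge leaving \<open>R\<close> is taken and its far end becomes a root,
  until no other vertex remains.\<close>

lemma exists_rooted_forest:
  assumes "finite F" "finite V" "a ` F \<subseteq> V" "b ` F \<subseteq> V" "V \<subseteq> reach a b F R"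
  shows "rooted_forests a b V R F \<noteq> {}"
  using assms
proof (induction "card (V - R)" arbitrary: R F)
  case 0
  then have "V \<subseteq> R" by auto
  then have "{} \<in> rooted_forests a b V R F" using 0
    by (auto simp: rooted_forests_def intro: reach_root)
  then show ?case by blast
next
  case (Suc m)
  then have "\<not> V \<subseteq> R" by (metis Diff_eq_empty_iff card.empty nat.distinct(1))
  then obtain e x y where e: "e \<in> F" "x \<in> R" "y \<notin> R" "(x, y) \<in> edge_rel a b {e}"
    using crossing_edge Suc.prems(5) by meson
  have y: "y \<in> V" using e Suc.prems by (auto simp: edge_rel_def)
  have "card (V - insert y R) = m"
    using Suc.hyps(2) Suc.prems(2) y e(3)
    by (metis Diff_iff Diff_insert card_Diff_singleton diff_Suc_1)
  then have "rooted_forests a b V (insert y R) (F - {e}) \<noteq> {}"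
    using Suc.hyps(1)[of "insert y R" "F - {e}"] Suc.prems reach_contract[OF e(1,2,4)] by auto
  then show ?case
    using rooted_forests_edge[OF Suc.prems(1,2) e(1,2) y e(3,4)] rooted_forests_finite[of "F - {e}" a b V "insert y R"]
      Suc.prems(1) by (metis add_is_0 card.empty card_0_eq finite_Diff)
qed

lemma reach_delete_redundant_edge:
  assumes "(a s, b s) \<in> (edge_rel a b (F - {s}))\<^sup>*"
  shows "reach a b F R \<subseteq> reach a b (F - {s}) R"
proof (rule reach_subsetI)
  have sym: "(b s, a s) \<in> (edge_rel a b (F - {s}))\<^sup>*"
    using assms by (rule symD[OF sym_rtrancl[OF sym_edge_rel]])
  fix x y assume x: "x \<in> reach a b (F - {s}) R" and "(x, y) \<in> edge_rel a b F"
  then have "(x, y) \<in> (edge_rel a b (F - {s}))\<^sup>*"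
    using assms sym by (auto simp: edge_rel_def)
  then show "y \<in> reach a b (F - {s}) R" using x by (auto simp: reach_def intro: rtrancl_trans)
qed (auto intro: reach_root)

section \<open>Spanning trees of a bidirected digraph as rooted forests of oriented edges\<close>

context
  fixes X :: "('a, 'b) pre_digraph" and r :: "'b \<Rightarrow> 'b" and S :: "'b set"
  assumes fin: "fin_digraph X" and bi: "bidirected_digraph X r" and ori: "orientation X r S"
begin

interpretation fin_digraph X by (fact fin)
interpretation bidirected_digraph X r by (fact bi)

definition oriented_subgraph :: "'b set \<Rightarrow> ('a, 'b) pre_digraph" where
  "oriented_subgraph F = X\<lparr>arcs := F \<union> r ` F\<rparr>"

lemma orientation_subset_arcs: "S \<subseteq> arcs X" using ori by (simp add: orientation_def)

lemma wf_oriented_subgraph: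
  assumes "F \<subseteq> S" shows "wf_digraph (oriented_subgraph F)"
  using assms orientation_subset_arcs by unfold_locales (auto simp: oriented_subgraph_def)

lemma ends_in_verts:
  assumes "F \<subseteq> S" shows "tail X ` F \<subseteq> verts X" "head X ` F \<subseteq> verts X"
  using assms orientation_subset_arcs by auto

lemma edge_rel_verts:
  assumes "F \<subseteq> S" "(x, y) \<in> edge_rel (tail X) (head X) F"
  shows "x \<in> verts X" "y \<in> verts X"
  using assms orientation_subset_arcs by (auto simp: edge_rel_def)

lemma arcs_ends_oriented_subgraph:
  assumes "F \<subseteq> S"
  shows "arcs_ends (oriented_subgraph F) = edge_rel (tail X) (head X) F"
proof -
  have "arcs_ends (oriented_subgraph F) =
      (\<lambda>e. (tail X e, head X e)) ` F \<union> (\<lambda>e. (tail X (r e), head X (r e))) ` F"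
    by (simp add: arcs_ends_def oriented_subgraph_def arc_to_ends_def image_Un image_image)
  also have "(\<lambda>e. (tail X (r e), head X (r e))) ` F = (\<lambda>e. (head X e, tail X e)) ` F"
    using assms orientation_subset_arcs by (intro image_cong refl) auto
  finally show ?thesis by (auto simp: edge_rel_def)
qed

lemma reachable_oriented_subgraph:
  assumes "F \<subseteq> S" "u \<in> verts X"
  shows "u \<rightarrow>\<^sup>*\<^bsub>oriented_subgraph F\<^esub> v \<longleftrightarrow> (u, v) \<in> (edge_rel (tail X) (head X) F)\<^sup>*"
proof
  assume "u \<rightarrow>\<^sup>*\<^bsub>oriented_subgraph F\<^esub> v"
  then show "(u, v) \<in> (edge_rel (tail X) (head X) F)\<^sup>*"
    unfolding reachable_def arcs_ends_oriented_subgraph[OF assms(1)] by (rule rtrancl_on_rtranclI)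
next
  assume uv: "(u, v) \<in> (edge_rel (tail X) (head X) F)\<^sup>*"
  then have "v \<in> verts X"
    by (induction) (use assms edge_rel_verts in auto)
  then show "u \<rightarrow>\<^sup>*\<^bsub>oriented_subgraph F\<^esub> v"
    unfolding reachable_def arcs_ends_oriented_subgraph[OF assms(1)]
    using edge_rel_verts[OF assms(1)] assms(2)
    by (intro rtrancl_consistent_rtrancl_on[OF uv]) (auto simp: oriented_subgraph_def)
qed

lemma connected_oriented_subgraph:
  assumes "F \<subseteq> S" "q \<in> verts X"
  shows "Digraph_Component.connected (oriented_subgraph F) \<longleftrightarrow>
    verts X \<subseteq> reach (tail X) (head X) F {q}"
proof -
  interpret H: wf_digraph "oriented_subgraph F" by (rule wf_oriented_subgraph[OF assms(1)])
  let ?E = "edge_rel (tail X) (head X) F"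
  have symE: "sym (?E\<^sup>*)" by (intro sym_rtrancl sym_edge_rel)
  have sym: "symmetric (oriented_subgraph F)"
    unfolding symmetric_def arcs_ends_oriented_subgraph[OF assms(1)] by (rule sym_edge_rel)
  have v: "verts (oriented_subgraph F) = verts X" by (simp add: oriented_subgraph_def)
  have "Digraph_Component.connected (oriented_subgraph F) \<longleftrightarrow>
      (\<forall>u\<in>verts X. \<forall>v\<in>verts X. (u, v) \<in> ?E\<^sup>*)"
    unfolding connected_def strongly_connected_def using assms
    by (auto simp: H.reachable_mk_symmetric_eq[OF sym] reachable_oriented_subgraph v)
  also have "\<dots> \<longleftrightarrow> verts X \<subseteq> reach (tail X) (head X) F {q}"
  proof
    assume R: "verts X \<subseteq> reach (tail X) (head X) F {q}"
    show "\<forall>u\<in>verts X. \<forall>v\<in>verts X. (u, v) \<in> ?E\<^sup>*"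
    proof (intro ballI)
      fix u v assume "u \<in> verts X" "v \<in> verts X"
      then have "(q, u) \<in> ?E\<^sup>*" "(q, v) \<in> ?E\<^sup>*" using R by (auto simp: reach_def)
      then show "(u, v) \<in> ?E\<^sup>*" using symE by (meson rtrancl_trans symD)
    qed
  qed (use assms(2) in \<open>auto simp: reach_def\<close>)
  finally show ?thesis .
qed

lemma rtrancl_edge_rel_if_cas:
  assumes "F \<subseteq> S" "pre_digraph.cas X u p v" "set p \<subseteq> F \<union> r ` F"
  shows "(u, v) \<in> (edge_rel (tail X) (head X) F)\<^sup>*"
  using assms(2,3)
proof (induction p arbitrary: u)
  case (Cons e p)
  then have "(u, head X e) \<in> edge_rel (tail X) (head X) F"
  proof (cases "e \<in> F")
    case False
    then obtain s where "s \<in> F" "e = r s" using Cons.prems(2) by auto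
    then show ?thesis using assms(1) orientation_subset_arcs Cons.prems(1) by (auto simp: edge_rel_def subset_iff)
  qed (use Cons.prems(1) in \<open>auto simp: edge_rel_def\<close>)
  moreover have "(head X e, v) \<in> (edge_rel (tail X) (head X) F)\<^sup>*" using Cons by auto
  ultimately show ?case by (rule converse_rtrancl_into_rtrancl)
qed simp

text \<open>If the reversal of the first arc \<open>f\<close> occurred, the walk would return to its
  starting vertex, the head of \<open>r f\<close>; distinctness of the vertices excludes this. The
  remaining arcs follow by induction.\<close>

lemma apath_arev_disjoint:
  assumes "cas u p v" "set p \<subseteq> arcs X" "distinct (awalk_verts u p)" "e \<in> set p"
  shows "r e \<notin> set p"
  using assms
proof (induction p arbitrary: u e)
  case (Cons f p)
  have av: "awalk_verts u (f # p) = tail X f # awalk_verts (head X f) p" by simp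
  have heads: "set (awalk_verts (head X f) p) = insert (head X f) (head X ` set p)"
    using Cons.prems(1) by (auto simp: awalk_verts_conv'[of "head X f" p v] cas_simp)
  have ne: "tail X f \<noteq> head X e" if "e \<in> set (f # p)" for e
    using Cons.prems(3) that unfolding av heads by (auto simp: heads)
  have IH: "r e \<notin> set p" if "e \<in> set p" for e
    using Cons.IH[of "head X f"] Cons.prems that by auto
  have f: "r f \<notin> set (f # p)" using ne[of "r f"] Cons.prems(2) by auto
  show ?case
  proof (cases "e = f")
    case False
    then have "e \<in> set p" using Cons.prems(4) by auto
    moreover have "r e \<noteq> f" using f \<open>e \<in> set p\<close> by auto
    ultimately show ?thesis using IH by auto
  qed (use f in auto)
qed simp

lemma cas_oriented_subgraph: "pre_digraph.cas (oriented_subgraph F) u p v = cas u p v"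
  by (induction p arbitrary: u) (auto simp: pre_digraph.cas.simps oriented_subgraph_def)

lemma awalk_verts_oriented_subgraph:
  "pre_digraph.awalk_verts (oriented_subgraph F) u p = awalk_verts u p"
  by (induction p arbitrary: u) (auto simp: pre_digraph.awalk_verts.simps oriented_subgraph_def)

text \<open>For connected subgraphs acyclicity amounts to the edge count. An arc of a cycle is
  redundant, so a proper subset of \<open>F\<close> already contains a spanning forest and
  \<open>F\<close> is too large. Conversely a surplus edge lies outside some spanning forest
  \<open>F'\<close> inside \<open>F\<close>, and a path of \<open>F'\<close> between its ends closes
  to a cycle.\<close>

lemma multigraph_tree_oriented_subgraph:
  assumes F: "F \<subseteq> S" and q: "q \<in> verts X"
  shows "multigraph_tree (oriented_subgraph F) r \<longleftrightarrow>
    F \<in> rooted_forests (tail X) (head X) (verts X) {q} S"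
proof -
  let ?H = "oriented_subgraph F" and ?t = "tail X" and ?h = "head X" and ?V = "verts X"
  interpret H: wf_digraph ?H by (rule wf_oriented_subgraph[OF F])
  have finF: "finite F" using F orientation_subset_arcs finite_arcs by (meson finite_subset)
  note ends = ends_in_verts[OF F]
  have arcsH: "arcs ?H = F \<union> r ` F" by (simp add: oriented_subgraph_def)
  have FX: "F \<subseteq> arcs X" using F orientation_subset_arcs by auto
  have notS: "r e \<notin> S" if "e \<in> S" for e using ori that unfolding orientation_def by blast
  have "(\<exists>p. H.cycle p \<and> (\<forall>e\<in>set p. r e \<notin> set p)) \<longleftrightarrow> card F \<noteq> card (?V - {q})"
    if conn: "?V \<subseteq> reach ?t ?h F {q}"
  proof
    assume "\<exists>p. H.cycle p \<and> (\<forall>e\<in>set p. r e \<notin> set p)"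
    then obtain p u where p: "H.awalk u p u" "distinct p" "p \<noteq> []" and nr: "\<forall>e\<in>set p. r e \<notin> set p"
      by (auto simp: H.cycle_conv)
    obtain e p' where ep: "p = e # p'" using p(3) by (cases p) auto
    have eH: "e \<in> F \<union> r ` F" and p'H: "set p' \<subseteq> F \<union> r ` F"
      using p(1) by (auto simp: H.awalk_def ep arcsH)
    have cas: "cas u p u" using p(1) by (simp add: H.awalk_def cas_oriented_subgraph)
    then have c: "?t e = u" "cas (?h e) p' u" by (auto simp: ep)
    \<comment> \<open>\<open>s\<close> is the orientation of \<open>e\<close> that lies in
      \<open>F\<close>. The rest of the cycle avoids both orientations of \<open>e\<close>, so it
      connects the ends of \<open>s\<close> without using \<open>s\<close>.\<close>
    define s where "s = (if e \<in> F then e else r e)"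
    have s: "s \<in> F" "e = s \<or> e = r s" using eH by (auto simp: s_def)
    have "e \<notin> set p'" "r e \<notin> set p'" using p(2) nr by (auto simp: ep)
    then have "set p' \<subseteq> (F - {s}) \<union> r ` (F - {s})"
      using p'H s by auto
    then have path: "(?h e, ?t e) \<in> (edge_rel ?t ?h (F - {s}))\<^sup>*"
      using rtrancl_edge_rel_if_cas[of "F - {s}" "?h e" p' u] F c by auto
    have sm: "sym ((edge_rel ?t ?h (F - {s}))\<^sup>*)" by (intro sym_rtrancl sym_edge_rel)
    have "(?t s, ?h s) \<in> (edge_rel ?t ?h (F - {s}))\<^sup>*"
      using s(2)
    proof
      assume "e = s" then show ?thesis using path symD[OF sm] by simp
    next
      assume "e = r s" then show ?thesis using path s(1) FX by auto
    qed
    then have "?V \<subseteq> reach ?t ?h (F - {s}) {q}"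
      using conn reach_delete_redundant_edge[of ?t s ?h F "{q}"] by auto
    then have "rooted_forests ?t ?h ?V {q} (F - {s}) \<noteq> {}"
      using finF ends by (intro exists_rooted_forest) auto
    then obtain F' where "F' \<subseteq> F - {s}" "card F' = card (?V - {q})"
      by (auto simp: rooted_forests_def)
    then have "card (?V - {q}) < card F"
      using s finF card_mono[of "F - {s}" F'] card_Diff1_less[of F s] by simp
    then show "card F \<noteq> card (?V - {q})" by simp
  next
    assume ne: "card F \<noteq> card (?V - {q})"
    obtain F' where F': "F' \<subseteq> F" "card F' = card (?V - {q})" "?V \<subseteq> reach ?t ?h F' {q}"
      using exists_rooted_forest[OF finF _ ends conn] by (auto simp: rooted_forests_def)
    then have "F' \<noteq> F" using ne by auto
    then obtain e where e: "e \<in> F" "e \<notin> F'" using F'(1) by blast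
    have F'S: "F' \<subseteq> S" using F' F by auto
    interpret H': wf_digraph "oriented_subgraph F'" by (rule wf_oriented_subgraph[OF F'S])
    have eX: "e \<in> arcs X" using e FX by auto
    have "(q, ?t e) \<in> (edge_rel ?t ?h F')\<^sup>*" "(q, ?h e) \<in> (edge_rel ?t ?h F')\<^sup>*"
      using F'(3) tail_in_verts[OF eX] head_in_verts[OF eX] by (auto simp: reach_def)
    moreover have "sym ((edge_rel ?t ?h F')\<^sup>*)" by (intro sym_rtrancl sym_edge_rel)
    ultimately have "(?h e, ?t e) \<in> (edge_rel ?t ?h F')\<^sup>*" by (meson rtrancl_trans symD)
    then have "?h e \<rightarrow>\<^sup>*\<^bsub>oriented_subgraph F'\<^esub> ?t e"
      using reachable_oriented_subgraph[OF F'S] eX by simp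
    then obtain p where p: "H'.apath (?h e) p (?t e)" by (auto simp: H'.reachable_apath)
    have cas: "cas (?h e) p (?t e)" and d: "distinct (awalk_verts (?h e) p)"
      and pF': "set p \<subseteq> F' \<union> r ` F'"
      using p by (auto simp: H'.apath_def H'.awalk_def cas_oriented_subgraph
        awalk_verts_oriented_subgraph) (auto simp: oriented_subgraph_def)
    have "H.cycle (e # p)"
      unfolding H.cycle_def H.awalk_def cas_oriented_subgraph awalk_verts_oriented_subgraph arcsH
      using cas d pF' F'(1) e eX by (intro exI[of _ "?t e"]) (auto simp: oriented_subgraph_def)
    \<comment> \<open>Only cycles without an arc and its reversal are forbidden in
      \<open>multigraph_tree\<close>. A path never contains such a pair, and \<open>e\<close> adds
      none because \<open>p\<close> uses neither \<open>e\<close> nor \<open>r e\<close>.\<close>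
    moreover have "r f \<notin> set (e # p)" if "f \<in> set (e # p)" for f
    proof -
      have pX: "set p \<subseteq> arcs X" 
      proof -
        have "F' \<union> r ` F' \<subseteq> arcs X" using F'(1) FX by auto
        then show ?thesis using pF' by (rule order_trans[rotated])
      qed
      have "e \<notin> set p" "r e \<notin> set p"
      proof -
        have "e \<noteq> r f" "r e \<noteq> f" "r e \<noteq> r f" if "f \<in> F'" for f
          using that e F' F notS[of f] notS[of e] by (auto simp: arev_eq_iff)
        then show "e \<notin> set p" "r e \<notin> set p" using pF' e(2) by blast+
      qed
      moreover have "r f \<noteq> e" if "f \<in> set p" using \<open>r e \<notin> set p\<close> that by auto
      ultimately show ?thesis using apath_arev_disjoint[OF cas pX d] that arev_neq[OF eX] by auto
    qed
    ultimately show "\<exists>p. H.cycle p \<and> (\<forall>e\<in>set p. r e \<notin> set p)" by blast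
  qed
  then show ?thesis
    using F connected_oriented_subgraph[OF F q]
    unfolding multigraph_tree_def rooted_forests_def by blast
qed

text \<open>Each undirected edge has exactly one orientation in \<open>S\<close>, so intersecting
  with \<open>S\<close> inverts the passage from oriented to undirected edges. Any vertex may serve
  as the root.\<close>

theorem num_spanning_trees_eq_card_rooted_forests:
  assumes q: "q \<in> verts X"
  shows "num_spanning_trees X r = card (rooted_forests (tail X) (head X) (verts X) {q} S)"
proof -
  let ?d = "\<lambda>F. (\<lambda>e. {e, r e}) ` F"
  let ?T = "{F. F \<subseteq> uedges X r \<and> multigraph_tree (X\<lparr>arcs := \<Union>F\<rparr>) r}"
  have Sr: "r e \<notin> S" if "e \<in> S" for e using ori that unfolding orientation_def by blast
  have rS: "r e \<in> S" if "e \<in> arcs X" "e \<notin> S" for e using ori that unfolding orientation_def by blast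
  have un: "\<Union>(?d F) = F \<union> r ` F" for F by auto
  have inter: "S \<inter> \<Union>(?d F) = F" if "F \<subseteq> S" for F using that Sr by (auto simp: un)
  have "bij_betw ?d (rooted_forests (tail X) (head X) (verts X) {q} S) ?T"
  proof (rule bij_betwI')
    fix F G assume FG: "F \<in> rooted_forests (tail X) (head X) (verts X) {q} S"
      "G \<in> rooted_forests (tail X) (head X) (verts X) {q} S"
    then have "F \<subseteq> S" "G \<subseteq> S" by (auto simp: rooted_forests_def)
    then have eq: "S \<inter> \<Union>(?d F) = F" "S \<inter> \<Union>(?d G) = G" by (simp_all only: inter)
    show "(?d F = ?d G) = (F = G)"
    proof
      assume "?d F = ?d G"
      then have "S \<inter> \<Union>(?d F) = S \<inter> \<Union>(?d G)" by (rule arg_cong)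
      then show "F = G" unfolding eq .
    qed (rule arg_cong)
  next
    fix F assume F: "F \<in> rooted_forests (tail X) (head X) (verts X) {q} S"
    then have FS: "F \<subseteq> S" by (simp add: rooted_forests_def)
    have "?d F \<subseteq> uedges X r"
      unfolding uedges_def by (rule image_mono[OF order_trans[OF FS orientation_subset_arcs]])
    moreover have "multigraph_tree (oriented_subgraph F) r"
      using F multigraph_tree_oriented_subgraph[OF FS q] by simp
    ultimately show "?d F \<in> ?T"
      unfolding mem_Collect_eq un oriented_subgraph_def by (rule conjI)
  next
    fix G assume G: "G \<in> ?T"
    define F where "F = S \<inter> \<Union>G"
    have FS: "F \<subseteq> S" by (auto simp: F_def)
    have GX: "\<exists>e\<in>arcs X. x = {e, r e}" if "x \<in> G" for x using G that by (auto simp: uedges_def)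
    have "?d F = G"
    proof (intro Set.set_eqI iffI)
      fix x assume "x \<in> ?d F"
      then obtain s y where s: "x = {s, r s}" "s \<in> S" "y \<in> G" "s \<in> y"
        unfolding F_def by blast
      obtain e where e: "y = {e, r e}" using GX s(3) by blast
      then have "x = y" using s by auto
      then show "x \<in> G" using s by simp
    next
      fix x assume x: "x \<in> G"
      then obtain e where e: "e \<in> arcs X" "x = {e, r e}" using GX by blast
      show "x \<in> ?d F"
      proof (cases "e \<in> S")
        case True
        then have "e \<in> F" using e x unfolding F_def by blast
        then show ?thesis using e(2) by blast
      next
        case False
        then have "r e \<in> F" using rS e x unfolding F_def by blast
        moreover have "x = {r e, r (r e)}" using e by auto
        ultimately show ?thesis by blast
      qed
    qed
    moreover have "F \<in> rooted_forests (tail X) (head X) (verts X) {q} S"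
      using multigraph_tree_oriented_subgraph[OF FS q] G un[of F]
      unfolding \<open>?d F = G\<close> oriented_subgraph_def by simp
    ultimately show "\<exists>F\<in>rooted_forests (tail X) (head X) (verts X) {q} S. G = ?d F" by blast
  qed
  then show ?thesis unfolding num_spanning_trees_def by (rule bij_betw_same_card[symmetric])
qed

lemma num_spanning_trees_pos:
  assumes "Digraph_Component.connected X"
  shows "num_spanning_trees X r > 0"
proof -
  have Sa: "S \<union> r ` S = arcs X"
  proof (intro Set.set_eqI iffI)
    fix e assume "e \<in> arcs X"
    then have "e \<in> S \<or> r e \<in> S" using ori unfolding orientation_def by blast
    moreover have "e = r (r e)" by simp
    ultimately show "e \<in> S \<union> r ` S" by blast
  qed (use orientation_subset_arcs in auto)
  then have "oriented_subgraph S = X" by (simp add: oriented_subgraph_def)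
  obtain q where q: "q \<in> verts X"
    using assms by (auto simp: connected_def strongly_connected_def)
  have V: "verts X \<subseteq> reach (tail X) (head X) S {q}"
    using connected_oriented_subgraph[of S q] q assms \<open>oriented_subgraph S = X\<close> by simp
  have finS: "finite S" using orientation_subset_arcs finite_arcs by (rule finite_subset)
  have "rooted_forests (tail X) (head X) (verts X) {q} S \<noteq> {}"
    by (rule exists_rooted_forest[OF finS finite_verts ends_in_verts[OF subset_refl] V])
  then show ?thesis
    by (simp add: num_spanning_trees_eq_card_rooted_forests[OF q] card_gt_0_iff
      rooted_forests_finite[OF finS])
qed

end

section \<open>Block Vandermonde determinants\<close>

lemma sum_lessThan_mult:
  "(\<Sum>u<n * g. f u) = (\<Sum>t<n. \<Sum>i<g. f (t * g + i))" for f :: "nat \<Rightarrow> 'a :: comm_monoid_add"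
proof (induction n)
  case (Suc n)
  have "(\<Sum>u<Suc n * g. f u) = (\<Sum>u<n * g. f u) + (\<Sum>u=n*g..<n*g+g. f u)"
  proof -
    have "{..<Suc n * g} = {..<n * g} \<union> {n*g..<n*g+g}" by auto
    then show ?thesis by (simp add: sum.union_disjoint ivl_disj_int(2) del: mult_Suc) 
  qed
  also have "(\<Sum>u=n*g..<n*g+g. f u) = (\<Sum>i<g. f (n * g + i))"
    using sum.shift_bounds_nat_ivl[of f 0 "n * g" g] by (simp add: lessThan_atLeast0 add.commute)
  finally show ?case using Suc by simp
qed simp

lemma vandermonde_kernel_trivial:
  fixes z :: "nat \<Rightarrow> 'a :: field"
  assumes inj: "inj_on z {..<n}" and zero: "\<And>k. k < n \<Longrightarrow> (\<Sum>s<n. c s * z k ^ s) = 0" and s: "s < n"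
  shows "c s = 0"
proof -
  define p where "p = (\<Sum>s<n. monom (c s) s)"
  have co: "coeff p i = (if i < n then c i else 0)" for i
    by (simp add: p_def coeff_sum sum.delta' if_distrib cong: if_cong)
  have "p = 0"
  proof (rule ccontr)
    assume "p \<noteq> 0"
    have "degree p < n"
      by (rule degree_lessI) (simp_all add: \<open>p \<noteq> 0\<close> co)
    moreover have "z ` {..<n} \<subseteq> {x. poly p x = 0}"
      using zero unfolding p_def by (auto simp: poly_sum poly_monom)
    then have "n \<le> card {x. poly p x = 0}"
      using card_mono[OF poly_roots_finite[OF \<open>p \<noteq> 0\<close>], of "z ` {..<n}"] card_image[OF inj] by simp
    ultimately show False using card_poly_roots_bound[OF \<open>p \<noteq> 0\<close>] by simp
  qed
  then show ?thesis using co[of s] s by simp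
qed

lemma det_block_diagonal:
  fixes B :: "nat \<Rightarrow> 'a :: idom mat"
  assumes "\<And>k. B k \<in> carrier_mat g g"
  shows "det (mat (n * g) (n * g) (\<lambda>(x, y). if x div g = y div g then B (x div g) $$ (x mod g, y mod g) else 0))
    = (\<Prod>k<n. det (B k))"
proof (induction n)
  case (Suc n)
  let ?D = "\<lambda>n. mat (n * g) (n * g) (\<lambda>(x, y). if x div g = y div g then B (x div g) $$ (x mod g, y mod g) else 0)"
  have "?D (Suc n) = four_block_mat (?D n) (0\<^sub>m (n * g) g) (0\<^sub>m g (n * g)) (B n)"
  proof (rule eq_matI)
    fix x y
    assume "x < dim_row (four_block_mat (?D n) (0\<^sub>m (n * g) g) (0\<^sub>m g (n * g)) (B n))"
      "y < dim_col (four_block_mat (?D n) (0\<^sub>m (n * g) g) (0\<^sub>m g (n * g)) (B n))"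
    then have xy: "x < n * g + g" "y < n * g + g" using assms[of n] by auto
    have big: "w div g = n \<and> w mod g = w - n * g" if "\<not> w < n * g" "w < n * g + g" for w
    proof -
      obtain d where d: "w = n * g + d" using \<open>\<not> w < n * g\<close> le_Suc_ex not_less by blast
      with that have "d < g" by simp
      with d show ?thesis by (simp add: add.commute)
    qed
    have small: "w div g < n" if "w < n * g" for w
      using that by (simp add: less_mult_imp_div_less)
    show "?D (Suc n) $$ (x, y) = four_block_mat (?D n) (0\<^sub>m (n * g) g) (0\<^sub>m g (n * g)) (B n) $$ (x, y)"
      using xy assms[of n] big[of x] big[of y] small[of x] small[of y]
      by (cases "x < n * g"; cases "y < n * g") (auto simp: add.commute)
  qed (use assms[of n] in auto)
  then have "det (?D (Suc n)) = det (?D n) * det (B n)"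
    using assms[of n] by (simp add: det_four_block_mat_lower_left_zero[of _ "n * g" _ g])
  then show ?case using Suc by simp
qed simp

text \<open>\<open>A\<close> acts on the sequences \<open>z k ^ t\<close> through
  \<open>B k\<close>, so \<open>A W = W D\<close> with \<open>W\<close> the Vandermonde matrix
  tensored with the identity of size \<open>g\<close> and \<open>D\<close> block diagonal.
  \<open>W\<close> is invertible because the nodes are distinct. With \<open>g = 1\<close> this
  computes resultants; with the roots of unity as nodes it is the Fourier transform.\<close>

lemma det_block_vandermonde:
  fixes A :: "'a :: field mat" and z :: "nat \<Rightarrow> 'a" and B :: "nat \<Rightarrow> 'a mat"
  assumes A: "A \<in> carrier_mat (n * g) (n * g)" and inj: "inj_on z {..<n}"
    and B: "\<And>k. B k \<in> carrier_mat g g"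
    and key: "\<And>s i j k. s < n \<Longrightarrow> i < g \<Longrightarrow> j < g \<Longrightarrow> k < n \<Longrightarrow>
      (\<Sum>t<n. A $$ (s * g + i, t * g + j) * z k ^ t) = z k ^ s * B k $$ (i, j)"
  shows "det A = (\<Prod>k<n. det (B k))"
proof -
  define W where "W = mat (n * g) (n * g)
    (\<lambda>(x, y). if x mod g = y mod g then z (y div g) ^ (x div g) else 0)"
  define D where "D = mat (n * g) (n * g)
    (\<lambda>(x, y). if x div g = y div g then B (x div g) $$ (x mod g, y mod g) else 0)"
  have carr: "W \<in> carrier_mat (n * g) (n * g)" "D \<in> carrier_mat (n * g) (n * g)"
    by (auto simp: W_def D_def)
  have idx: "t * g + i < n * g" if "t < n" "i < g" for t i
  proof -
    have "t * g + i < Suc t * g" using that by simp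
    also have "\<dots> \<le> n * g" using that by (intro mult_le_mono1) auto
    finally show ?thesis .
  qed
  have "A * W = W * D"
  proof (rule eq_matI)
    fix x y assume "x < dim_row (W * D)" "y < dim_col (W * D)"
    then have xy: "x < n * g" "y < n * g" using carr by auto
    define s i k j where "s = x div g" and "i = x mod g" and "k = y div g" and "j = y mod g"
    have g: "g > 0" using xy by (cases g) auto
    have b: "s < n" "k < n" "i < g" "j < g"
      using xy g by (auto simp: s_def k_def i_def j_def less_mult_imp_div_less)
    have x: "x = s * g + i" and y: "y = k * g + j" by (auto simp: s_def i_def k_def j_def)
    have "(A * W) $$ (x, y) = (\<Sum>u<n * g. A $$ (x, u) * W $$ (u, y))"
      using xy A carr by (simp add: scalar_prod_def lessThan_atLeast0)
    also have "\<dots> = (\<Sum>t<n. \<Sum>m<g. A $$ (x, t * g + m) * W $$ (t * g + m, y))"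
      by (rule sum_lessThan_mult)
    also have "\<dots> = (\<Sum>t<n. \<Sum>m<g. if m = j then A $$ (x, t * g + j) * z k ^ t else 0)"
      using xy g idx by (intro sum.cong refl) (auto simp: W_def k_def j_def)
    also have "\<dots> = (\<Sum>t<n. A $$ (s * g + i, t * g + j) * z k ^ t)"
      using b by (simp add: x)
    also have "\<dots> = z k ^ s * B k $$ (i, j)" by (rule key[OF b(1,3,4,2)])
    finally have L: "(A * W) $$ (x, y) = z k ^ s * B k $$ (i, j)" .
    have "(W * D) $$ (x, y) = (\<Sum>u<n * g. W $$ (x, u) * D $$ (u, y))"
      using xy carr by (simp add: scalar_prod_def lessThan_atLeast0)
    also have "\<dots> = (\<Sum>t<n. \<Sum>m<g. W $$ (x, t * g + m) * D $$ (t * g + m, y))"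
      by (rule sum_lessThan_mult)
    also have "\<dots> = (\<Sum>t<n. \<Sum>m<g. if m = i then (if t = k then z k ^ s * B k $$ (i, j) else 0) else 0)"
      using xy g idx by (intro sum.cong refl) (auto simp: W_def D_def k_def j_def s_def i_def)
    also have "\<dots> = z k ^ s * B k $$ (i, j)" using b by simp
    finally show "(A * W) $$ (x, y) = (W * D) $$ (x, y)" using L by simp
  qed (use A carr in auto)
  then have "det A * det W = det W * det D"
    using det_mult[OF A carr(1)] det_mult[OF carr] by metis
  moreover have "det W \<noteq> 0"
  proof
    assume "det W = 0"
    then have "det W\<^sup>T = 0" using det_transpose[OF carr(1)] by simp
    then obtain v where v: "v \<in> carrier_vec (n * g)" "v \<noteq> 0\<^sub>v (n * g)" "W\<^sup>T *\<^sub>v v = 0\<^sub>v (n * g)"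
      using det_0_iff_vec_prod_zero[of "W\<^sup>T" "n * g"] carr by auto
    \<comment> \<open>For a fixed residue modulo \<open>g\<close>, the entries of \<open>v\<close>
      are the coefficients of a polynomial of degree below \<open>n\<close> that vanishes at all
      \<open>n\<close> nodes.\<close>
    have "v $ x = 0" if x: "x < n * g" for x
    proof -
      have g: "g > 0" using x by (cases g) auto
      define j where "j = x mod g"
      have j: "j < g" using g by (simp add: j_def)
      have "v $ ((x div g) * g + j) = 0"
      proof (rule vandermonde_kernel_trivial[OF inj, where c = "\<lambda>s. v $ (s * g + j)"])
        fix k assume k: "k < n"
        have "0 = (W\<^sup>T *\<^sub>v v) $ (k * g + j)" using v idx[OF k j] by simp
        also have "\<dots> = (\<Sum>u<n * g. W $$ (u, k * g + j) * v $ u)"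
          using idx[OF k j] carr v(1) by (simp add: scalar_prod_def lessThan_atLeast0)
        also have "\<dots> = (\<Sum>t<n. \<Sum>m<g. W $$ (t * g + m, k * g + j) * v $ (t * g + m))"
          by (rule sum_lessThan_mult)
        also have "\<dots> = (\<Sum>t<n. \<Sum>m<g. if m = j then v $ (t * g + j) * z k ^ t else 0)"
          using idx k j by (intro sum.cong refl) (auto simp: W_def)
        also have "\<dots> = (\<Sum>t<n. v $ (t * g + j) * z k ^ t)" using j by simp
        finally show "(\<Sum>t<n. v $ (t * g + j) * z k ^ t) = 0" by simp
      qed (use x in \<open>simp add: less_mult_imp_div_less\<close>)
      then show ?thesis by (simp add: j_def)
    qed
    then have "v = 0\<^sub>v (n * g)" using v(1) by (intro eq_vecI) auto
    then show False using v by simp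
  qed
  ultimately have "det A = det D" by simp
  then show ?thesis unfolding D_def using det_block_diagonal[OF B] by simp
qed

section \<open>Norms from the \<open>l\<close>-power cyclotomic fields\<close>

definition peval :: "int poly \<Rightarrow> complex \<Rightarrow> complex" where
  "peval F z = poly (map_poly of_int F) z"

lemma peval_pCons: "peval (pCons a F) z = of_int a + z * peval F z"
  by (cases "a = 0 \<and> F = 0") (auto simp: peval_def map_poly_pCons)

lemma peval_0 [simp]: "peval 0 z = 0" by (simp add: peval_def)
lemma peval_1 [simp]: "peval 1 z = 1" by (simp add: peval_def)

lemma peval_add [simp]: "peval (F + G) z = peval F z + peval G z"
  by (simp add: peval_def of_int_hom.map_poly_hom_add)

lemma peval_mult [simp]: "peval (F * G) z = peval F z * peval G z"
  by (simp add: peval_def of_int_poly_hom.hom_mult)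

lemma peval_uminus [simp]: "peval (- F) z = - peval F z"
  by (simp add: peval_def of_int_poly_hom.hom_uminus)

lemma peval_diff [simp]: "peval (F - G) z = peval F z - peval G z"
  by (simp add: peval_def of_int_poly_hom.hom_minus)

lemma peval_power [simp]: "peval (F ^ n) z = peval F z ^ n"
  by (induction n) auto

lemma peval_monom [simp]: "peval (monom c n) z = of_int c * z ^ n"
  by (simp add: peval_def map_poly_monom poly_monom)

lemma peval_smult [simp]: "peval (Polynomial.smult c F) z = of_int c * peval F z"
  by (simp add: peval_def of_int_hom.map_poly_hom_smult)

lemma peval_const [simp]: "peval [:c:] z = of_int c"
  by (simp add: peval_pCons)

lemma peval_numeral [simp]: "peval (numeral n) z = numeral n"
  by (simp add: numeral_poly)

lemma peval_sum [simp]: "peval (\<Sum>i\<in>A. F i) z = (\<Sum>i\<in>A. peval (F i) z)"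
  by (induction A rule: infinite_finite_induct) auto

lemma peval_altdef: "degree F < n \<Longrightarrow> peval F z = (\<Sum>i<n. of_int (coeff F i) * z ^ i)"
proof -
  assume n: "degree F < n"
  have "peval F z = (\<Sum>i\<le>degree F. of_int (coeff F i) * z ^ i)"
    by (simp add: peval_def poly_altdef coeff_map_poly degree_map_poly)
  also have "\<dots> = (\<Sum>i<n. of_int (coeff F i) * z ^ i)"
    using n by (intro sum.mono_neutral_left) (auto simp: coeff_eq_0)
  finally show ?thesis .
qed

text \<open>Resultants with a monic polynomial having simple roots, as products over the roots:
  multiplication by \<open>F\<close> on \<open>\<int>[T]/P\<close> is diagonalised over \<open>\<complex>\<close> by the Vandermonde matrix.\<close>

lemma peval_mod_monic:
  fixes P :: "int poly"
  assumes "lead_coeff P = 1"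
  obtains R where "R = 0 \<or> degree R < degree P" "\<And>z. peval P z = 0 \<Longrightarrow> peval F z = peval R z"
proof -
  have "P \<noteq> 0" using assms by auto
  \<comment> \<open>Pseudo-division by a monic polynomial introduces no factor, so this is division
    over the integers.\<close>
  obtain q R where "pseudo_divmod F P = (q, R)" by force
  from pseudo_divmod[OF \<open>P \<noteq> 0\<close> this] have *: "F = P * q + R" "R = 0 \<or> degree R < degree P"
    using assms by auto
  show ?thesis by (rule that[OF *(2)]) (simp add: *(1))
qed

lemma mult_matrix_exists:
  fixes P :: "int poly"
  assumes "lead_coeff P = 1" "degree P = d" "d > 0"
  obtains A :: "int mat" where "A \<in> carrier_mat d d"
    "\<And>s z. s < d \<Longrightarrow> peval P z = 0 \<Longrightarrow> (\<Sum>t<d. of_int (A $$ (s, t)) * z ^ t) = z ^ s * peval F z"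
proof -
  have "\<exists>R. degree R < d \<and> (\<forall>z. peval P z = 0 \<longrightarrow> peval (monom 1 s * F) z = peval R z)" for s
  proof -
    obtain R where "R = 0 \<or> degree R < degree P" "\<And>z. peval P z = 0 \<Longrightarrow> peval (monom 1 s * F) z = peval R z"
      using peval_mod_monic[OF assms(1)] by blast
    then show ?thesis using assms(2,3) by (intro exI[of _ R]) auto
  qed
  then obtain R where R: "\<And>s. degree (R s) < d" "\<And>s z. peval P z = 0 \<Longrightarrow> peval (monom 1 s * F) z = peval (R s) z"
    by metis
  show ?thesis
  proof (rule that[of "mat d d (\<lambda>(s, t). coeff (R s) t)"])
    fix s z assume "s < d" "peval P z = 0"
    then show "(\<Sum>t<d. of_int (mat d d (\<lambda>(s, t). coeff (R s) t) $$ (s, t)) * z ^ t) = z ^ s * peval F z"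
      using R(2)[of z s] peval_altdef[OF R(1), of s z] by simp
  qed simp
qed

lemma prod_roots_eq_det:
  fixes P :: "int poly" and A :: "int mat"
  assumes "finite Z" "card Z = d" "\<And>z. z \<in> Z \<Longrightarrow> peval P z = 0" "A \<in> carrier_mat d d"
    "\<And>s z. s < d \<Longrightarrow> peval P z = 0 \<Longrightarrow> (\<Sum>t<d. of_int (A $$ (s, t)) * z ^ t) = z ^ s * peval F z"
  shows "(\<Prod>z\<in>Z. peval F z) = of_int (det A)"
proof -
  obtain h where h: "bij_betw h {..<d} Z"
    using ex_bij_betw_nat_finite[OF assms(1)] assms(2) by (auto simp: lessThan_atLeast0)
  have "det (map_mat of_int A) = (\<Prod>k<d. det (mat 1 1 (\<lambda>_. peval F (h k))))"
  proof (rule det_block_vandermonde[where g = 1 and z = h])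
    show "inj_on h {..<d}" using h by (simp add: bij_betw_def)
    fix s i j k :: nat assume *: "s < d" "i < 1" "j < 1" "k < d"
    then have "h k \<in> Z" using h by (auto simp: bij_betw_def)
    then show "(\<Sum>t<d. map_mat complex_of_int A $$ (s * 1 + i, t * 1 + j) * h k ^ t) =
        h k ^ s * mat 1 1 (\<lambda>_. peval F (h k)) $$ (i, j)"
      using assms(5)[of s "h k"] assms(3,4) * by auto
  qed (use assms(4) in auto)
  also have "\<dots> = (\<Prod>k<d. peval F (h k))"
    by (intro prod.cong refl) (auto simp: det_single)
  also have "\<dots> = (\<Prod>z\<in>Z. peval F z)" by (rule prod.reindex_bij_betw[OF h])
  finally show ?thesis by (simp add: of_int_hom.hom_det)
qed

lemma det_cong_mod:
  fixes A B :: "int mat"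
  assumes "A \<in> carrier_mat d d" "B \<in> carrier_mat d d"
    "\<And>i j. i < d \<Longrightarrow> j < d \<Longrightarrow> p dvd A $$ (i, j) - B $$ (i, j)"
  shows "p dvd det A - det B"
proof -
  have "[det A = det B] (mod p)"
    unfolding det_def'[OF assms(1)] det_def'[OF assms(2)]
  proof (intro cong_sum cong_mult cong_refl cong_prod)
    fix f i assume "f \<in> {f. f permutes {0..<d}}" "i \<in> {0..<d}"
    then have "i < d" "f i < d" using permutes_in_image[of f "{0..<d}" i] by auto
    then show "[A $$ (i, f i) = B $$ (i, f i)] (mod p)"
      using assms(3) by (simp add: cong_iff_dvd_diff)
  qed
  then show ?thesis by (simp add: cong_iff_dvd_diff)
qed

lemma prod_roots_int:
  fixes P F :: "int poly"
  assumes "lead_coeff P = 1" "degree P > 0" "finite Z" "card Z = degree P" "\<And>z. z \<in> Z \<Longrightarrow> peval P z = 0"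
  shows "(\<Prod>z\<in>Z. peval F z) \<in> \<int>"
  using mult_matrix_exists[OF assms(1) refl assms(2), of F] prod_roots_eq_det[OF assms(3-5)]
  by (metis Ints_of_int)

text \<open>Multiplication by \<open>F + p C\<close> has the matrix \<open>A + p B\<close>, which
  agrees with \<open>A\<close> entrywise modulo \<open>p\<close>; hence so do the
  determinants.\<close>

lemma prod_roots_cong:
  fixes P F C :: "int poly"
  assumes "lead_coeff P = 1" "degree P > 0" "finite Z" "card Z = degree P" "\<And>z. z \<in> Z \<Longrightarrow> peval P z = 0"
  obtains m m' :: int where "(\<Prod>z\<in>Z. peval F z) = of_int m" "(\<Prod>z\<in>Z. peval (F + [:p:] * C) z) = of_int m'"
    "p dvd m' - m"
proof -
  let ?d = "degree P"
  obtain A where A: "A \<in> carrier_mat ?d ?d"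
    "\<And>s z. s < ?d \<Longrightarrow> peval P z = 0 \<Longrightarrow> (\<Sum>t<?d. of_int (A $$ (s, t)) * z ^ t) = z ^ s * peval F z"
    using mult_matrix_exists[OF assms(1) refl assms(2), of F] by blast
  obtain B where B: "B \<in> carrier_mat ?d ?d"
    "\<And>s z. s < ?d \<Longrightarrow> peval P z = 0 \<Longrightarrow> (\<Sum>t<?d. of_int (B $$ (s, t)) * z ^ t) = z ^ s * peval C z"
    using mult_matrix_exists[OF assms(1) refl assms(2), of C] by blast
  have AB: "A + p \<cdot>\<^sub>m B \<in> carrier_mat ?d ?d" using A B by auto
  have "(\<Prod>z\<in>Z. peval (F + [:p:] * C) z) = of_int (det (A + p \<cdot>\<^sub>m B))"
  proof (rule prod_roots_eq_det[OF assms(3-5) AB])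
    fix s z assume sz: "s < ?d" "peval P z = 0"
    have "(\<Sum>t<?d. of_int ((A + p \<cdot>\<^sub>m B) $$ (s, t)) * z ^ t) =
        (\<Sum>t<?d. of_int (A $$ (s, t)) * z ^ t) + of_int p * (\<Sum>t<?d. of_int (B $$ (s, t)) * z ^ t)"
      using A(1) B(1) sz by (simp add: algebra_simps sum.distrib sum_distrib_left)
    then show "(\<Sum>t<?d. of_int ((A + p \<cdot>\<^sub>m B) $$ (s, t)) * z ^ t) = z ^ s * peval (F + [:p:] * C) z"
      using A(2)[OF sz] B(2)[OF sz] by (simp add: algebra_simps)
  qed auto
  moreover have "p dvd det (A + p \<cdot>\<^sub>m B) - det A"
    by (rule det_cong_mod[OF AB A(1)]) (use A(1) B(1) in auto)
  ultimately show ?thesis using that prod_roots_eq_det[OF assms(3-5) A] by blast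
qed

section \<open>Roots of unity of order l^k and the norm N_k\<close>

definition prim_roots :: "nat \<Rightarrow> nat \<Rightarrow> complex set" where
  "prim_roots l k = {z. z ^ (l ^ k) = 1 \<and> z ^ (l ^ (k - 1)) \<noteq> 1}"

text \<open>The cyclotomic polynomial of order \<open>l ^ k\<close>, for \<open>k \<ge> 1\<close>:
  the one of order \<open>l\<close> with \<open>T ^ (l ^ (k - 1))\<close> substituted.\<close>

definition cyc_poly :: "nat \<Rightarrow> nat \<Rightarrow> int poly" where
  "cyc_poly l k = (\<Sum>i<l. monom 1 (i * l ^ (k - 1)))"

text \<open>The product is an integer (\<open>cyc_norm_eq\<close>); the floor of its real part recovers it.\<close>

definition cyc_norm :: "nat \<Rightarrow> nat \<Rightarrow> int poly \<Rightarrow> int" where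
  "cyc_norm l k F = \<lfloor>Re (\<Prod>z\<in>prim_roots l k. peval F z)\<rfloor>"

context
  fixes l :: nat
  assumes l: "prime l"
begin

lemma peval_cyc_poly: "peval (cyc_poly l k) z = (\<Sum>i<l. (z ^ (l ^ (k - 1))) ^ i)"
  by (simp add: cyc_poly_def power_mult[symmetric] mult.commute)

lemma power_l_Suc: "k \<ge> 1 \<Longrightarrow> l ^ k = l ^ (k - 1) * l"
  by (cases k) auto

lemma cyc_poly_root:
  assumes "k \<ge> 1" "z \<in> prim_roots l k" shows "peval (cyc_poly l k) z = 0"
proof -
  let ?x = "z ^ (l ^ (k - 1))"
  have "?x ^ l = z ^ (l ^ k)" by (simp only: power_mult[symmetric] power_l_Suc[OF assms(1)])
  then have "?x \<noteq> 1" "?x ^ l = 1" using assms(2) by (auto simp: prim_roots_def)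
  then show ?thesis by (simp add: peval_cyc_poly geometric_sum)
qed

lemma finite_prim_roots: "finite (prim_roots l k)"
  by (rule finite_subset[OF _ finite_roots_unity[of "l ^ k"]]) (use prime_gt_0_nat[OF l] in \<open>auto simp: prim_roots_def\<close>)

lemma card_prim_roots:
  assumes "k \<ge> 1" shows "card (prim_roots l k) = (l - 1) * l ^ (k - 1)"
proof -
  let ?A = "{z::complex. z ^ (l ^ k) = 1}" and ?B = "{z::complex. z ^ (l ^ (k - 1)) = 1}"
  have "?B \<subseteq> ?A" by (auto simp: power_l_Suc[OF assms] power_mult)
  moreover have "prim_roots l k = ?A - ?B" by (auto simp: prim_roots_def)
  moreover have "finite ?B" using finite_roots_unity[of "l ^ (k - 1)"] prime_gt_0_nat[OF l] by auto
  ultimately have "card (prim_roots l k) = l ^ k - l ^ (k - 1)"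
    using card_roots_unity_eq[of "l ^ k"] card_roots_unity_eq[of "l ^ (k - 1)"] prime_gt_0_nat[OF l]
    by (simp add: card_Diff_subset)
  then show ?thesis by (simp add: power_l_Suc[OF assms] algebra_simps)
qed

lemma degree_lead_coeff_cyc_poly:
  assumes "k \<ge> 1"
  shows "degree (cyc_poly l k) = (l - 1) * l ^ (k - 1)" "lead_coeff (cyc_poly l k) = 1"
proof -
  let ?q = "l ^ (k - 1)"
  have q: "?q > 0" using prime_gt_0_nat[OF l] by simp
  have co: "coeff (cyc_poly l k) ((l - 1) * ?q) = 1"
  proof -
    have "coeff (cyc_poly l k) ((l - 1) * ?q) = (\<Sum>i<l. if i = l - 1 then 1 else 0)"
      unfolding cyc_poly_def coeff_sum
    proof (intro sum.cong refl)
      fix i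
      have "i * ?q = (l - 1) * ?q \<longleftrightarrow> i = l - 1" using q by (simp only: mult_cancel2) auto
      then show "coeff (monom 1 (i * ?q)) ((l - 1) * ?q) = (if i = l - 1 then 1 else 0 :: int)"
        by (simp only: coeff_monom)
    qed
    also have "\<dots> = 1" using prime_gt_0_nat[OF l] by simp
    finally show ?thesis .
  qed
  have "degree (cyc_poly l k) \<le> (l - 1) * ?q"
    unfolding cyc_poly_def
    by (intro degree_sum_le) (auto intro!: order.trans[OF degree_monom_le] mult_le_mono1)
  moreover have "(l - 1) * ?q \<le> degree (cyc_poly l k)" using co by (intro le_degree) auto
  ultimately show "degree (cyc_poly l k) = (l - 1) * ?q" by simp
  then show "lead_coeff (cyc_poly l k) = 1" using co by simp
qed

lemma cyc_poly_simple_roots: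
  assumes "k \<ge> 1"
  shows "lead_coeff (cyc_poly l k) = 1" "degree (cyc_poly l k) > 0" "finite (prim_roots l k)"
    "card (prim_roots l k) = degree (cyc_poly l k)"
    "\<And>z. z \<in> prim_roots l k \<Longrightarrow> peval (cyc_poly l k) z = 0"
  using degree_lead_coeff_cyc_poly[OF assms] card_prim_roots[OF assms] finite_prim_roots
    cyc_poly_root[OF assms] prime_gt_1_nat[OF l] by auto

lemma prod_prim_roots:
  assumes "k \<ge> 1"
  shows "(\<Prod>z\<in>prim_roots l k. x - z) = (\<Sum>i<l. (x ^ (l ^ (k - 1))) ^ i)"
proof -
  let ?P = "map_poly complex_of_int (cyc_poly l k)" and ?Q = "\<Prod>z\<in>prim_roots l k. [:- z, 1:]"
  note f = cyc_poly_simple_roots[OF assms]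
  have dQ: "degree ?Q = card (prim_roots l k)" by (simp add: degree_prod_eq_sum_degree)
  have dP: "degree ?P = card (prim_roots l k)" using f(4) by simp
  have "?P = ?Q"
  proof (rule poly_eqI_degree_lead_coeff[where n = "card (prim_roots l k)" and A = "prim_roots l k"])
    have "lead_coeff ?Q = 1" by (simp add: lead_coeff_prod)
    then have "coeff ?Q (card (prim_roots l k)) = 1" using dQ by simp
    moreover have "coeff ?P (card (prim_roots l k)) = 1" using f(1,4) by (simp add: coeff_map_poly)
    ultimately show "coeff ?P (card (prim_roots l k)) = coeff ?Q (card (prim_roots l k))" by simp
    fix z assume "z \<in> prim_roots l k"
    then show "poly ?P z = poly ?Q z"
      using f(3,5) by (auto simp: peval_def poly_prod prod_zero_iff)
  qed (use dP dQ in auto)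
  then have "poly ?P x = poly ?Q x" by simp
  then show ?thesis by (simp add: peval_cyc_poly[unfolded peval_def] poly_prod algebra_simps)
qed

lemma cyc_norm_eq:
  assumes "k \<ge> 1" shows "of_int (cyc_norm l k F) = (\<Prod>z\<in>prim_roots l k. peval F z)"
  using prod_roots_int[OF cyc_poly_simple_roots[OF assms], of F] by (auto simp: cyc_norm_def elim!: Ints_cases)

lemma cyc_norm_eqI:
  assumes "k \<ge> 1" "\<And>z. z \<in> prim_roots l k \<Longrightarrow> peval F z = peval G z"
  shows "cyc_norm l k F = cyc_norm l k G"
  using assms(2) unfolding cyc_norm_def by (metis (no_types, lifting) prod.cong)

lemma cyc_norm_mult:
  assumes "k \<ge> 1" shows "cyc_norm l k (F * G) = cyc_norm l k F * cyc_norm l k G"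
proof -
  have "complex_of_int (cyc_norm l k (F * G)) = of_int (cyc_norm l k F * cyc_norm l k G)"
    by (simp add: cyc_norm_eq[OF assms] prod.distrib)
  then show ?thesis by (simp only: of_int_eq_iff)
qed

lemma cyc_norm_1: "cyc_norm l k 1 = 1"
  by (simp add: cyc_norm_def)

lemma cyc_norm_power:
  assumes "k \<ge> 1" shows "cyc_norm l k (F ^ n) = cyc_norm l k F ^ n"
  by (induction n) (simp_all add: cyc_norm_mult[OF assms] cyc_norm_1)

lemma cyc_norm_const:
  assumes "k \<ge> 1" shows "cyc_norm l k [:c:] = c ^ card (prim_roots l k)"
proof -
  have "complex_of_int (cyc_norm l k [:c:]) = of_int (c ^ card (prim_roots l k))"
    by (simp add: cyc_norm_eq[OF assms])
  then show ?thesis by (simp only: of_int_eq_iff)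
qed

lemma cyc_norm_cong:
  assumes "k \<ge> 1" shows "p dvd cyc_norm l k (F + [:p:] * C) - cyc_norm l k F"
proof -
  obtain m m' :: int where "(\<Prod>z\<in>prim_roots l k. peval F z) = of_int m"
    "(\<Prod>z\<in>prim_roots l k. peval (F + [:p:] * C) z) = of_int m'" "p dvd m' - m"
    using prod_roots_cong[OF cyc_poly_simple_roots[OF assms]] by blast
  then show ?thesis unfolding cyc_norm_def by simp
qed

lemma cyc_norm_X:
  assumes "k \<ge> 1" shows "\<bar>cyc_norm l k (monom 1 1)\<bar> = 1"
proof -
  have "norm z = 1" if "z \<in> prim_roots l k" for z
  proof -
    have "norm z ^ (l ^ k) = 1 ^ (l ^ k)" using that by (simp add: prim_roots_def norm_power[symmetric])
    then show ?thesis by (rule power_eq_imp_eq_base) (use prime_gt_0_nat[OF l] in auto)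
  qed
  then have "norm (complex_of_int (cyc_norm l k (monom 1 1))) = 1"
    by (simp add: cyc_norm_eq[OF assms] prod_norm[symmetric])
  then show ?thesis by (metis norm_of_int of_int_abs of_int_eq_1_iff)
qed

end

lemma power_swap: "(z ^ a) ^ b = (z ^ b) ^ a" for z :: "'a :: monoid_mult"
  by (simp add: mult.commute flip: power_mult)

context
  fixes l :: nat
  assumes l: "prime l"
begin

lemma prod_l_power_roots_unity:
  fixes h :: "complex \<Rightarrow> 'a :: comm_monoid_mult"
  shows "(\<Prod>z | z ^ (l ^ n) = 1. h z) = h 1 * (\<Prod>k=1..n. \<Prod>z\<in>prim_roots l k. h z)"
proof (induction n)
  case 0
  have "{z::complex. z ^ (l ^ 0) = 1} = {1}" by auto
  then show ?case by simp
next
  case (Suc n)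
  have "{z::complex. z ^ (l ^ Suc n) = 1} = {z. z ^ (l ^ n) = 1} \<union> prim_roots l (Suc n)"
  proof -
    have "z ^ (l ^ Suc n) = (z ^ (l ^ n)) ^ l" for z :: complex by (simp only: power_Suc2 power_mult)
    then show ?thesis by (auto simp: prim_roots_def simp del: power_Suc)
  qed
  moreover have "finite {z::complex. z ^ (l ^ n) = 1}"
    using finite_roots_unity[of "l ^ n"] prime_gt_0_nat[OF l] by simp
  moreover have "{z::complex. z ^ (l ^ n) = 1} \<inter> prim_roots l (Suc n) = {}"
    by (auto simp: prim_roots_def)
  ultimately show ?case
    using Suc finite_prim_roots[OF l, of "Suc n"] by (simp add: prod.union_disjoint mult.assoc)
qed

lemma prod_l_power_roots_unity_linear:
  "(\<Prod>w | w ^ (l ^ n) = 1. x - w) = x ^ (l ^ n) - (1::complex)"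
proof (induction n)
  case 0
  have "{z::complex. z ^ (l ^ 0) = 1} = {1}" by auto
  then show ?case by simp
next
  case (Suc n)
  have "(\<Prod>w | w ^ (l ^ Suc n) = 1. x - w) = (\<Prod>w | w ^ (l ^ n) = 1. x - w) * (\<Prod>z\<in>prim_roots l (Suc n). x - z)"
    by (simp only: prod_l_power_roots_unity) (simp add: mult.assoc)
  also have "\<dots> = (x ^ (l ^ n) - 1) * (\<Sum>i<l. (x ^ (l ^ n)) ^ i)"
    using prod_prim_roots[OF l, of "Suc n" x] Suc by simp
  also have "\<dots> = (x ^ (l ^ n)) ^ l - 1" by (rule power_diff_1_eq[symmetric])
  finally show ?case by (simp add: power_mult[symmetric] mult.commute)
qed

lemma power_coprime_inverse:
  assumes "coprime s l" "k \<ge> 1"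
  obtains u where "\<And>z::complex. z ^ (l ^ k) = 1 \<Longrightarrow> (z ^ s) ^ u = z"
proof -
  have "coprime s (l ^ k)" using assms by simp
  then obtain u where u: "[s * u = 1] (mod l ^ k)" using cong_solve_coprime_nat[of s "l ^ k"] by auto
  have N: "l ^ k > 1" by (rule one_less_power) (use prime_gt_1_nat[OF l] assms(2) in auto)
  have "(z ^ s) ^ u = z" if z: "z ^ (l ^ k) = 1" for z :: complex
  proof -
    have "s * u mod l ^ k = 1 mod l ^ k" using u by (simp only: cong_def)
    also have "\<dots> = 1" using N by (rule mod_less)
    finally have "s * u mod l ^ k = 1" .
    then have "s * u = l ^ k * (s * u div l ^ k) + 1" using mult_div_mod_eq[of "l ^ k" "s * u"] by simp
    then have "z ^ (s * u) = z ^ (l ^ k * (s * u div l ^ k) + 1)" by (rule arg_cong)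
    also have "\<dots> = (z ^ (l ^ k)) ^ (s * u div l ^ k) * z" by (simp only: power_add power_mult power_one_right)
    finally show ?thesis using z by (simp add: power_mult)
  qed
  then show ?thesis using that by blast
qed

lemma power_coprime_prim_roots:
  assumes "coprime s l" "k \<ge> 1" "z \<in> prim_roots l k"
  shows "z ^ s \<in> prim_roots l k"
proof -
  obtain u where u: "\<And>z::complex. z ^ (l ^ k) = 1 \<Longrightarrow> (z ^ s) ^ u = z"
    using power_coprime_inverse[OF assms(1,2)] by blast
  have z: "z ^ (l ^ k) = 1" "z ^ (l ^ (k - 1)) \<noteq> 1" using assms(3) by (auto simp: prim_roots_def)
  have "(z ^ s) ^ (l ^ k) = 1" using z by (simp add: power_swap[of z s])
  moreover have "(z ^ s) ^ (l ^ (k - 1)) \<noteq> 1"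
  proof
    assume "(z ^ s) ^ (l ^ (k - 1)) = 1"
    then have "((z ^ s) ^ u) ^ (l ^ (k - 1)) = 1" by (simp only: power_swap[of "z ^ s" u] power_one)
    then show False using u[OF z(1)] z by simp
  qed
  ultimately show ?thesis by (simp add: prim_roots_def)
qed

lemma power_coprime_bij_prim_roots:
  assumes "coprime s l" "k \<ge> 1"
  shows "bij_betw (\<lambda>z. z ^ s) (prim_roots l k) (prim_roots l k)"
proof -
  obtain u where u: "\<And>z::complex. z ^ (l ^ k) = 1 \<Longrightarrow> (z ^ s) ^ u = z"
    using power_coprime_inverse[OF assms] by blast
  have inj: "inj_on (\<lambda>z. z ^ s) (prim_roots l k)"
    using u by (intro inj_on_inverseI[where g = "\<lambda>z. z ^ u"]) (auto simp: prim_roots_def)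
  moreover have "(\<lambda>z. z ^ s) ` prim_roots l k \<subseteq> prim_roots l k"
    using power_coprime_prim_roots[OF assms] by auto
  ultimately show ?thesis
    using endo_inj_surj[OF finite_prim_roots[OF l]] by (simp add: bij_betw_def)
qed

lemma power_l_prim_roots:
  assumes "t < k" "z \<in> prim_roots l k"
  shows "z ^ (l ^ t) \<in> prim_roots l (k - t)"
proof -
  have "l ^ t * l ^ (k - t) = l ^ k" "l ^ t * l ^ (k - t - 1) = l ^ (k - 1)"
    using assms(1) by (simp_all flip: power_add)
  then show ?thesis using assms(2) by (auto simp: prim_roots_def simp flip: power_mult)
qed

text \<open>Raising to the power \<open>s'\<close> permutes the primitive roots, so only
  \<open>T ^ (l ^ t) - 1\<close> matters. It splits over the \<open>l ^ t\<close> solutions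
  \<open>w\<close> of \<open>w ^ (l ^ t) = 1\<close>. Each contributes the cyclotomic value at
  \<open>w\<close>, which is \<open>l\<close> because \<open>t < k\<close> gives
  \<open>w ^ (l ^ (k - 1)) = 1\<close>. That the result is independent of \<open>k\<close> serves
  both directions of the equivalence.\<close>

lemma cyc_norm_X_power_minus_1:
  assumes "coprime s' l" "t < k"
  shows "\<bar>cyc_norm l k (monom 1 (l ^ t * s') - 1)\<bar> = int (l ^ (l ^ t))"
proof -
  have k: "k \<ge> 1" using assms by simp
  let ?Z = "prim_roots l k" and ?W = "{w::complex. w ^ (l ^ t) = 1}"
  have "norm (complex_of_int (cyc_norm l k (monom 1 (l ^ t * s') - 1))) = norm (\<Prod>z\<in>?Z. (z ^ s') ^ (l ^ t) - 1)"
    by (simp add: cyc_norm_eq[OF l k] mult.commute flip: power_mult)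
  also have "\<dots> = norm (\<Prod>z\<in>?Z. z ^ (l ^ t) - 1)"
    using prod.reindex_bij_betw[OF power_coprime_bij_prim_roots[OF assms(1) k], of "\<lambda>z. z ^ (l ^ t) - 1"]
    by simp
  also have "\<dots> = norm (\<Prod>z\<in>?Z. \<Prod>w\<in>?W. z - w)"
    by (simp add: prod_l_power_roots_unity_linear)
  also have "\<dots> = norm (\<Prod>w\<in>?W. \<Prod>z\<in>?Z. z - w)" by (subst prod.swap) simp
  also have "\<dots> = (\<Prod>w\<in>?W. norm (\<Prod>z\<in>?Z. w - z))"
    by (simp add: norm_minus_commute flip: prod_norm)
  also have "\<dots> = (\<Prod>w\<in>?W. real l)"
  proof (intro prod.cong refl)
    fix w assume w: "w \<in> ?W"
    have "l ^ (k - 1) = l ^ t * l ^ (k - 1 - t)" using assms(2) by (simp flip: power_add)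
    then have "w ^ (l ^ (k - 1)) = 1" using w by (simp add: power_mult)
    then show "norm (\<Prod>z\<in>?Z. w - z) = real l" by (simp add: prod_prim_roots[OF l k])
  qed
  also have "\<dots> = real (l ^ (l ^ t))"
    using card_roots_unity_eq[of "l ^ t"] prime_gt_0_nat[OF l] by simp
  finally have "real_of_int \<bar>cyc_norm l k (monom 1 (l ^ t * s') - 1)\<bar> = real_of_int (int (l ^ (l ^ t)))"
    by simp
  then show ?thesis by (simp only: of_int_eq_iff)
qed

end

section \<open>Reduction modulo a prime and modulo W\<close>

lemma reduce_mod_prime:
  fixes W F :: "int poly" and p :: int
  assumes p: "p > 0" and u: "[coeff W d * u = 1] (mod p)" and d: "\<And>i. i > d \<Longrightarrow> p dvd coeff W i"
    and F: "\<And>i. i \<ge> d + n \<Longrightarrow> p dvd coeff F i"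
  shows "\<exists>Q C R. F = W * Q + [:p:] * C + R \<and> (\<forall>i\<ge>d. coeff R i = 0) \<and> (\<forall>i. coeff R i \<in> {0..<p})"
  using F
proof (induction n arbitrary: F)
  case 0
  \<comment> \<open>Residues are normalised to \<open>{0..<p}\<close>, so that only finitely many
    remainders exist.\<close>
  define R where "R = map_poly (\<lambda>c. c mod p) F"
  have co: "coeff R i = coeff F i mod p" for i by (simp add: R_def coeff_map_poly)
  have "[:p:] dvd F - R" unfolding const_poly_dvd_iff by (simp add: co mod_eq_dvd_iff[symmetric])
  then obtain C where "F - R = [:p:] * C" by (elim dvdE)
  then have "F = W * 0 + [:p:] * C + R" by (simp add: algebra_simps)
  moreover have "\<forall>i\<ge>d. coeff R i = 0" using 0 by (simp add: co)
  moreover have "\<forall>i. coeff R i \<in> {0..<p}" using p by (simp add: co)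
  ultimately show ?case by blast
next
  case (Suc n)
  \<comment> \<open>\<open>u\<close> inverts the top coefficient of \<open>W\<close> modulo
    \<open>p\<close>, so this multiple of \<open>W\<close> cancels the coefficient at
    \<open>d + n\<close> only modulo \<open>p\<close>. This is why the induction carries
    divisibility of coefficients and not a degree bound.\<close>
  define c where "c = coeff F (d + n) * u"
  define F' where "F' = F - W * monom c n"
  have co: "coeff F' i = coeff F i - c * coeff W (i - n)" if "i \<ge> n" for i
    using that by (simp add: F'_def mult.commute[of W] coeff_monom_mult)
  have "p dvd coeff F' i" if i: "i \<ge> d + n" for i
  proof (cases "i = d + n")
    case True
    have "p dvd 1 - coeff W d * u" using u by (simp add: cong_iff_dvd_diff dvd_diff_commute)
    then have "p dvd coeff F (d + n) * (1 - coeff W d * u)" by simp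
    then show ?thesis using True by (simp add: co c_def algebra_simps)
  next
    case False
    then show ?thesis using Suc.prems[of i] d[of "i - n"] i by (simp add: co)
  qed
  then obtain Q C R where "F' = W * Q + [:p:] * C + R" and R: "\<forall>i\<ge>d. coeff R i = 0" "\<forall>i. coeff R i \<in> {0..<p}"
    using Suc.IH by blast
  then have "F = W * (Q + monom c n) + [:p:] * C + R" by (simp add: F'_def algebra_simps)
  then show ?case using R by blast
qed

text \<open>Modulo \<open>p\<close> the powers of \<open>T\<close> take finitely many values modulo \<open>W\<close>, so two of them agree.\<close>

lemma power_T_periodic_mod_prime:
  fixes W :: "int poly" and p :: nat
  assumes p: "prime p" and W: "\<not> int p dvd coeff W i0"
  obtains a s Q C where "s > 0" "monom 1 a * (monom 1 s - 1) = W * Q + [:int p:] * C"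
proof -
  let ?p = "int p"
  have p0: "?p > 0" using prime_gt_0_nat[OF p] by simp
  define I where "I = {i. \<not> ?p dvd coeff W i}"
  have "I \<subseteq> {..degree W}" by (auto simp: I_def intro!: le_degree)
  then have finI: "finite I" by (rule finite_subset) simp
  \<comment> \<open>\<open>d\<close> is the degree of \<open>W\<close> modulo \<open>p\<close>,
    which may be smaller than \<open>degree W\<close>.\<close>
  define d where "d = Max I"
  have "I \<noteq> {}" using W by (auto simp: I_def)
  then have dI: "d \<in> I" unfolding d_def using finI by (rule Max_in[rotated])
  have d: "?p dvd coeff W i" if "i > d" for i
    using that Max_ge[OF finI, of i] by (auto simp: d_def I_def)
  have "coprime (coeff W d) ?p"
    using dI p by (simp add: I_def coprime_commute prime_imp_coprime)
  then obtain u where u: "[coeff W d * u = 1] (mod ?p)" using cong_solve_coprime_int by blast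
  have "\<exists>Q C R. monom 1 m = W * Q + [:?p:] * C + R \<and> (\<forall>i\<ge>d. coeff R i = 0) \<and> (\<forall>i. coeff R i \<in> {0..<?p})"
    for m
    by (rule reduce_mod_prime[OF p0 u d, where n = "Suc m"]) auto
  then obtain Q C R where QCR: "\<And>m. monom 1 m = W * Q m + [:?p:] * C m + R m"
    and R: "\<And>m i. i \<ge> d \<Longrightarrow> coeff (R m) i = 0" "\<And>m i. coeff (R m) i \<in> {0..<?p}"
    by metis
  have "range R \<subseteq> Poly ` {xs. set xs \<subseteq> {0..<?p} \<and> length xs = d}"
  proof
    fix q assume "q \<in> range R"
    then obtain m where q: "q = R m" by auto
    have "q = Poly (map (coeff q) [0..<d])"
      by (rule poly_eqI) (auto simp: coeff_Poly nth_default_def q R)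
    moreover have "set (map (coeff q) [0..<d]) \<subseteq> {0..<?p}" using R(2) by (auto simp: q)
    ultimately show "q \<in> Poly ` {xs. set xs \<subseteq> {0..<?p} \<and> length xs = d}"
      by (intro image_eqI[of _ _ "map (coeff q) [0..<d]"]) auto
  qed
  moreover have "finite {xs. set xs \<subseteq> {0..<?p} \<and> length xs = d}" by (rule finite_lists_length_eq) simp
  ultimately have "finite (range R)" by (meson finite_imageI finite_subset)
  then have "\<not> inj R" by (meson range_inj_infinite)
  then obtain i j where "i \<noteq> j" "R i = R j" by (auto simp: inj_def)
  then obtain i j where ij: "i < j" "R i = R j" by (cases i j rule: linorder_cases) auto
  have "monom 1 i * (monom 1 (j - i) - 1) = monom 1 j - (monom 1 i :: int poly)"
    using ij by (simp add: algebra_simps mult_monom)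
  also have "\<dots> = W * (Q j - Q i) + [:?p:] * (C j - C i)"
    using QCR[of i] QCR[of j] ij by (simp add: algebra_simps)
  finally show ?thesis using that[of "j - i"] ij(1) by auto
qed

lemma freshmans_dream_dvd:
  fixes x y :: "'a :: comm_ring_1"
  assumes "prime l"
  shows "of_nat l dvd (x + y) ^ l - (x ^ l + y ^ l)"
proof -
  have l0: "l > 0" using prime_gt_0_nat[OF assms] .
  have "(x + y) ^ l = (\<Sum>k\<le>l. of_nat (l choose k) * x ^ k * y ^ (l - k))" by (rule binomial_ring)
  also have "\<dots> = (\<Sum>k\<in>{0,l}. of_nat (l choose k) * x ^ k * y ^ (l - k)) +
      (\<Sum>k\<in>{..l} - {0,l}. of_nat (l choose k) * x ^ k * y ^ (l - k))"
    by (subst add.commute, rule sum.subset_diff) auto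
  also have "(\<Sum>k\<in>{0,l}. of_nat (l choose k) * x ^ k * y ^ (l - k)) = x ^ l + y ^ l"
    using l0 by (simp add: add.commute)
  finally have "(x + y) ^ l - (x ^ l + y ^ l) =
      (\<Sum>k\<in>{..l} - {0,l}. of_nat (l choose k) * x ^ k * y ^ (l - k))" by simp
  also have "of_nat l dvd \<dots>"
  proof (rule dvd_sum)
    fix k assume "k \<in> {..l} - {0, l}"
    then have "l dvd (l choose k)" by (intro dvd_choose_prime) (use assms in auto)
    then have "(of_nat l :: 'a) dvd of_nat (l choose k)" by (auto elim!: dvdE)
    then show "(of_nat l :: 'a) dvd of_nat (l choose k) * x ^ k * y ^ (l - k)" by (intro dvd_mult2)
  qed
  finally show ?thesis .
qed

text \<open>The inner binomial coefficients of an \<open>l\<close>-th power vanish modulo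
  \<open>l\<close>; iteration gives all \<open>k\<close>. The use is that \<open>x - 1\<close>
  becomes nilpotent modulo \<open>l\<close> once \<open>x ^ (l ^ k) = 1\<close>.\<close>

lemma power_diff_one_mod_prime:
  fixes x :: "'a :: comm_ring_1"
  assumes "prime l"
  shows "of_nat l dvd (x - 1) ^ (l ^ k) - (x ^ (l ^ k) - 1)"
proof (induction k)
  case (Suc k)
  define y where "y = x ^ (l ^ k)"
  obtain h where "(x - 1) ^ (l ^ k) - (x ^ (l ^ k) - 1) = of_nat l * h" using Suc by (elim dvdE)
  then have h: "(x - 1) ^ (l ^ k) = (y - 1) + of_nat l * h" by (simp add: y_def algebra_simps)
  have l0: "l > 0" using prime_gt_0_nat[OF assms] .
  have 1: "of_nat l dvd (x - 1) ^ (l ^ Suc k) - ((y - 1) ^ l + (of_nat l * h) ^ l)"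
    using freshmans_dream_dvd[OF assms, of "y - 1" "of_nat l * h"]
    by (simp add: power_mult[of _ "l ^ k" l] mult.commute[of l] h)
  have 2: "of_nat l dvd (of_nat l * h) ^ l" using l0 by (simp add: power_mult_distrib dvd_mult2 dvd_power)
  have 3: "of_nat l dvd (y - 1) ^ l - (y ^ l + (-1) ^ l)"
    using freshmans_dream_dvd[OF assms, of y "-1"] by simp
  have 4: "of_nat l dvd (-1) ^ l - (-1 :: 'a)"
  proof (cases "l = 2")
    case False
    then have "l > 2" using prime_ge_2_nat[OF assms] by simp
    then have "odd l" by (rule prime_odd_nat[OF assms])
    then show ?thesis by simp
  next
    case True
    then have "(-1) ^ l - (-1 :: 'a) = of_nat l" by simp
    then show ?thesis by simp
  qed
  have "(x - 1) ^ (l ^ Suc k) - (x ^ (l ^ Suc k) - 1) =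
      ((x - 1) ^ (l ^ Suc k) - ((y - 1) ^ l + (of_nat l * h) ^ l)) + (of_nat l * h) ^ l +
      ((y - 1) ^ l - (y ^ l + (-1) ^ l)) + ((-1) ^ l - (-1))"
  proof -
    have "x ^ (l ^ Suc k) = y ^ l" by (simp only: y_def power_Suc2 power_mult)
    then show ?thesis by (simp del: power_Suc)
  qed
  also have "of_nat l dvd \<dots>" by (intro dvd_add 1 2 3 4)
  finally show ?case .
qed simp

context
  fixes l :: nat
  assumes l: "prime l"
begin

lemma split_off_l_power:
  assumes "s > 0"
  obtains t s' where "s = l ^ t * s'" "coprime s' l"
proof -
  have "s \<noteq> 0" "\<not> is_unit l" using assms prime_gt_1_nat[OF l] by auto
  then obtain s' where s': "s = l ^ multiplicity l s * s'" "\<not> l dvd s'"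
    by (rule multiplicity_decompose')
  have "coprime s' l" using prime_imp_coprime[OF l s'(2)] by (simp add: coprime_commute)
  then show ?thesis using that s'(1) by blast
qed

text \<open>With \<open>l ^ t\<close> the l-part of \<open>s\<close>, the norm of
  \<open>T ^ a (T ^ s - 1)\<close> is \<open>l ^ (l ^ t)\<close> up to sign for all
  \<open>k > t\<close>, and a prime \<open>p\<close> dividing the norm of \<open>W\<close> would
  divide it.\<close>

lemma not_dvd_cyc_norm:
  fixes W :: "int poly" and p :: nat
  assumes "prime p" "p \<noteq> l" "\<not> int p dvd coeff W i0"
  shows "\<exists>k0. \<forall>k\<ge>k0. \<not> int p dvd cyc_norm l k W"
proof -
  obtain a s Q C where s: "s > 0" "monom 1 a * (monom 1 s - 1) = W * Q + [:int p:] * C"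
    by (rule power_T_periodic_mod_prime[OF assms(1,3)])
  obtain t s' where st: "s = l ^ t * s'" and cop: "coprime s' l"
    by (rule split_off_l_power[OF s(1)])
  have "\<not> int p dvd cyc_norm l k W" if "k \<ge> Suc t" for k
  proof
    assume dvd: "int p dvd cyc_norm l k W"
    have k: "k \<ge> 1" "t < k" using that by auto
    have "int p dvd cyc_norm l k (W * Q + [:int p:] * C) - cyc_norm l k (W * Q)"
      by (rule cyc_norm_cong[OF l k(1)])
    then have "int p dvd cyc_norm l k (monom 1 a * (monom 1 s - 1))"
    proof -
      have "int p dvd cyc_norm l k (W * Q)" using dvd by (simp add: cyc_norm_mult[OF l k(1)])
      then show ?thesis
        using \<open>int p dvd _ - _\<close> unfolding s(2) by (metis dvd_add diff_add_cancel)
    qed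
    moreover have "\<bar>cyc_norm l k (monom 1 a * (monom 1 s - 1))\<bar> = int (l ^ (l ^ t))"
    proof -
      have "monom 1 a = (monom 1 1 :: int poly) ^ a" by (simp add: monom_power)
      then show ?thesis
        using cyc_norm_X_power_minus_1[OF l cop k(2)] cyc_norm_X[OF l k(1)] st
        by (simp add: cyc_norm_mult[OF l k(1)] cyc_norm_power[OF l k(1)] abs_mult power_abs)
    qed
    ultimately have "int p dvd int (l ^ (l ^ t))" by (metis dvd_abs_iff)
    then have "p dvd l" using assms(1) prime_dvd_power by (simp only: int_dvd_int_iff) blast
    then show False using assms(1,2) l primes_dvd_imp_eq by blast
  qed
  then show ?thesis by blast
qed

text \<open>The cyclotomic polynomial vanishes at \<open>x\<close>, so \<open>l\<close> is the sum
  of the \<open>1 - x ^ (i l ^ (k - 1))\<close>, each a multiple of \<open>1 - x\<close>. The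
  cofactor is an explicit polynomial in \<open>x\<close>, so that \<open>T ^ s\<close> can later be
  substituted.\<close>

lemma l_eq_mult_one_minus:
  assumes "k \<ge> 1" "x \<in> prim_roots l k"
  shows "of_nat l = (1 - x) * (\<Sum>i<l. \<Sum>m<i * l ^ (k - 1). x ^ m)"
proof -
  have "(1 - x) * (\<Sum>i<l. \<Sum>m<i * l ^ (k - 1). x ^ m) = (\<Sum>i<l. 1 - x ^ (i * l ^ (k - 1)))"
    by (simp add: sum_distrib_left[of "1 - x"] one_diff_power_eq)
  also have "\<dots> = of_nat l - (\<Sum>i<l. (x ^ (l ^ (k - 1))) ^ i)"
    by (simp add: sum_subtractf mult.commute flip: power_mult)
  finally show ?thesis using cyc_poly_root[OF l assms] by (simp add: peval_cyc_poly[OF l])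
qed

text \<open>Ramification of \<open>l\<close>. The sum of the \<open>x ^ i\<close> is congruent to
  \<open>l\<close>, hence to 0, modulo \<open>1 - x\<close>, so \<open>(1 - x) ^ 2\<close> divides
  \<open>1 - x ^ l\<close>. As \<open>x ^ l\<close> has exact order \<open>l ^ (k - 1)\<close>,
  where \<open>k - 1 \<ge> 1\<close>, the number \<open>1 - x ^ l\<close> in turn divides
  \<open>l\<close>.\<close>

lemma l_eq_mult_one_minus_sq:
  assumes "k \<ge> 2" "x \<in> prim_roots l k"
  shows "of_nat l = (1 - x) ^ 2 * (((\<Sum>i<l. \<Sum>m<i * l ^ (k - 1). x ^ m) - (\<Sum>i<l. \<Sum>m<i. x ^ m)) *
    (\<Sum>i<l. \<Sum>m<i * l ^ (k - 2). (x ^ l) ^ m))"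
proof -
  let ?A = "\<Sum>i<l. \<Sum>m<i * l ^ (k - 1). x ^ m" and ?B = "\<Sum>i<l. \<Sum>m<i. x ^ m"
    and ?D = "\<Sum>i<l. \<Sum>m<i * l ^ (k - 2). (x ^ l) ^ m"
  have "x ^ (l ^ 1) \<in> prim_roots l (k - 1)" using assms by (intro power_l_prim_roots[OF l]) auto
  then have y: "of_nat l = (1 - x ^ l) * ?D"
    using l_eq_mult_one_minus[of "k - 1" "x ^ l"] assms(1) by (simp add: numeral_2_eq_2)
  have "(1 - x) * ?B = (\<Sum>i<l. 1 - x ^ i)" by (simp add: sum_distrib_left[of "1 - x"] one_diff_power_eq)
  then have "(\<Sum>i<l. x ^ i) = of_nat l - (1 - x) * ?B" by (simp add: sum_subtractf)
  also have "\<dots> = (1 - x) * (?A - ?B)"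
    using l_eq_mult_one_minus[of k x] assms by (simp add: algebra_simps)
  finally have "1 - x ^ l = (1 - x) * ((1 - x) * (?A - ?B))"
    by (simp add: one_diff_power_eq)
  then show ?thesis using y by (simp add: power2_eq_square mult.assoc)
qed

text \<open>By ramification the error \<open>l C\<close> is a multiple of
  \<open>(T ^ s - 1) ^ 2\<close> at the primitive roots, so \<open>W Q\<close> takes there the
  values of \<open>(T ^ s - 1) G\<close>, with \<open>G\<close> a power of \<open>T\<close> plus a
  multiple of \<open>T ^ s - 1\<close>. Modulo \<open>l\<close> the former is a unit and the latter
  nilpotent, so \<open>l\<close> does not divide the norm of \<open>G\<close>. The bound
  \<open>e = l ^ t\<close> is the exponent in the norm of \<open>T ^ s - 1\<close>.\<close>

lemma cyc_norm_l_part: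
  fixes W :: "int poly"
  assumes "\<not> int l dvd coeff W i0"
  shows "\<exists>k0 e. \<forall>k\<ge>k0. \<not> int l ^ Suc e dvd cyc_norm l k W"
proof -
  obtain a s Q C where s: "s > 0" "monom 1 a * (monom 1 s - 1) = W * Q + [:int l:] * C"
    by (rule power_T_periodic_mod_prime[OF l assms])
  obtain t s' where st: "s = l ^ t * s'" and cop: "coprime s' l"
    by (rule split_off_l_power[OF s(1)])
  \<comment> \<open>The threshold makes \<open>z ^ s\<close> of order at least \<open>l ^ 2\<close>,
    as the squared divisibility requires.\<close>
  have "\<not> int l ^ Suc (l ^ t) dvd cyc_norm l k W" if "k \<ge> t + 2" for k
  proof
    assume dvd: "int l ^ Suc (l ^ t) dvd cyc_norm l k W"
    have k: "k \<ge> 1" "t < k" "k - t \<ge> 2" using that by auto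
    note mult = cyc_norm_mult[OF l k(1)]
    let ?X = "monom 1 s :: int poly"
    \<comment> \<open>The cofactor of \<open>l_eq_mult_one_minus_sq\<close> with
      \<open>T ^ s\<close> for \<open>x\<close>, times \<open>C\<close>: its value at
      \<open>z\<close> is that of \<open>l C\<close> divided by
      \<open>(1 - z ^ s) ^ 2\<close>.\<close>
    define V where "V = ((\<Sum>i<l. \<Sum>m<i * l ^ (k - t - 1). ?X ^ m) - (\<Sum>i<l. \<Sum>m<i. ?X ^ m)) *
      (\<Sum>i<l. \<Sum>m<i * l ^ (k - t - 2). (?X ^ l) ^ m) * C"
    define G where "G = monom 1 a - (?X - 1) * V"
    have "cyc_norm l k (W * Q) = cyc_norm l k ((?X - 1) * G)"
    proof (rule cyc_norm_eqI[OF l k(1)])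
      fix z assume z: "z \<in> prim_roots l k"
      have "z ^ s = (z ^ s') ^ (l ^ t)" by (simp add: st mult.commute flip: power_mult)
      then have x: "z ^ s \<in> prim_roots l (k - t)"
        using power_l_prim_roots[OF l k(2) power_coprime_prim_roots[OF l cop k(1) z]] by simp
      have "peval (W * Q) z = z ^ a * (z ^ s - 1) - of_nat l * peval C z"
        using arg_cong[OF s(2), of "\<lambda>F. peval F z"] by (simp add: algebra_simps)
      also have "of_nat l * peval C z = (1 - z ^ s) ^ 2 * peval V z"
        by (subst l_eq_mult_one_minus_sq[OF k(3) x]) (simp add: V_def)
      also have "z ^ a * (z ^ s - 1) - (1 - z ^ s) ^ 2 * peval V z = peval ((?X - 1) * G) z"
        by (simp add: G_def power2_eq_square algebra_simps)
      finally show "peval (W * Q) z = peval ((?X - 1) * G) z" .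
    qed
    then have WQ: "cyc_norm l k W * cyc_norm l k Q = cyc_norm l k (?X - 1) * cyc_norm l k G"
      by (simp add: mult)
    define m where "m = l ^ k"
    obtain h where h: "(?X - 1) ^ m - (?X ^ m - 1) = of_nat l * h"
      using power_diff_one_mod_prime[OF l, of ?X k] by (auto simp: m_def elim: dvdE)
    \<comment> \<open>The cofactor of \<open>G\<close> in a difference of \<open>m\<close>-th
      powers. It makes the product of the norms of \<open>G\<close> and \<open>H\<close> congruent
      modulo \<open>l\<close> to the norm of \<open>T ^ (a m)\<close>, which is 1 up to
      sign.\<close>
    define H where "H = (\<Sum>i<m. ((?X - 1) * V) ^ (m - Suc i) * monom 1 a ^ i)"
    have GH: "G * H = monom 1 a ^ m - ((?X - 1) * V) ^ m"
      unfolding G_def H_def by (rule power_diff_sumr2[symmetric])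
    have "cyc_norm l k (G * H) = cyc_norm l k (monom 1 a ^ m + [:int l:] * (- h * V ^ m))"
    proof (rule cyc_norm_eqI[OF l k(1)])
      fix z assume z: "z \<in> prim_roots l k"
      have "z ^ m = 1" using z by (simp add: prim_roots_def m_def)
      then have "(z ^ s) ^ m = 1" by (simp add: power_swap[of z s])
      moreover have "peval (of_nat l) z = of_nat l" by (simp add: of_nat_poly)
      ultimately have "(z ^ s - 1) ^ m = of_nat l * peval h z"
        using arg_cong[OF h, of "\<lambda>F. peval F z"] by simp
      then show "peval (G * H) z = peval (monom 1 a ^ m + [:int l:] * (- h * V ^ m)) z"
        unfolding GH by (simp add: power_mult_distrib)
    qed
    then have "int l dvd cyc_norm l k G * cyc_norm l k H - cyc_norm l k (monom 1 a ^ m)"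
      using cyc_norm_cong[OF l k(1), of "int l" "monom 1 a ^ m" "- h * V ^ m"] by (simp add: mult)
    moreover have "\<bar>cyc_norm l k (monom 1 a ^ m)\<bar> = 1"
    proof -
      have "monom 1 a = (monom 1 1 :: int poly) ^ a" by (simp add: monom_power)
      then show ?thesis
        using cyc_norm_X[OF l k(1)] by (simp add: cyc_norm_power[OF l k(1)] power_abs)
    qed
    ultimately have nG: "\<not> int l dvd cyc_norm l k G"
    proof -
      assume 1: "int l dvd cyc_norm l k G * cyc_norm l k H - cyc_norm l k (monom 1 a ^ m)"
        and 2: "\<bar>cyc_norm l k (monom 1 a ^ m)\<bar> = 1"
      show ?thesis
      proof
        assume "int l dvd cyc_norm l k G"
        then have "int l dvd cyc_norm l k G * cyc_norm l k H" by simp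
        from dvd_diff[OF this 1] have "int l dvd cyc_norm l k (monom 1 a ^ m)" by simp
        then have "int l dvd \<bar>cyc_norm l k (monom 1 a ^ m)\<bar>" by simp
        then have "int l dvd 1" unfolding 2 .
        then show False using prime_gt_1_nat[OF l] by simp
      qed
    qed
    have "int l ^ Suc (l ^ t) dvd cyc_norm l k (?X - 1) * cyc_norm l k G"
      unfolding WQ[symmetric] using dvd by (rule dvd_mult2)
    then have "int l ^ Suc (l ^ t) dvd \<bar>cyc_norm l k (?X - 1)\<bar> * cyc_norm l k G"
      by (cases "0 \<le> cyc_norm l k (?X - 1)") (simp_all add: abs_if del: power_Suc)
    then have "int l * int l ^ (l ^ t) dvd int l ^ (l ^ t) * cyc_norm l k G"
      using cyc_norm_X_power_minus_1[OF l cop k(2)] by (simp add: st)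
    then have "int l dvd cyc_norm l k G"
      using prime_gt_0_nat[OF l] by (simp add: mult.commute)
    then show False using nG by simp
  qed
  then show ?thesis by blast
qed

end

section \<open>Kronecker's theorem\<close>

text \<open>\<open>V(T) V(-T)\<close> is even; keeping its even coefficients gives a polynomial
  whose roots are the squares of the roots of \<open>V\<close>.\<close>

definition graeffe :: "int poly \<Rightarrow> int poly" where
  "graeffe V = (\<Sum>i\<le>degree V. monom (coeff (V * pcompose V [:0, -1:]) (2 * i)) i)"

lemma peval_pcompose_neg: "peval (pcompose V [:0, -1:]) z = peval V (- z)"
  by (induction V) (simp_all add: pcompose_pCons peval_pCons)

lemma coeff_pcompose_neg: "coeff (pcompose V [:0, -1:]) i = (-1) ^ i * coeff V i" for V :: "int poly"
  by (simp add: coeff_pcompose_linear)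

lemma peval_graeffe: "peval (graeffe V) (z ^ 2) = peval V z * peval V (- z)"
proof -
  let ?E = "V * pcompose V [:0, -1:]" and ?d = "degree V"
  \<comment> \<open>Replacing \<open>T\<close> by \<open>-T\<close> exchanges the two factors of the
    product.\<close>
  have odd0: "coeff ?E i = 0" if "odd i" for i
  proof -
    have "pcompose ?E [:0, -1:] = ?E"
      by (simp add: pcompose_mult pcompose_assoc[symmetric] pcompose_pCons mult.commute)
    then have "(-1) ^ i * coeff ?E i = coeff ?E i" by (metis coeff_pcompose_neg)
    then show ?thesis using that by simp
  qed
  have deg: "degree ?E < 2 * Suc ?d"
    using degree_mult_le[of V "pcompose V [:0, -1:]"] degree_pcompose_le[of V "[:0, -1:]"] by simp
  have "peval V z * peval V (- z) = peval ?E z" by (simp add: peval_pcompose_neg)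
  also have "\<dots> = (\<Sum>i<2 * Suc ?d. of_int (coeff ?E i) * z ^ i)" by (rule peval_altdef[OF deg])
  also have "\<dots> = (\<Sum>i\<in>(*) 2 ` {..?d}. of_int (coeff ?E i) * z ^ i)"
  proof (rule sum.mono_neutral_right)
    show "\<forall>i\<in>{..<2 * Suc ?d} - (*) 2 ` {..?d}. of_int (coeff ?E i) * z ^ i = 0"
    proof
      fix i assume i: "i \<in> {..<2 * Suc ?d} - (*) 2 ` {..?d}"
      have "odd i"
      proof
        assume "even i"
        then obtain j where "i = 2 * j" by (elim evenE)
        then show False using i by auto
      qed
      then show "of_int (coeff ?E i) * z ^ i = 0" by (simp add: odd0)
    qed
  qed auto
  also have "\<dots> = (\<Sum>i\<le>?d. of_int (coeff ?E (2 * i)) * z ^ (2 * i))"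
    by (subst sum.reindex) (auto simp: inj_on_def)
  also have "\<dots> = peval (graeffe V) (z ^ 2)" by (simp add: graeffe_def power_mult)
  finally show ?thesis by simp
qed

lemma degree_graeffe:
  "degree (graeffe V) = degree V" "\<bar>lead_coeff (graeffe V)\<bar> = \<bar>lead_coeff V\<bar> ^ 2"
proof -
  let ?d = "degree V"
  have co: "coeff (graeffe V) i = (if i \<le> ?d then coeff (V * pcompose V [:0, -1:]) (2 * i) else 0)" for i
    by (simp add: graeffe_def coeff_sum sum.delta' if_distrib cong: if_cong)
  have "coeff (graeffe V) ?d = lead_coeff V * coeff (pcompose V [:0, -1:]) ?d"
  proof -
    have "degree (pcompose V [:0, -1:]) = ?d" by (simp add: degree_pcompose)
    then show ?thesis using coeff_mult_degree_sum[of V "pcompose V [:0, -1:]"] by (simp add: co mult_2)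
  qed
  then have top: "coeff (graeffe V) ?d = (-1) ^ ?d * lead_coeff V ^ 2"
    by (simp add: coeff_pcompose_neg power2_eq_square)
  have le: "degree (graeffe V) \<le> ?d" by (rule degree_le) (simp add: co)
  show deg: "degree (graeffe V) = ?d"
  proof (cases "V = 0")
    case False
    then have "?d \<le> degree (graeffe V)" using top by (intro le_degree) simp
    then show ?thesis using le by simp
  qed (use le in simp)
  show "\<bar>lead_coeff (graeffe V)\<bar> = \<bar>lead_coeff V\<bar> ^ 2"
    by (simp add: deg top abs_mult power_abs)
qed

lemma coeff_prod_list_linear_bound:
  fixes rs :: "complex list"
  assumes "\<And>r. r \<in> set rs \<Longrightarrow> norm r \<le> 1"
  shows "norm (coeff (\<Prod>r\<leftarrow>rs. [:- r, 1:]) i) \<le> 2 ^ length rs"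
  using assms
proof (induction rs arbitrary: i)
  case (Cons r rs)
  let ?q = "\<Prod>r\<leftarrow>rs. [:- r, 1:]"
  have IH: "norm (coeff ?q j) \<le> 2 ^ length rs" for j using Cons by simp
  have 1: "norm (- r * coeff ?q i) \<le> 2 ^ length rs"
    using mult_mono[OF _ IH[of i], of "norm r" 1] Cons.prems[of r] by (simp add: norm_mult)
  have 2: "norm (coeff (pCons 0 ?q) i) \<le> 2 ^ length rs"
    using IH by (cases i) auto
  have "coeff (\<Prod>r\<leftarrow>r # rs. [:- r, 1:]) i = - r * coeff ?q i + coeff (pCons 0 ?q) i"
    by simp
  then show ?case
    using norm_triangle_ineq[of "- r * coeff ?q i" "coeff (pCons 0 ?q) i"] 1 2 by simp
qed simp

lemma int_poly_factorization:
  fixes V :: "int poly"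
  obtains rs :: "complex list" where
    "map_poly of_int V = Polynomial.smult (of_int (lead_coeff V)) (\<Prod>r\<leftarrow>rs. [:- r, 1:])"
    "length rs = degree V"
proof -
  obtain rs where "Polynomial.smult (lead_coeff (map_poly complex_of_int V)) (\<Prod>r\<leftarrow>rs. [:- r, 1:]) = map_poly of_int V"
    "length rs = degree (map_poly complex_of_int V)"
    using fundamental_theorem_algebra_factorized[of "map_poly complex_of_int V"] by blast
  then show ?thesis by (intro that[of rs]) simp_all
qed

lemma peval_factorization:
  assumes "map_poly of_int V = Polynomial.smult (of_int a) (\<Prod>r\<leftarrow>rs. [:- r, 1:])"
  shows "peval V z = of_int a * (\<Prod>r\<leftarrow>rs. z - r)"
  by (simp add: peval_def assms poly_prod_list o_def)

lemma finite_bounded_int_polys: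
  "finite {V :: int poly. degree V = d \<and> (\<forall>i. \<bar>coeff V i\<bar> \<le> B)}"
proof (rule finite_subset)
  show "{V :: int poly. degree V = d \<and> (\<forall>i. \<bar>coeff V i\<bar> \<le> B)} \<subseteq>
      Poly ` {xs. set xs \<subseteq> {-B..B} \<and> length xs = Suc d}"
  proof
    fix V :: "int poly" assume V: "V \<in> {V. degree V = d \<and> (\<forall>i. \<bar>coeff V i\<bar> \<le> B)}"
    have "V = Poly (map (coeff V) [0..<Suc d])"
      using V by (intro poly_eqI) (auto simp: coeff_Poly nth_default_def coeff_eq_0 simp del: upt_Suc)
    moreover have "set (map (coeff V) [0..<Suc d]) \<subseteq> {-B..B}"
      using V by (auto simp: abs_le_iff minus_le_iff)
    ultimately show "V \<in> Poly ` {xs. set xs \<subseteq> {-B..B} \<and> length xs = Suc d}"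
      by (intro image_eqI[of _ _ "map (coeff V) [0..<Suc d]"]) auto
  qed
  show "finite (Poly ` {xs. set xs \<subseteq> {-B..B} \<and> length xs = Suc d})"
    by (intro finite_imageI finite_lists_length_eq) simp
qed

text \<open>Graeffe's root squaring stays within the finitely many integer polynomials
  of the given degree with bounded coefficients.\<close>

theorem kronecker_root_of_unity:
  fixes V :: "int poly"
  assumes "\<bar>lead_coeff V\<bar> = 1" "\<And>w. peval V w = 0 \<Longrightarrow> norm w \<le> 1" "peval V z = 0" "z \<noteq> 0"
  shows "\<exists>k>0. z ^ k = 1"
proof -
  define d where "d = degree V"
  define good where "good P \<longleftrightarrow> degree P = d \<and> \<bar>lead_coeff P\<bar> = 1 \<and> (\<forall>w. peval P w = 0 \<longrightarrow> norm w \<le> 1)"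
    for P :: "int poly"
  have good_graeffe: "good (graeffe P)" if "good P" for P
    unfolding good_def
  proof (intro conjI allI impI)
    fix w assume w: "peval (graeffe P) w = 0"
    then have "peval P (csqrt w) = 0 \<or> peval P (- csqrt w) = 0"
      using peval_graeffe[of P "csqrt w"] by simp
    then have "norm (csqrt w) \<le> 1" 
      using that norm_minus_cancel[of "csqrt w"] unfolding good_def by metis
    then have "norm (csqrt w) ^ 2 \<le> 1" by (simp add: power_le_one)
    then show "norm w \<le> 1" by (simp flip: norm_power)
  next
    show "\<bar>lead_coeff (graeffe P)\<bar> = 1"
    proof -
      have "\<bar>lead_coeff P\<bar> = 1" using that unfolding good_def by blast
      then show ?thesis by (simp only: degree_graeffe(2) one_power2)
    qed
  qed (use that in \<open>simp add: good_def degree_graeffe(1)\<close>)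
  have "\<exists>P. good P \<and> peval P (z ^ (2 ^ n)) = 0" for n
  proof (induction n)
    case 0
    show ?case using assms by (intro exI[of _ V]) (simp add: good_def d_def)
  next
    case (Suc n)
    then obtain P where P: "good P" "peval P (z ^ (2 ^ n)) = 0" by blast
    have "peval (graeffe P) ((z ^ (2 ^ n)) ^ 2) = 0" unfolding peval_graeffe P(2) by simp
    moreover have "z ^ (2 ^ Suc n) = (z ^ (2 ^ n)) ^ 2" by (simp only: power_Suc2 power_mult)
    ultimately have "peval (graeffe P) (z ^ (2 ^ Suc n)) = 0" by (simp only:)
    then show ?case using good_graeffe[OF P(1)] by blast
  qed
  then obtain P where P: "\<And>n. good (P n)" "\<And>n. peval (P n) (z ^ (2 ^ n)) = 0" by metis
  let ?G = "{V :: int poly. degree V = d \<and> (\<forall>i. \<bar>coeff V i\<bar> \<le> 2 ^ d)}"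
  have bounded: "Q \<in> ?G" if Q: "good Q" for Q
  proof -
    obtain rs :: "complex list" where rs: "map_poly of_int Q = Polynomial.smult (of_int (lead_coeff Q)) (\<Prod>r\<leftarrow>rs. [:- r, 1:])"
      "length rs = degree Q" using int_poly_factorization[of Q] .
    have "norm r \<le> 1" if "r \<in> set rs" for r
    proof -
      have "peval Q r = 0" unfolding peval_factorization[OF rs(1)] using that by (simp add: prod_list_zero_iff)
      then show ?thesis using Q by (simp add: good_def)
    qed
    then have "norm (coeff (\<Prod>r\<leftarrow>rs. [:- r, 1:]) i) \<le> 2 ^ d" for i
      using coeff_prod_list_linear_bound[of rs i] rs(2) Q by (simp add: good_def)
    moreover have "norm (complex_of_int (coeff Q i)) = norm (coeff (\<Prod>r\<leftarrow>rs. [:- r, 1:]) i)" for i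
    proof -
      have "complex_of_int (coeff Q i) = coeff (map_poly of_int Q) i" by (simp add: coeff_map_poly)
      also have "\<dots> = of_int (lead_coeff Q) * coeff (\<Prod>r\<leftarrow>rs. [:- r, 1:]) i" by (simp add: rs(1))
      moreover have "norm (complex_of_int (lead_coeff Q)) = 1"
      proof -
        have "\<bar>lead_coeff Q\<bar> = 1" using Q unfolding good_def by blast
        then show ?thesis by (metis norm_of_int of_int_abs of_int_1)
      qed
      ultimately show ?thesis by (simp only: norm_mult mult_1)
    qed
    ultimately have "real_of_int \<bar>coeff Q i\<bar> \<le> real_of_int (2 ^ d)" for i by simp
    then show ?thesis using Q unfolding good_def by (simp only: of_int_le_iff) simp
  qed
  have "range (\<lambda>n. z ^ (2 ^ n)) \<subseteq> (\<Union>Q\<in>?G - {0}. {w. peval Q w = 0})"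
  proof safe
    fix n :: nat
    have "P n \<noteq> 0" using P(1)[of n] by (auto simp: good_def)
    then show "z ^ 2 ^ n \<in> (\<Union>Q\<in>?G - {0}. {w. peval Q w = 0})" using bounded[OF P(1)] P(2)[of n] by blast
  qed
  moreover have "finite (\<Union>Q\<in>?G - {0}. {w. peval Q w = 0})"
    using finite_bounded_int_polys[of d "2 ^ d"] by (intro finite_UN_I) (auto simp: peval_def intro!: poly_roots_finite)
  ultimately have "finite (range (\<lambda>n::nat. z ^ (2 ^ n)))" by (rule finite_subset)
  then have "\<not> inj (\<lambda>n::nat. z ^ (2 ^ n))" by (meson range_inj_infinite)
  then obtain i j :: nat where "i \<noteq> j" "z ^ (2 ^ i) = z ^ (2 ^ j)" unfolding inj_def by blast
  then obtain i j :: nat where ij: "i < j" "z ^ (2 ^ i) = z ^ (2 ^ j)" by (cases i j rule: linorder_cases) auto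
  have less: "(2::nat) ^ i < 2 ^ j" using ij(1) by simp
  then have "z ^ (2 ^ j) = z ^ (2 ^ i) * z ^ (2 ^ j - 2 ^ i)" by (simp flip: power_add)
  then have "z ^ (2 ^ j - 2 ^ i) = 1" using ij(2) assms(4) by simp
  then show ?thesis using less by (intro exI[of _ "2 ^ j - 2 ^ i"]) simp
qed

section \<open>Growth of the cyclotomic norms\<close>

text \<open>The cyclotomic polynomial of order \<open>l ^ k\<close> at \<open>x\<close>. The sum
  shows its size at once: close to 1 if \<open>x ^ (l ^ (k - 1))\<close> is near 0, close to
  \<open>l\<close> if it is near 1.\<close>

definition cyc_eval :: "nat \<Rightarrow> nat \<Rightarrow> complex \<Rightarrow> complex" where
  "cyc_eval l k x = (\<Sum>i<l. (x ^ (l ^ (k - 1))) ^ i)"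

lemma norm_power_minus_1_le:
  fixes y :: complex
  assumes "norm y = 1"
  shows "norm (y ^ n - 1) \<le> real n * norm (y - 1)"
  using norm_power_diff[of y 1 n] assms by simp

lemma realpow_at_top:
  fixes x :: real
  assumes "x > 1" shows "filterlim (\<lambda>n. x ^ n) at_top sequentially"
  using filterlim_at_infinity_imp_norm_at_top[OF filterlim_realpow_sequentially_gt1[of x]] assms
  by (simp add: norm_power)

context
  fixes l :: nat
  assumes l: "prime l"
begin

text \<open>The resultant of \<open>W\<close> and the cyclotomic polynomial, read off the roots of
  \<open>W\<close> instead of the roots of unity.\<close>

lemma norm_cyc_norm:
  assumes k: "k \<ge> 1" and fac: "map_poly of_int W = Polynomial.smult (of_int a) (\<Prod>r\<leftarrow>rs. [:- r, 1:])"
  shows "real_of_int \<bar>cyc_norm l k W\<bar> =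
    real_of_int \<bar>a\<bar> ^ ((l - 1) * l ^ (k - 1)) * (\<Prod>r\<leftarrow>rs. norm (cyc_eval l k r))"
proof -
  let ?Z = "prim_roots l k"
  have "real_of_int \<bar>cyc_norm l k W\<bar> = norm (\<Prod>z\<in>?Z. peval W z)"
    by (simp flip: cyc_norm_eq[OF l k])
  also have "(\<Prod>z\<in>?Z. peval W z) = of_int a ^ card ?Z * (\<Prod>z\<in>?Z. \<Prod>r\<leftarrow>rs. z - r)"
    by (simp add: peval_factorization[OF fac] prod.distrib)
  also have "norm \<dots> = real_of_int \<bar>a\<bar> ^ card ?Z * norm (\<Prod>z\<in>?Z. \<Prod>r\<leftarrow>rs. z - r)"
    by (simp add: norm_mult norm_power)
  also have "norm (\<Prod>z\<in>?Z. \<Prod>r\<leftarrow>rs. z - r) = (\<Prod>r\<leftarrow>rs. norm (cyc_eval l k r))"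
  proof (induction rs)
    case (Cons r rs)
    have "norm (\<Prod>z\<in>?Z. z - r) = norm (\<Prod>z\<in>?Z. r - z)"
      by (simp add: norm_minus_commute flip: prod_norm)
    also have "\<dots> = norm (cyc_eval l k r)" by (simp add: prod_prim_roots[OF l k] cyc_eval_def)
    finally show ?case using Cons by (simp add: prod.distrib norm_mult)
  qed simp
  finally show ?thesis by (simp add: card_prim_roots[OF l k])
qed

lemma cyc_eval_mult: "k \<ge> 1 \<Longrightarrow> (x ^ (l ^ (k - 1)) - 1) * cyc_eval l k x = x ^ (l ^ k) - 1"
  unfolding cyc_eval_def
  by (subst power_diff_1_eq[symmetric]) (simp add: power_l_Suc[OF l, of k] flip: power_mult)

lemma l_power_at_top: "filterlim (\<lambda>k. l ^ (k - 1)) at_top sequentially"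
proof -
  have "k \<le> l ^ (k - 1)" if "k \<ge> 1" for k
  proof -
    have "k - 1 < l ^ (k - 1)" using power_gt_expt[of l "k - 1"] prime_gt_1_nat[OF l] by simp
    then show ?thesis by simp
  qed
  then show ?thesis
    by (intro filterlim_at_top_mono[OF filterlim_ident]) (auto simp: eventually_sequentially)
qed

lemma norm_cyc_eval_ge_half:
  assumes "norm r < 1"
  shows "eventually (\<lambda>k. norm (cyc_eval l k r) \<ge> 1 / 2) sequentially"
proof -
  have "(\<lambda>k. r ^ (l ^ (k - 1))) \<longlonglongrightarrow> 0"
    using filterlim_compose[OF LIMSEQ_power_zero[OF assms] l_power_at_top] .
  then have "(\<lambda>k. cyc_eval l k r) \<longlonglongrightarrow> (\<Sum>i<l. 0 ^ i)"
    unfolding cyc_eval_def by (intro tendsto_intros)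
  also have "(\<Sum>i<l. (0::complex) ^ i) = 1"
    using prime_gt_0_nat[OF l] by (cases l) (simp_all add: lessThan_Suc_eq_insert_0 sum.reindex)
  finally have "(\<lambda>k. norm (cyc_eval l k r)) \<longlonglongrightarrow> norm (1::complex)" by (rule tendsto_norm)
  then have "eventually (\<lambda>k. norm (cyc_eval l k r) > 1 / 2) sequentially"
    by (rule order_tendstoD) simp
  then show ?thesis by eventually_elim simp
qed

lemma norm_cyc_eval_ge:
  assumes "norm r > 1"
  shows "norm (cyc_eval l k r) \<ge> norm r ^ (l ^ (k - 1)) - 1"
proof -
  define y where "y = r ^ (l ^ (k - 1))"
  have y1: "norm y \<ge> 1" using assms by (simp add: y_def norm_power one_le_power)
  \<comment> \<open>In \<open>y ^ l - 1 = (y - 1) cyc_eval l k r\<close> the left side is at least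
    \<open>norm y ^ 2 - 1\<close>, as \<open>l \<ge> 2\<close>; the factor \<open>norm y + 1\<close>
    then cancels.\<close>
  have "(norm y - 1) * (norm y + 1) = norm y ^ 2 - 1" by (simp add: power2_eq_square algebra_simps)
  also have "\<dots> \<le> norm y ^ l - 1"
    using power_increasing[OF _ y1, of 2 l] prime_ge_2_nat[OF l] by simp
  also have "\<dots> \<le> norm (y ^ l - 1)"
    using norm_triangle_ineq2[of "y ^ l" 1] by (simp add: norm_power)
  also have "y ^ l - 1 = (y - 1) * cyc_eval l k r" by (simp add: cyc_eval_def y_def power_diff_1_eq)
  also have "norm \<dots> \<le> (norm y + 1) * norm (cyc_eval l k r)"
    using norm_triangle_ineq4[of y 1] by (simp add: norm_mult mult_right_mono)
  finally have "(norm y - 1) * (norm y + 1) \<le> norm (cyc_eval l k r) * (norm y + 1)" by (simp add: mult.commute)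
  then have "norm y - 1 \<le> norm (cyc_eval l k r)"
    using y1 by (subst (asm) mult_le_cancel_right) auto
  then show ?thesis by (simp add: y_def norm_power)
qed

lemma norm_cyc_eval_at_top:
  assumes "norm r > 1"
  shows "filterlim (\<lambda>k. norm (cyc_eval l k r)) at_top sequentially"
proof -
  have "filterlim (\<lambda>k. norm r ^ (l ^ (k - 1))) at_top sequentially"
    by (rule filterlim_compose[OF realpow_at_top[OF assms] l_power_at_top])
  then have "filterlim (\<lambda>k. -1 + norm r ^ (l ^ (k - 1))) at_top sequentially"
    by (intro filterlim_tendsto_add_at_top[OF tendsto_const])
  then show ?thesis
    by (rule filterlim_at_top_mono) (use norm_cyc_eval_ge[OF assms] in \<open>auto simp: algebra_simps\<close>)
qed

lemma prod_list_ge_half: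
  assumes "\<And>r. r \<in> set rs \<Longrightarrow> norm r \<noteq> 1"
  shows "eventually (\<lambda>k. (\<Prod>r\<leftarrow>rs. norm (cyc_eval l k r)) \<ge> (1 / 2) ^ length rs) sequentially"
  using assms
proof (induction rs)
  case (Cons r rs)
  have "eventually (\<lambda>k. norm (cyc_eval l k r) \<ge> 1 / 2) sequentially"
  proof (cases "norm r < 1")
    case False
    then have "norm r > 1" using Cons.prems[of r] by simp
    from norm_cyc_eval_at_top[OF this] show ?thesis unfolding filterlim_at_top by blast
  qed (rule norm_cyc_eval_ge_half)
  moreover have "eventually (\<lambda>k. (\<Prod>r\<leftarrow>rs. norm (cyc_eval l k r)) \<ge> (1 / 2) ^ length rs) sequentially"
    using Cons by simp
  ultimately show ?case
  proof eventually_elim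
    case (elim k)
    then have "(1 / 2) * (1 / 2) ^ length rs \<le> norm (cyc_eval l k r) * (\<Prod>r\<leftarrow>rs. norm (cyc_eval l k r))"
      by (intro mult_mono) auto
    then show ?case by simp
  qed
qed simp

lemma off_circle_at_top:
  assumes rs: "\<And>r. r \<in> set rs \<Longrightarrow> norm r \<noteq> 1" and a: "a \<noteq> 0"
    and big: "\<bar>a\<bar> \<ge> 2 \<or> (\<exists>r\<in>set rs. norm r > 1)"
  shows "filterlim (\<lambda>k. real_of_int \<bar>a\<bar> ^ ((l - 1) * l ^ (k - 1)) * (\<Prod>r\<leftarrow>rs. norm (cyc_eval l k r)))
    at_top sequentially"
proof -
  \<comment> \<open>\<open>f\<close> bounds the factor that grows, a root outside the circle or the
    power of \<open>a\<close>; the other roots cost at most the constant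
    \<open>(1 / 2) ^ n\<close>.\<close>
  obtain f :: "nat \<Rightarrow> real" and n where f: "filterlim f at_top sequentially"
    and ge: "eventually (\<lambda>k. real_of_int \<bar>a\<bar> ^ ((l - 1) * l ^ (k - 1)) * (\<Prod>r\<leftarrow>rs. norm (cyc_eval l k r))
      \<ge> f k * (1 / 2) ^ n) sequentially"
  proof (cases "\<exists>r\<in>set rs. norm r > 1")
    case True
    then obtain r where r: "r \<in> set rs" "norm r > 1" by blast
    then obtain xs ys where split: "rs = xs @ r # ys" by (meson split_list)
    have "eventually (\<lambda>k. (\<Prod>r\<leftarrow>xs @ ys. norm (cyc_eval l k r)) \<ge> (1 / 2) ^ length (xs @ ys)) sequentially"
      using rs by (intro prod_list_ge_half) (auto simp: split)
    then have "eventually (\<lambda>k. real_of_int \<bar>a\<bar> ^ ((l - 1) * l ^ (k - 1)) * (\<Prod>r\<leftarrow>rs. norm (cyc_eval l k r))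
        \<ge> norm (cyc_eval l k r) * (1 / 2) ^ length (xs @ ys)) sequentially"
    proof eventually_elim
      case (elim k)
      have "(\<Prod>r\<leftarrow>rs. norm (cyc_eval l k r)) = norm (cyc_eval l k r) * (\<Prod>r\<leftarrow>xs @ ys. norm (cyc_eval l k r))"
        by (simp add: split)
      then have "norm (cyc_eval l k r) * (1 / 2) ^ length (xs @ ys) \<le> (\<Prod>r\<leftarrow>rs. norm (cyc_eval l k r))"
        by (simp only:) (rule mult_left_mono[OF elim], simp)
      moreover have "1 \<le> real_of_int \<bar>a\<bar> ^ ((l - 1) * l ^ (k - 1))"
        using a by (intro one_le_power) linarith
      moreover have "0 \<le> (\<Prod>r\<leftarrow>rs. norm (cyc_eval l k r))" by (rule prod_list_nonneg) auto
      ultimately show ?case using mult_mono[of 1 "real_of_int \<bar>a\<bar> ^ ((l - 1) * l ^ (k - 1))"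
            "norm (cyc_eval l k r) * (1 / 2) ^ length (xs @ ys)" "\<Prod>r\<leftarrow>rs. norm (cyc_eval l k r)"]
        by auto
    qed
    then show ?thesis using that norm_cyc_eval_at_top[OF r(2)] by blast
  next
    case False
    then have a2: "real_of_int \<bar>a\<bar> \<ge> 2" using big by linarith
    have "eventually (\<lambda>k. (\<Prod>r\<leftarrow>rs. norm (cyc_eval l k r)) \<ge> (1 / 2) ^ length rs) sequentially"
      by (rule prod_list_ge_half[OF rs])
    then have "eventually (\<lambda>k. real_of_int \<bar>a\<bar> ^ ((l - 1) * l ^ (k - 1)) * (\<Prod>r\<leftarrow>rs. norm (cyc_eval l k r))
        \<ge> 2 ^ (l ^ (k - 1)) * (1 / 2) ^ length rs) sequentially"
    proof eventually_elim
      case (elim k)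
      have "(2::real) ^ (l ^ (k - 1)) \<le> 2 ^ ((l - 1) * l ^ (k - 1))"
        using prime_gt_1_nat[OF l] by (intro power_increasing) auto
      also have "\<dots> \<le> real_of_int \<bar>a\<bar> ^ ((l - 1) * l ^ (k - 1))" using a2 by (intro power_mono) auto
      finally show ?case using elim by (intro mult_mono) auto
    qed
    moreover have "filterlim (\<lambda>k. (2::real) ^ (l ^ (k - 1))) at_top sequentially"
      by (rule filterlim_compose[OF realpow_at_top l_power_at_top]) simp
    ultimately show ?thesis using that by blast
  qed
  have "filterlim (\<lambda>k. (1 / 2) ^ n * f k) at_top sequentially"
    by (rule filterlim_tendsto_pos_mult_at_top[OF tendsto_const _ f]) simp
  then show ?thesis
    by (rule filterlim_at_top_mono) (use ge in \<open>simp add: mult.commute\<close>)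
qed

text \<open>If \<open>cyc_eval l k r\<close> is small then \<open>r ^ l ^ k\<close> is close to 1, so that the following factors are
  close to \<open>l\<close>.\<close>

lemma norm_cyc_eval_after_small:
  assumes r: "norm r = 1" and k: "k \<ge> 1" and j: "1 \<le> j" "j \<le> m"
    and small: "norm (cyc_eval l k r) < 1 / (2 * real l ^ (m + 2))"
  shows "norm (cyc_eval l (k + j) r) \<ge> 1"
proof -
  have l2: "real l \<ge> 2" using prime_ge_2_nat[OF l] by simp
  \<comment> \<open>The constant pays for three losses: 2 bounds
    \<open>norm (r ^ (l ^ (k - 1)) - 1)\<close>, at most \<open>l ^ m\<close> is lost in raising to
    the power \<open>l ^ (j - 1)\<close>, and \<open>l ^ 2\<close> in a sum of \<open>l\<close>
    powers with exponents below \<open>l\<close>. The value is then within 1 of \<open>l\<close>,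
    hence at least \<open>l - 1\<close>.\<close>
  have "norm (r ^ (l ^ k) - 1) = norm (r ^ (l ^ (k - 1)) - 1) * norm (cyc_eval l k r)"
    by (simp add: norm_mult flip: cyc_eval_mult[OF k])
  also have "\<dots> \<le> 2 * (1 / (2 * real l ^ (m + 2)))"
    using norm_triangle_ineq4[of "r ^ (l ^ (k - 1))" 1] r small
    by (intro mult_mono) (auto simp: norm_power)
  finally have 1: "norm (r ^ (l ^ k) - 1) \<le> 1 / real l ^ (m + 2)" by simp
  define x where "x = r ^ (l ^ (k + j - 1))"
  have x: "norm x = 1" by (simp add: x_def norm_power r)
  have "l ^ (k + j - 1) = l ^ k * l ^ (j - 1)" using j by (simp flip: power_add)
  then have "norm (x - 1) \<le> real (l ^ (j - 1)) * norm (r ^ (l ^ k) - 1)"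
    using norm_power_minus_1_le[of "r ^ (l ^ k)" "l ^ (j - 1)"] r by (simp add: x_def power_mult norm_power)
  also have "\<dots> \<le> real l ^ m * (1 / real l ^ (m + 2))"
    using 1 j l2 by (intro mult_mono) (auto intro!: power_increasing)
  also have "\<dots> = 1 / real l ^ 2" using l2 by (simp add: power_add power2_eq_square)
  finally have d: "norm (x - 1) \<le> 1 / real l ^ 2" .
  have "norm (\<Sum>i<l. x ^ i - 1) \<le> (\<Sum>i<l. norm (x ^ i - 1))" by (rule norm_sum)
  also have "\<dots> \<le> (\<Sum>i<l. real l * (1 / real l ^ 2))"
  proof (rule sum_mono)
    fix i assume "i \<in> {..<l}"
    have "norm (x ^ i - 1) \<le> real i * norm (x - 1)" by (rule norm_power_minus_1_le[OF x])
    also have "\<dots> \<le> real l * (1 / real l ^ 2)" using d \<open>i \<in> {..<l}\<close> by (intro mult_mono) auto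
    finally show "norm (x ^ i - 1) \<le> real l * (1 / real l ^ 2)" .
  qed
  also have "\<dots> = 1" using l2 by (simp add: power2_eq_square)
  finally have "norm (\<Sum>i<l. x ^ i - 1) \<le> 1" .
  moreover have "(\<Sum>i<l. x ^ i - 1) = cyc_eval l (k + j) r - of_nat l"
    by (simp add: sum_subtractf cyc_eval_def x_def)
  ultimately have "norm (of_nat l - cyc_eval l (k + j) r) \<le> 1" by (simp add: norm_minus_commute)
  moreover have "norm (of_nat l :: complex) - norm (cyc_eval l (k + j) r) \<le> norm (of_nat l - cyc_eval l (k + j) r)"
    by (rule norm_triangle_ineq2)
  ultimately show ?thesis using l2 by simp
qed

theorem bounded_cyc_norm_imp_root_of_unity:
  fixes W :: "int poly"
  assumes W: "W \<noteq> 0" and bound: "\<And>k. k \<ge> k0 \<Longrightarrow> \<bar>cyc_norm l k W\<bar> \<le> B"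
    and z: "peval W z = 0" "z \<noteq> 0"
  shows "\<exists>k>0. z ^ k = 1"
proof -
  define a where "a = lead_coeff W"
  have a: "a \<noteq> 0" using W by (simp add: a_def)
  obtain rs :: "complex list" where fac: "map_poly of_int W = Polynomial.smult (of_int a) (\<Prod>r\<leftarrow>rs. [:- r, 1:])"
    unfolding a_def using int_poly_factorization[of W] by blast
  have root: "peval W w = 0 \<longleftrightarrow> w \<in> set rs" for w
    unfolding peval_factorization[OF fac] using a by (auto simp: prod_list_zero_iff)
  have "\<bar>a\<bar> = 1 \<and> (\<forall>r\<in>set rs. norm r \<le> 1)"
  proof (rule ccontr)
    define off where "off = filter (\<lambda>r. norm r \<noteq> 1) rs"
    define us where "us = filter (\<lambda>r. norm r = 1) rs"
    \<comment> \<open>\<open>m\<close> counts the distinct roots on the circle, for the pigeonhole;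
      multiplicities enter only through \<open>length us\<close>. \<open>\<epsilon>\<close> is small
      enough to keep a root from being small again within \<open>m\<close> steps.\<close>
    define m where "m = card (set us)"
    define \<epsilon> where "\<epsilon> = 1 / (2 * real l ^ (m + 2))"
    have \<epsilon>: "\<epsilon> > 0" "\<epsilon> \<le> 1" using prime_gt_0_nat[OF l] prime_gt_1_nat[OF l]
      one_le_power[of "real l" "m + 2"] by (auto simp: \<epsilon>_def)
    assume "\<not> ?thesis"
    then have "\<bar>a\<bar> \<ge> 2 \<or> (\<exists>r\<in>set off. norm r > 1)" using a by (auto simp: off_def not_le)
    then have top: "filterlim (\<lambda>k. real_of_int \<bar>a\<bar> ^ ((l - 1) * l ^ (k - 1)) * (\<Prod>r\<leftarrow>off. norm (cyc_eval l k r)))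
        at_top sequentially" by (intro off_circle_at_top a) (auto simp: off_def)
    have split: "(\<Prod>r\<leftarrow>rs. norm (cyc_eval l k r)) =
        (\<Prod>r\<leftarrow>off. norm (cyc_eval l k r)) * (\<Prod>r\<leftarrow>us. norm (cyc_eval l k r))" for k
      unfolding off_def us_def by (induction rs) auto
    \<comment> \<open>The bound is chosen so that factors of at least \<open>\<epsilon>\<close> on
      the circle would push the norm beyond \<open>B\<close>.\<close>
    have "eventually (\<lambda>k. real_of_int \<bar>a\<bar> ^ ((l - 1) * l ^ (k - 1)) * (\<Prod>r\<leftarrow>off. norm (cyc_eval l k r))
        \<ge> (real_of_int \<bar>B\<bar> + 1) / \<epsilon> ^ length us) sequentially"
      using top unfolding filterlim_at_top by blast
    then obtain k1 where k1: "\<And>k. k \<ge> k1 \<Longrightarrow> real_of_int \<bar>a\<bar> ^ ((l - 1) * l ^ (k - 1)) *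
        (\<Prod>r\<leftarrow>off. norm (cyc_eval l k r)) \<ge> (real_of_int \<bar>B\<bar> + 1) / \<epsilon> ^ length us"
      unfolding eventually_sequentially by blast
    define K where "K = max 1 (max k0 k1)"
    have "\<exists>r\<in>set us. norm (cyc_eval l k r) < \<epsilon>" if k: "k \<ge> K" for k
    proof (rule ccontr)
      assume "\<not> ?thesis"
      then have ge: "\<And>r. r \<in> set us \<Longrightarrow> \<epsilon> \<le> norm (cyc_eval l k r)" by (auto simp: not_less)
      have "\<epsilon> ^ length us \<le> (\<Prod>r\<leftarrow>us. norm (cyc_eval l k r))"
        using ge
      proof (induction us)
        case (Cons r us)
        then have "\<epsilon> * \<epsilon> ^ length us \<le> norm (cyc_eval l k r) * (\<Prod>r\<leftarrow>us. norm (cyc_eval l k r))"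
          using \<epsilon> by (intro mult_mono) auto
        then show ?case by simp
      qed simp
      moreover have "k \<ge> 1" "k \<ge> k1" "k \<ge> k0" using k by (auto simp: K_def)
      ultimately have "(real_of_int \<bar>B\<bar> + 1) / \<epsilon> ^ length us * \<epsilon> ^ length us \<le> real_of_int \<bar>cyc_norm l k W\<bar>"
        unfolding norm_cyc_norm[OF \<open>k \<ge> 1\<close> fac] split mult.assoc[symmetric]
        using k1[of k] \<epsilon> order_trans[OF _ k1[of k], of 0]
        by (intro mult_mono) auto
      then have "real_of_int \<bar>B\<bar> + 1 \<le> real_of_int \<bar>cyc_norm l k W\<bar>" using \<epsilon> by simp
      then show False using bound[OF \<open>k \<ge> k0\<close>] by linarith
    qed
    then obtain \<rho> where \<rho>: "\<And>k. k \<ge> K \<Longrightarrow> \<rho> k \<in> set us \<and> norm (cyc_eval l k (\<rho> k)) < \<epsilon>" by metis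
    \<comment> \<open>Any two of these \<open>m + 1\<close> consecutive indices differ by at most
      \<open>m\<close>, so they would need \<open>m + 1\<close> different roots.\<close>
    have "inj_on \<rho> {K..K + m}"
    proof (rule linorder_inj_onI)
      fix k k' assume kk: "k < k'" "k \<in> {K..K + m}" "k' \<in> {K..K + m}"
      show "\<rho> k \<noteq> \<rho> k'"
      proof
        assume eq: "\<rho> k = \<rho> k'"
        have "norm (cyc_eval l (k + (k' - k)) (\<rho> k)) \<ge> 1"
        proof (rule norm_cyc_eval_after_small[where m = m])
          show "norm (\<rho> k) = 1" using \<rho>[of k] kk by (auto simp: us_def)
          show "norm (cyc_eval l k (\<rho> k)) < 1 / (2 * real l ^ (m + 2))" using \<rho>[of k] kk by (simp add: \<epsilon>_def)
        qed (use kk in \<open>auto simp: K_def\<close>)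
        then show False using \<rho>[of k'] kk eq \<epsilon> by auto
      qed
    qed auto
    moreover have "\<rho> ` {K..K + m} \<subseteq> set us" using \<rho> by auto
    ultimately have "card {K..K + m} \<le> card (set us)" by (rule card_inj_on_le) simp
    then show False by (simp add: m_def)
  qed
  then show ?thesis using kronecker_root_of_unity[of W z] z root by (auto simp: a_def)
qed

end

section \<open>Prime factors of products of cyclotomic norms\<close>

context
  fixes l :: nat and \<kappa> :: "nat \<Rightarrow> nat" and m0 :: int and U :: "int poly"
  assumes l: "prime l"
    and \<kappa>_pos: "\<And>n. n \<ge> 1 \<Longrightarrow> \<kappa> n > 0"
    and \<kappa>_eq: "\<And>n. n \<ge> 1 \<Longrightarrow> int (l ^ n * \<kappa> n) = \<bar>m0\<bar> * (\<Prod>k=1..n. \<bar>cyc_norm l k U\<bar>)"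
begin

lemma prime_not_dvd_l_power:
  assumes "prime p" "p \<noteq> l" shows "\<not> p dvd l ^ n"
proof
  assume "p dvd l ^ n"
  then have "p dvd l" using assms(1) by (rule prime_dvd_power[rotated])
  then show False using primes_dvd_imp_eq[OF assms(1) l] assms(2) by simp
qed

lemma cyc_norm_U_nonzero: "k \<ge> 1 \<Longrightarrow> cyc_norm l k U \<noteq> 0"
proof
  assume k: "k \<ge> 1" "cyc_norm l k U = 0"
  then have "(\<Prod>j=1..k. \<bar>cyc_norm l j U\<bar>) = 0" by (auto intro!: prod_zero bexI[of _ k])
  then have "int (l ^ k * \<kappa> k) = 0" by (simp only: \<kappa>_eq[OF k(1)] mult_zero_right)
  then show False using \<kappa>_pos[OF k(1)] prime_gt_0_nat[OF l] by simp
qed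

lemma norm_poly_nonzero: "U \<noteq> 0"
proof
  assume "U = 0"
  then have "cyc_norm l 1 U = 0"
    using cyc_norm_const[OF l order_refl, of 0] card_prim_roots[OF l order_refl] prime_gt_1_nat[OF l]
    by (simp add: power_0_left)
  then show False using cyc_norm_U_nonzero[of 1] by simp
qed

lemma norm_factor_nonzero: "m0 \<noteq> 0"
  using \<kappa>_eq[of 1] \<kappa>_pos[of 1] prime_gt_0_nat[OF l] by auto

lemma prime_dvd_kappa_cases:
  assumes "n \<ge> 1" "prime p" "p dvd \<kappa> n"
  shows "int p dvd m0 \<or> (\<exists>k\<in>{1..n}. int p dvd cyc_norm l k U)"
proof -
  have "int p dvd int (l ^ n * \<kappa> n)" using assms(3) by (simp only: int_dvd_int_iff dvd_mult)
  then have "int p dvd \<bar>m0\<bar> * (\<Prod>k=1..n. \<bar>cyc_norm l k U\<bar>)" using \<kappa>_eq[OF assms(1)] by simp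
  then have "int p dvd m0 \<or> int p dvd (\<Prod>k=1..n. \<bar>cyc_norm l k U\<bar>)"
    using assms(2) by (simp add: prime_dvd_mult_iff)
  moreover have "\<exists>k\<in>{1..n}. int p dvd cyc_norm l k U" if "int p dvd (\<Prod>k=1..n. \<bar>cyc_norm l k U\<bar>)"
    using that assms(2) by (subst (asm) prime_dvd_prod_iff) auto
  ultimately show ?thesis by blast
qed

text \<open>By the product formula \<open>l ^ n \<kappa> n\<close> divides
  \<open>l ^ n' \<kappa> n'\<close>; only the prime \<open>l\<close> can be lost to the power in
  front.\<close>

lemma prime_dvd_kappa_mono:
  assumes "1 \<le> n" "n \<le> n'" "prime p" "p \<noteq> l" "p dvd \<kappa> n"
  shows "p dvd \<kappa> n'"
proof -
  have n': "n' \<ge> 1" using assms by simp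
  have "{1..n'} = {1..n} \<union> {n<..n'}" "{1..n} \<inter> {n<..n'} = {}" using assms by auto
  then have "(\<Prod>k=1..n'. \<bar>cyc_norm l k U\<bar>) = (\<Prod>k=1..n. \<bar>cyc_norm l k U\<bar>) * (\<Prod>k\<in>{n<..n'}. \<bar>cyc_norm l k U\<bar>)"
    by (simp only: prod.union_disjoint finite_atLeastAtMost finite_greaterThanAtMost)
  then have "int (l ^ n' * \<kappa> n') = int (l ^ n * \<kappa> n) * (\<Prod>k\<in>{n<..n'}. \<bar>cyc_norm l k U\<bar>)"
    by (simp only: \<kappa>_eq[OF n'] \<kappa>_eq[OF assms(1)] mult.assoc)
  moreover have "int p dvd int (l ^ n * \<kappa> n)" using assms(5) by (simp only: int_dvd_int_iff dvd_mult)
  ultimately have "int p dvd int (l ^ n' * \<kappa> n')" by simp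
  then have "p dvd l ^ n' * \<kappa> n'" by (simp only: int_dvd_int_iff)
  then have "p dvd l ^ n' \<or> p dvd \<kappa> n'" using assms(3) by (simp add: prime_dvd_mult_iff)
  moreover have "\<not> p dvd l ^ n'"
    by (rule prime_not_dvd_l_power[OF assms(3,4)])
  ultimately show ?thesis by blast
qed

lemma prime_dvd_cyc_norm_imp_dvd_kappa:
  assumes "k \<ge> 1" "prime p" "p \<noteq> l" "int p dvd cyc_norm l k U"
  shows "p dvd \<kappa> k"
proof -
  have "cyc_norm l k U dvd (\<Prod>j=1..k. \<bar>cyc_norm l j U\<bar>)"
    using assms(1) dvd_prodI[of "{1..k}" k "\<lambda>j. \<bar>cyc_norm l j U\<bar>"] by simp
  then have "int p dvd int (l ^ k * \<kappa> k)"
    unfolding \<kappa>_eq[OF assms(1)] using assms(4) by (meson dvd_mult dvd_trans)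
  then have "p dvd l ^ k * \<kappa> k" by (simp only: int_dvd_int_iff)
  moreover have "\<not> p dvd l ^ k"
    by (rule prime_not_dvd_l_power[OF assms(2,3)])
  ultimately show ?thesis using assms(2) by (simp add: prime_dvd_mult_iff)
qed

lemma common_exponent:
  assumes "\<And>z. peval U z = 0 \<Longrightarrow> \<exists>k>0. z ^ k = 1"
  shows "\<exists>s>0. \<forall>z. peval U z = 0 \<longrightarrow> z ^ s = 1"
proof -
  have fin: "finite {z. peval U z = 0}"
    unfolding peval_def using norm_poly_nonzero by (intro poly_roots_finite) simp
  obtain e where e: "\<And>z. peval U z = 0 \<Longrightarrow> e z > 0 \<and> z ^ (e z) = 1" using assms by metis
  define s where "s = (\<Prod>z | peval U z = 0. e z)"
  show ?thesis
  proof (intro exI[of _ s] conjI allI impI)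
    show "s > 0" unfolding s_def using e by (intro prod_pos) auto
    fix z assume z: "peval U z = 0"
    then have "e z dvd s" unfolding s_def using fin by (intro dvd_prodI) auto
    then show "z ^ s = 1" using e[OF z] by (auto simp: power_mult elim!: dvdE)
  qed
qed

text \<open>Over the complex numbers each linear factor of \<open>U\<close> divides
  \<open>T ^ s - 1\<close>, so \<open>U\<close> divides a power with exponent the number of roots
  with multiplicity. Pseudo-division brings this back to the integers at the cost of
  \<open>a\<close>: the remainder is a complex multiple of \<open>U\<close> of smaller degree, hence
  0.\<close>

lemma dvd_power_X_minus_1:
  assumes "\<And>z. peval U z = 0 \<Longrightarrow> z ^ s = 1"
  obtains a :: int and d q where "a \<noteq> 0" "[:a:] * (monom 1 s - 1) ^ d = U * q"
proof -
  let ?C = "map_poly complex_of_int"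
  obtain rs :: "complex list" where fac: "?C U = Polynomial.smult (of_int (lead_coeff U)) (\<Prod>r\<leftarrow>rs. [:- r, 1:])"
    using int_poly_factorization[of U] by blast
  define F where "F = (monom 1 s - 1 :: int poly) ^ length rs"
  have "(\<Prod>r\<leftarrow>rs'. [:- r, 1:]) dvd ?C (monom 1 s - 1) ^ length rs'" if "set rs' \<subseteq> set rs" for rs'
    using that
  proof (induction rs')
    case (Cons r rs')
    have "peval U r = 0" unfolding peval_factorization[OF fac] using Cons.prems by (simp add: prod_list_zero_iff)
    then have "peval (monom 1 s - 1) r = 0" using assms[of r] by simp
    then have "[:- r, 1:] dvd ?C (monom 1 s - 1)" by (simp add: peval_def poly_eq_0_iff_dvd)
    moreover have "(\<Prod>r\<leftarrow>rs'. [:- r, 1:]) dvd ?C (monom 1 s - 1) ^ length rs'" using Cons by simp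
    ultimately show ?case
      by (simp only: list.map prod_list.Cons list.size(4) add_Suc_right add_0_right power_Suc mult_dvd_mono)
  qed simp
  then have "(\<Prod>r\<leftarrow>rs. [:- r, 1:]) dvd ?C F"
    unfolding F_def by (simp add: of_int_poly_hom.hom_power)
  then have UF: "?C U dvd ?C F" unfolding fac using norm_poly_nonzero by (subst smult_dvd_iff) simp
  obtain a q where aq: "a \<noteq> 0" "Polynomial.smult a F = U * q + pseudo_mod F U"
    using pseudo_mod(1)[OF norm_poly_nonzero, of F] by blast
  have "?C U dvd ?C (Polynomial.smult a F)"
    using UF by (simp add: of_int_hom.map_poly_hom_smult dvd_smult)
  then have "?C U dvd ?C (U * q) + ?C (pseudo_mod F U)" unfolding aq(2) by (simp add: of_int_poly_hom.hom_add)
  then have dvd: "?C U dvd ?C (pseudo_mod F U)"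
    by (simp add: of_int_poly_hom.hom_mult dvd_add_right_iff)
  have "pseudo_mod F U = 0"
  proof (rule ccontr)
    assume ne: "pseudo_mod F U \<noteq> 0"
    then have "degree (pseudo_mod F U) < degree U" using pseudo_mod(2)[OF norm_poly_nonzero, of F] by simp
    moreover have "degree (?C U) \<le> degree (?C (pseudo_mod F U))"
      using dvd ne by (intro dvd_imp_degree_le) simp_all
    ultimately show False by simp
  qed
  then show ?thesis using that[of a "length rs" q] aq by (simp add: F_def)
qed

lemma bounded_if_all_roots_of_unity:
  assumes "\<And>z. peval U z = 0 \<Longrightarrow> \<exists>k>0. z ^ k = 1"
  obtains P where "finite P" "\<And>n. n \<ge> 1 \<Longrightarrow> prime_factors (\<kappa> n) \<subseteq> P"
proof -
  obtain s where s: "s > 0" "\<forall>z. peval U z = 0 \<longrightarrow> z ^ s = 1" using common_exponent[OF assms] by blast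
  obtain a :: int and d q where a: "a \<noteq> 0" "[:a:] * (monom 1 s - 1) ^ d = U * q"
    by (rule dvd_power_X_minus_1[of s]) (use s(2) in blast)
  obtain t s' where st: "s = l ^ t * s'" and cop: "coprime s' l"
    by (rule split_off_l_power[OF l s(1)])
  have big: "p dvd nat \<bar>a\<bar> \<or> p = l" if "k > t" "prime p" "int p dvd cyc_norm l k U" for k p
  proof -
    have k: "k \<ge> 1" using that by simp
    have "int p dvd cyc_norm l k ([:a:] * (monom 1 s - 1) ^ d)"
      unfolding a(2) using that by (simp add: cyc_norm_mult[OF l k])
    then have "int p dvd a ^ card (prim_roots l k) * cyc_norm l k (monom 1 s - 1) ^ d"
      by (simp only: cyc_norm_mult[OF l k] cyc_norm_power[OF l k] cyc_norm_const[OF l k])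
    then have "int p dvd a \<or> int p dvd cyc_norm l k (monom 1 s - 1)"
    proof -
      have "prime (int p)" using that(2) by simp
      then show ?thesis
        using \<open>int p dvd a ^ _ * _\<close> prime_dvd_multD prime_dvd_power by blast
    qed
    moreover have "p = l" if "int p dvd cyc_norm l k (monom 1 s - 1)"
    proof -
      have "int p dvd \<bar>cyc_norm l k (monom 1 s - 1)\<bar>" using that by simp
      then have "int p dvd int (l ^ (l ^ t))"
        unfolding st cyc_norm_X_power_minus_1[OF l cop \<open>k > t\<close>] .
      then have "p dvd l ^ (l ^ t)" by (simp only: int_dvd_int_iff)
      then show ?thesis using prime_not_dvd_l_power[OF \<open>prime p\<close>] by blast
    qed
    ultimately show ?thesis by (auto simp: nat_dvd_iff int_dvd_int_iff[symmetric])
  qed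
  \<comment> \<open>The norm of \<open>T ^ s - 1\<close> is known to be a power of \<open>l\<close>
    only for \<open>k > t\<close>; the finitely many earlier norms contribute their own
    primes.\<close>
  define P where "P = prime_factors (nat \<bar>m0\<bar>) \<union> (\<Union>k\<in>{1..t}. prime_factors (nat \<bar>cyc_norm l k U\<bar>)) \<union>
    prime_factors (nat \<bar>a\<bar>) \<union> {l}"
  have nat_dvd: "p dvd nat \<bar>x\<bar>" if "int p dvd x" for p x using that by (simp add: dvd_nat_abs_iff)
  show ?thesis
  proof (rule that[of P])
    fix n :: nat assume n: "n \<ge> 1"
    show "prime_factors (\<kappa> n) \<subseteq> P"
    proof
      fix p assume "p \<in> prime_factors (\<kappa> n)"
      then have p: "prime p" "p dvd \<kappa> n" by (auto simp: in_prime_factors_iff)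
      from prime_dvd_kappa_cases[OF n p] show "p \<in> P"
      proof
        assume "int p dvd m0"
        then have "p \<in> prime_factors (nat \<bar>m0\<bar>)" using nat_dvd p norm_factor_nonzero by (auto simp: in_prime_factors_iff)
        then show ?thesis by (simp add: P_def)
      next
        assume "\<exists>k\<in>{1..n}. int p dvd cyc_norm l k U"
        then obtain k where k: "k \<ge> 1" "int p dvd cyc_norm l k U" by auto
        show ?thesis
        proof (cases "k \<le> t")
          case True
          have "p \<in> prime_factors (nat \<bar>cyc_norm l k U\<bar>)"
            using nat_dvd[OF k(2)] p cyc_norm_U_nonzero[OF k(1)] by (auto simp: in_prime_factors_iff)
          then show ?thesis using True k by (auto simp: P_def)
        next
          case False
          then have "p dvd nat \<bar>a\<bar> \<or> p = l" using big[of k p] p k by simp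
          then show ?thesis using a(1) p by (auto simp: P_def in_prime_factors_iff)
        qed
      qed
    qed
  qed (simp add: P_def)
qed

lemma bounded_imp_roots_of_unity:
  assumes P: "finite P" "\<And>k p. k \<ge> 1 \<Longrightarrow> prime p \<Longrightarrow> int p dvd cyc_norm l k U \<Longrightarrow> p \<in> P"
    and z: "peval U z = 0" "z \<noteq> 0"
  shows "\<exists>k>0. z ^ k = 1"
proof -
  \<comment> \<open>The norms of the content are unbounded unless it is a unit, yet they bring no
    new primes; so it is split off. The primitive part is nonzero modulo every prime.\<close>
  define c W where "c = content U" and "W = primitive_part U"
  have UW: "U = [:c:] * W" by (simp add: c_def W_def)
  have c0: "c \<noteq> 0" using norm_poly_nonzero by (simp add: c_def)
  have W0: "W \<noteq> 0" using norm_poly_nonzero by (simp add: W_def)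
  have prim: "\<exists>i. \<not> int p dvd coeff W i" if "prime p" for p
  proof (rule ccontr)
    assume "\<not> ?thesis"
    then have "int p dvd content W"
      unfolding const_poly_dvd_iff_dvd_content[symmetric] const_poly_dvd_iff by blast
    moreover have "content W = 1" using norm_poly_nonzero by (simp add: W_def)
    ultimately have "int p dvd 1" by (simp only:)
    then show False using prime_gt_1_nat[OF that] by simp
  qed
  have W_dvd: "cyc_norm l k W dvd cyc_norm l k U" if "k \<ge> 1" for k
    unfolding UW cyc_norm_mult[OF l that] by (rule dvd_triv_right)
  have "\<exists>k0. \<forall>k\<ge>k0. \<not> int p dvd cyc_norm l k W" if p: "prime p" "p \<noteq> l" for p
  proof -
    obtain i where "\<not> int p dvd coeff W i" using prim[OF p(1)] by blast
    from not_dvd_cyc_norm[OF l p this] show ?thesis .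
  qed
  then have "\<forall>p. \<exists>k0. prime p \<and> p \<noteq> l \<longrightarrow> (\<forall>k\<ge>k0. \<not> int p dvd cyc_norm l k W)" by blast
  from choice[OF this] obtain K where
    "\<forall>p. prime p \<and> p \<noteq> l \<longrightarrow> (\<forall>k\<ge>K p. \<not> int p dvd cyc_norm l k W)" ..
  then have K: "\<not> int p dvd cyc_norm l k W" if "prime p" "p \<noteq> l" "k \<ge> K p" for p k
    using that by blast
  obtain i0 where "\<not> int l dvd coeff W i0" using prim[OF l] by blast
  then obtain k0 e where "\<forall>k\<ge>k0. \<not> int l ^ Suc e dvd cyc_norm l k W"
    using cyc_norm_l_part[OF l] by blast
  then have e: "\<not> int l ^ Suc e dvd cyc_norm l k W" if "k \<ge> k0" for k using that by blast
  \<comment> \<open>From \<open>k1\<close> on no prime of \<open>P\<close> except possibly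
    \<open>l\<close> divides the norm of \<open>W\<close>, which is then up to sign a power of
    \<open>l\<close> with exponent at most \<open>e\<close>.\<close>
  define k1 where "k1 = Max (insert 1 (insert k0 (K ` P)))"
  have k1: "x \<le> k1" if "x \<in> insert 1 (insert k0 (K ` P))" for x
    unfolding k1_def using P(1) that by (intro Max_ge) auto
  have "\<bar>cyc_norm l k W\<bar> \<le> int l ^ e" if k: "k \<ge> k1" for k
  proof -
    have k': "k \<ge> 1" "k \<ge> k0" using k k1[of 1] k1[of k0] by auto
    define w where "w = nat \<bar>cyc_norm l k W\<bar>"
    have w: "int w = \<bar>cyc_norm l k W\<bar>" by (simp add: w_def)
    have "cyc_norm l k W \<noteq> 0" using W_dvd[OF k'(1)] cyc_norm_U_nonzero[OF k'(1)] by auto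
    then have "w > 0" by (simp add: w_def)
    then obtain j y where jy: "w = l ^ j * y" "coprime y l" by (rule split_off_l_power[OF l])
    have "y = 1"
    proof (rule ccontr)
      assume "y \<noteq> 1"
      then obtain p where p: "prime p" "p dvd y" using prime_factor_nat by blast
      have "p \<noteq> l" using jy(2) p by (metis coprime_absorb_right not_prime_unit)
      have "int p dvd int w" using p jy by (simp only: int_dvd_int_iff dvd_mult)
      then have dW: "int p dvd cyc_norm l k W" by (simp add: w)
      then have "p \<in> P" using P(2)[OF k'(1) p(1)] W_dvd[OF k'(1)] by (meson dvd_trans)
      then show False using K[OF p(1) \<open>p \<noteq> l\<close>, of k] dW k1[of "K p"] k by auto
    qed
    then have wj: "w = l ^ j" using jy by simp
    have "j \<le> e"
    proof (rule ccontr)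
      assume "\<not> j \<le> e"
      then have "l ^ Suc e dvd w" unfolding wj by (intro le_imp_power_dvd) simp
      then have "int l ^ Suc e dvd int w" by (simp only: int_dvd_int_iff flip: of_nat_power)
      then show False using e[OF k'(2)] by (simp add: w del: power_Suc)
    qed
    then have "w \<le> l ^ e" unfolding wj using prime_gt_0_nat[OF l] by (intro power_increasing) auto
    then have "int w \<le> int (l ^ e)" by (simp only: of_nat_le_iff)
    then show ?thesis by (simp only: w of_nat_power)
  qed
  moreover have "peval W z = 0" using z(1) c0 unfolding UW by simp
  ultimately show ?thesis using bounded_cyc_norm_imp_root_of_unity[OF l W0 _ _ z(2)] by blast
qed

text \<open>Failure of the limit bounds the count only along a subsequence. Primes other than
  \<open>l\<close> never disappear from \<open>\<kappa> n\<close>, so they are bounded in number for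
  all \<open>n\<close> and their increasing sets become constant. The hypothesis keeps out the root
  0, which is not a root of unity.\<close>

theorem omega_limit_iff:
  assumes U0: "peval U 0 \<noteq> 0"
  shows "filterlim (\<lambda>n. card (prime_factors (\<kappa> n))) at_top sequentially \<longleftrightarrow>
    (\<exists>z. peval U z = 0 \<and> \<not> (\<exists>k>0. z ^ k = 1))"
proof
  assume lim: "filterlim (\<lambda>n. card (prime_factors (\<kappa> n))) at_top sequentially"
  show "\<exists>z. peval U z = 0 \<and> \<not> (\<exists>k>0. z ^ k = 1)"
  proof (rule ccontr)
    assume "\<not> ?thesis"
    then obtain P where P: "finite P" "\<And>n. n \<ge> 1 \<Longrightarrow> prime_factors (\<kappa> n) \<subseteq> P"
      using bounded_if_all_roots_of_unity by metis
    have "eventually (\<lambda>n. card (prime_factors (\<kappa> n)) \<ge> Suc (card P)) sequentially"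
      using lim unfolding filterlim_at_top by blast
    then obtain n0 where "\<And>n. n \<ge> n0 \<Longrightarrow> card (prime_factors (\<kappa> n)) \<ge> Suc (card P)"
      unfolding eventually_sequentially by blast
    from this[of "max n0 1"] show False using card_mono[OF P(1) P(2)[of "max n0 1"]] by simp
  qed
next
  assume "\<exists>z. peval U z = 0 \<and> \<not> (\<exists>k>0. z ^ k = 1)"
  then obtain z where z: "peval U z = 0" "\<not> (\<exists>k>0. z ^ k = 1)" by blast
  show "filterlim (\<lambda>n. card (prime_factors (\<kappa> n))) at_top sequentially"
  proof (rule ccontr)
    assume "\<not> ?thesis"
    then obtain B where "\<not> eventually (\<lambda>n. B \<le> card (prime_factors (\<kappa> n))) sequentially"
      unfolding filterlim_at_top by blast
    then have small: "\<exists>n\<ge>m. card (prime_factors (\<kappa> n)) < B" for m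
      unfolding eventually_sequentially by (metis not_less)
    define Q where "Q n = prime_factors (\<kappa> n) - {l}" for n
    have fin: "finite (Q n)" for n by (simp add: Q_def)
    have mono: "Q n \<subseteq> Q n'" if "1 \<le> n" "n \<le> n'" for n n'
      using prime_dvd_kappa_mono[OF that] \<kappa>_pos[of n'] that by (auto simp: Q_def in_prime_factors_iff)
    have bound: "card (Q n) < B" if "n \<ge> 1" for n
    proof -
      obtain n' where n': "n' \<ge> n" "card (prime_factors (\<kappa> n')) < B" using small by blast
      have "card (Q n) \<le> card (Q n')" by (rule card_mono[OF fin mono[OF that n'(1)]])
      also have "\<dots> \<le> card (prime_factors (\<kappa> n'))" by (rule card_mono) (auto simp: Q_def)
      finally show ?thesis using n'(2) by simp
    qed
    \<comment> \<open>\<open>Q m\<close> has maximal cardinality, so by monotonicity it contains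
      every \<open>Q n\<close>.\<close>
    obtain m where m: "m \<ge> 1" "\<And>n. n \<ge> 1 \<Longrightarrow> card (Q n) \<le> card (Q m)"
      using ex_has_greatest_nat[of "\<lambda>n. n \<ge> 1" 1 "\<lambda>n. card (Q n)" B] bound by (metis less_imp_le order_refl)
    have sub: "Q n \<subseteq> Q m" if "n \<ge> 1" for n
    proof -
      have "Q m = Q (max n m)"
        using m by (intro card_seteq[OF fin mono]) auto
      then show ?thesis using mono[OF that, of "max n m"] by simp
    qed
    have "\<exists>k>0. z ^ k = 1"
    proof (rule bounded_imp_roots_of_unity[of "insert l (Q m)", OF _ _ z(1)])
      show "finite (insert l (Q m))" using fin by simp
      show "z \<noteq> 0" using z(1) U0 by blast
      fix k p assume *: "k \<ge> 1" "prime p" "int p dvd cyc_norm l k U"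
      show "p \<in> insert l (Q m)"
      proof (cases "p = l")
        case False
        then have "p \<in> Q k"
          using prime_factorsI[OF _ *(2) prime_dvd_cyc_norm_imp_dvd_kappa[OF *(1,2) False *(3)]] \<kappa>_pos[OF *(1)]
          by (simp add: Q_def)
        then show ?thesis using sub[OF *(1)] by blast
      qed simp
    qed
    then show False using z(2) by (rule notE[rotated])
  qed
qed

end

section \<open>Voltage Laplacians\<close>

definition leval :: "complex \<Rightarrow> laurent \<Rightarrow> complex" where
  "leval z f = (\<Sum>k\<in>Poly_Mapping.keys f. of_int (Poly_Mapping.lookup f k) * z powi k)"

lemma sum_keys_single:
  "(\<Sum>a\<in>Poly_Mapping.keys f. Poly_Mapping.single a (Poly_Mapping.lookup f a)) = f"
  by (rule poly_mapping_eqI) (simp add: lookup_sum lookup_single when_def sum.delta' in_keys_iff)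

lemma leval_superset:
  assumes "finite K" "Poly_Mapping.keys f \<subseteq> K"
  shows "leval z f = (\<Sum>k\<in>K. of_int (Poly_Mapping.lookup f k) * z powi k)"
  unfolding leval_def using assms by (intro sum.mono_neutral_left) (auto simp: in_keys_iff)

lemma leval_add: "leval z (f + h) = leval z f + leval z h"
proof -
  let ?K = "Poly_Mapping.keys f \<union> Poly_Mapping.keys h"
  have "leval z (f + h) = (\<Sum>k\<in>?K. of_int (Poly_Mapping.lookup (f + h) k) * z powi k)"
    by (rule leval_superset) (use Poly_Mapping.keys_add[of f h] in auto)
  also have "\<dots> = leval z f + leval z h"
    by (simp add: leval_superset[of ?K f] leval_superset[of ?K h] lookup_add algebra_simps sum.distrib)
  finally show ?thesis .
qed

lemma leval_single: "leval z (Poly_Mapping.single k c) = of_int c * z powi k"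
  by (subst leval_superset[of "{k}"]) auto

lemma leval_0: "leval z 0 = 0" by (simp add: leval_def)

lemma leval_sum: "leval z (\<Sum>i\<in>A. F i) = (\<Sum>i\<in>A. leval z (F i))"
  by (induction A rule: infinite_finite_induct) (simp_all add: leval_0 leval_add)

lemma leval_mult:
  assumes "z \<noteq> 0" shows "leval z (f * h) = leval z f * leval z h"
proof -
  have f: "f = (\<Sum>a\<in>Poly_Mapping.keys f. Poly_Mapping.single a (Poly_Mapping.lookup f a))"
    and h: "h = (\<Sum>a\<in>Poly_Mapping.keys h. Poly_Mapping.single a (Poly_Mapping.lookup h a))"
    by (simp_all add: sum_keys_single)
  have "f * h = (\<Sum>a\<in>Poly_Mapping.keys f. \<Sum>b\<in>Poly_Mapping.keys h.
      Poly_Mapping.single (a + b) (Poly_Mapping.lookup f a * Poly_Mapping.lookup h b))"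
    by (subst f, subst h) (simp add: sum_product mult_single)
  then have "leval z (f * h) = (\<Sum>a\<in>Poly_Mapping.keys f. \<Sum>b\<in>Poly_Mapping.keys h.
      (of_int (Poly_Mapping.lookup f a) * z powi a) * (of_int (Poly_Mapping.lookup h b) * z powi b))"
    using assms by (simp add: leval_sum leval_single power_int_add mult_ac)
  also have "\<dots> = leval z f * leval z h" by (simp add: leval_def sum_product)
  finally show ?thesis .
qed

lemma leval_1: "leval z 1 = 1"
  using leval_single[of z 0 1] by simp

lemma leval_uminus: "leval z (- f) = - leval z f"
  using leval_add[of z f "- f"] by (simp add: leval_0 eq_neg_iff_add_eq_0 add.commute)

lemma leval_diff: "leval z (f - h) = leval z f - leval z h"
  using leval_add[of z f "- h"] by (simp add: leval_uminus)

lemma leval_of_nat: "leval z (of_nat n) = of_nat n"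
  by (induction n) (simp_all add: leval_0 leval_add leval_1)

lemma leval_T_pow: "leval z (T_pow k) = z powi k"
  by (simp add: T_pow_def leval_single)

lemma leval_det:
  assumes "z \<noteq> 0" shows "leval z (det A) = det (map_mat (leval z) A)"
proof -
  interpret comm_ring_hom "leval z"
    by unfold_locales (simp_all add: leval_0 leval_1 leval_add leval_mult[OF assms] leval_uminus)
  show ?thesis by simp
qed

lemma laurent_of_poly_superset:
  assumes "degree p \<le> n"
  shows "laurent_of_poly p = (\<Sum>i\<le>n. Poly_Mapping.single (int i) (coeff p i))"
  unfolding laurent_of_poly_def using assms
  by (intro sum.mono_neutral_left) (auto simp: coeff_eq_0)

lemma leval_laurent_of_poly: "leval z (laurent_of_poly p) = peval p z"
proof -
  have "peval p z = (\<Sum>i<Suc (degree p). of_int (coeff p i) * z ^ i)" by (rule peval_altdef) simp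
  also have "\<dots> = leval z (laurent_of_poly p)"
    by (simp add: laurent_of_poly_def leval_sum leval_single lessThan_Suc_atMost del: sum.lessThan_Suc)
  finally show ?thesis by simp
qed

lemma T_pow_mult: "T_pow a * T_pow b = T_pow (a + b)"
  by (simp add: T_pow_def mult_single)

lemma T_pow_0: "T_pow 0 = 1"
  by (simp add: T_pow_def)

lemma laurent_of_poly_pCons_0: "laurent_of_poly (pCons 0 p) = T_pow 1 * laurent_of_poly p"
proof -
  have "laurent_of_poly (pCons 0 p) = (\<Sum>i\<le>Suc (degree p). Poly_Mapping.single (int i) (coeff (pCons 0 p) i))"
    by (rule laurent_of_poly_superset) (simp add: degree_pCons_le)
  also have "\<dots> = (\<Sum>i\<le>degree p. Poly_Mapping.single (int (Suc i)) (coeff p i))"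
    by (subst sum.atMost_Suc_shift) simp
  also have "\<dots> = T_pow 1 * laurent_of_poly p"
    by (simp add: laurent_of_poly_def T_pow_def sum_distrib_left mult_single)
  finally show ?thesis .
qed

text \<open>If \<open>T\<close> divided \<open>U\<close>, the exponent \<open>b - 1\<close> would
  already do, and \<open>b > 0\<close> makes it smaller than \<open>b\<close>.\<close>

lemma least_shift_nonzero_constant_term:
  assumes "b = (LEAST k. T_pow (int k) * f \<in> range laurent_of_poly)" "b > 0"
    and "laurent_of_poly U = T_pow (int b) * f"
  shows "coeff U 0 \<noteq> 0"
proof
  assume "coeff U 0 = 0"
  then obtain p where p: "U = pCons 0 p" by (cases U) auto
  have "T_pow (int (b - 1)) * f = T_pow (-1) * (T_pow (int b) * f)"
    using assms(2) by (simp add: T_pow_mult of_nat_diff flip: mult.assoc)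
  also have "\<dots> = T_pow (-1) * (T_pow 1 * laurent_of_poly p)"
    by (simp only: assms(3)[symmetric] p laurent_of_poly_pCons_0)
  also have "\<dots> = laurent_of_poly p" by (simp add: T_pow_mult T_pow_0 flip: mult.assoc)
  finally have "T_pow (int (b - 1)) * f \<in> range laurent_of_poly" by simp
  moreover have "b - 1 < (LEAST k. T_pow (int k) * f \<in> range laurent_of_poly)"
    using assms(1,2) by linarith
  ultimately show False using not_less_Least by blast
qed

text \<open>With \<open>d\<close> the degree, \<open>T ^ d U\<close> would be the reflected
  polynomial of \<open>U\<close>, whose degree is at most \<open>d\<close>.\<close>

lemma reciprocal_poly_const:
  fixes U :: "int poly"
  assumes "\<And>z. z \<noteq> 0 \<Longrightarrow> peval U (inverse z) = peval U z"
  shows "degree U = 0"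
proof (rule ccontr)
  assume d: "degree U \<noteq> 0"
  let ?p = "map_poly complex_of_int U"
  \<comment> \<open>The extra factor \<open>monom 1 1\<close> makes the expression vanish at 0 too,
    where the symmetry says nothing.\<close>
  have "poly (monom 1 1 * (monom 1 (degree ?p) * ?p - reflect_poly ?p)) z = 0" for z
  proof (cases "z = 0")
    case False
    then show ?thesis
      using assms[OF False] by (simp add: poly_monom poly_reflect_poly_nz peval_def)
  qed (simp add: poly_monom)
  then have "monom 1 1 * (monom 1 (degree ?p) * ?p - reflect_poly ?p) = 0"
    using poly_all_0_iff_0 by blast
  then have "monom 1 (degree ?p) * ?p = reflect_poly ?p" by simp
  then have "degree (monom 1 (degree ?p) * ?p) \<le> degree ?p"
    using degree_reflect_poly_le[of ?p] by simp
  moreover have "?p \<noteq> 0" using d by auto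
  ultimately show False using d by (simp add: degree_mult_eq degree_monom_eq)
qed

section \<open>The voltage matrix at a complex number and the tree number of X\<close>

definition volt_entry :: "('a, 'b) pre_digraph \<Rightarrow> 'b set \<Rightarrow> ('b \<Rightarrow> int) \<Rightarrow> complex \<Rightarrow> 'a \<Rightarrow> 'a \<Rightarrow> complex" where
  "volt_entry X S \<alpha> z x y = (\<Sum>s\<in>S.
     of_bool (x = tail X s) * of_bool (y = tail X s) + of_bool (x = head X s) * of_bool (y = head X s)
     - of_bool (x = tail X s) * of_bool (y = head X s) * z powi \<alpha> s
     - of_bool (x = head X s) * of_bool (y = tail X s) * z powi (- \<alpha> s))"

text \<open>Inverting \<open>z\<close> transposes the matrix, which is the source of the symmetry of
  \<open>f\<close>.\<close>

lemma volt_entry_sym: "volt_entry X S \<alpha> (inverse z) x y = volt_entry X S \<alpha> z y x"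
  unfolding volt_entry_def by (intro sum.cong refl) (simp add: power_int_minus power_int_inverse mult_ac)

lemma volt_entry_1: "volt_entry X S \<alpha> 1 x y = of_int (laplace_entry (tail X) (head X) S x y)"
  unfolding volt_entry_def laplace_entry_def by (simp add: algebra_simps)

lemma sum_periodic_delta:
  fixes F :: "int \<Rightarrow> complex"
  assumes N: "N > 0" and s: "\<sigma> \<in> {0..<N}" and per: "\<And>m. F (m mod N) = F m"
  shows "(\<Sum>\<rho>\<in>{0..<N}. of_bool (\<sigma> = (\<rho> + A) mod N) * F \<rho>) = F (\<sigma> - A)"
proof -
  have "\<sigma> = (\<rho> + A) mod N \<longleftrightarrow> \<rho> = (\<sigma> - A) mod N" if "\<rho> \<in> {0..<N}" for \<rho>
  proof
    assume "\<sigma> = (\<rho> + A) mod N"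
    then have "(\<sigma> - A) mod N = (\<rho> + A - A) mod N" by (simp only: mod_diff_left_eq)
    then show "\<rho> = (\<sigma> - A) mod N" using that by simp
  next
    assume "\<rho> = (\<sigma> - A) mod N"
    then have "(\<rho> + A) mod N = (\<sigma> - A + A) mod N" by (simp only: mod_add_left_eq)
    then show "\<sigma> = (\<rho> + A) mod N" using s by simp
  qed
  then have "(\<Sum>\<rho>\<in>{0..<N}. of_bool (\<sigma> = (\<rho> + A) mod N) * F \<rho>) =
      (\<Sum>\<rho>\<in>{0..<N}. if \<rho> = (\<sigma> - A) mod N then F \<rho> else 0)"
    by (intro sum.cong refl) auto
  also have "\<dots> = F ((\<sigma> - A) mod N)" using N by (simp add: sum.delta)
  finally show ?thesis by (simp add: per)
qed

lemma powi_mod: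
  fixes z :: complex
  assumes "N > 0" "z ^ N = 1" shows "z powi (m mod int N) = z powi m"
proof -
  have z: "z \<noteq> 0" using assms by (auto simp: power_0_left)
  have "z powi m = z powi (m mod int N + int N * (m div int N))" by simp
  also have "\<dots> = z powi (m mod int N) * (z powi int N) powi (m div int N)"
    by (subst power_int_add) (use z in \<open>simp_all only: power_int_mult disj_not1 not_False_eq_True simp_thms\<close>)
  also have "z powi int N = 1" using assms by simp
  finally show ?thesis by simp
qed

lemma rooted_forests_cong:
  assumes "\<And>e. e \<in> E \<Longrightarrow> a e = a' e" "\<And>e. e \<in> E \<Longrightarrow> b e = b' e"
  shows "rooted_forests a b V R E = rooted_forests a' b' V R E"
proof -
  have "reach a b F R = reach a' b' F R" if "F \<subseteq> E" for F
  proof -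
    have "edge_rel a b F = edge_rel a' b' F"
      unfolding edge_rel_def using assms that by (intro SUP_cong refl) auto
    then show ?thesis by (simp only: reach_def)
  qed
  then show ?thesis unfolding rooted_forests_def by blast
qed

text \<open>Edges keep their names, so the two sides are equal as sets. This passes between the
  vertices of \<open>X\<close> and matrix indices.\<close>

lemma rooted_forests_relabel:
  assumes inj: "inj_on w V" and ends: "a ` E \<subseteq> V" "b ` E \<subseteq> V" and R: "R \<subseteq> V"
  shows "rooted_forests (w \<circ> a) (w \<circ> b) (w ` V) (w ` R) E = rooted_forests a b V R E"
proof -
  have E_V: "a e \<in> V" "b e \<in> V" if "e \<in> E" for e using ends that by auto
  have reach_V: "reach a b F R \<subseteq> V" if "F \<subseteq> E" for F
    using R
  proof (rule reach_subsetI)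
    fix x y assume "(x, y) \<in> edge_rel a b F"
    then show "y \<in> V" using E_V subsetD[OF that] by (auto simp: edge_rel_def)
  qed
  have reach_w: "reach (w \<circ> a) (w \<circ> b) F (w ` R) = w ` reach a b F R" if F: "F \<subseteq> E" for F
  proof
    show "reach (w \<circ> a) (w \<circ> b) F (w ` R) \<subseteq> w ` reach a b F R"
    proof (rule reach_subsetI)
      fix x y assume "x \<in> w ` reach a b F R" "(x, y) \<in> edge_rel (w \<circ> a) (w \<circ> b) F"
      then obtain x' e where x': "x' \<in> reach a b F R" "x = w x'" and e: "e \<in> F"
        "x = w (a e) \<and> y = w (b e) \<or> x = w (b e) \<and> y = w (a e)"
        unfolding edge_rel_def comp_def by blast
      have V: "x' \<in> V" "a e \<in> V" "b e \<in> V"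
        using subsetD[OF reach_V[OF F] x'(1)] E_V subsetD[OF F e(1)] by simp_all
      then have "x' = a e \<and> y = w (b e) \<or> x' = b e \<and> y = w (a e)"
        using e(2) x'(2) inj_onD[OF inj _ V(1,2)] inj_onD[OF inj _ V(1,3)] by auto
      then obtain y' where "y = w y'" "(x', y') \<in> edge_rel a b F" using e(1) by (auto simp: edge_rel_def)
      then show "y \<in> w ` reach a b F R" using reach_step[OF x'(1)] by blast
    qed (auto intro: reach_root)
    show "w ` reach a b F R \<subseteq> reach (w \<circ> a) (w \<circ> b) F (w ` R)"
    proof safe
      fix x assume "x \<in> reach a b F R"
      then show "w x \<in> reach (w \<circ> a) (w \<circ> b) F (w ` R)"
      proof (induction rule: reach_induct)
        case (step x y)
        then have "(w x, w y) \<in> edge_rel (w \<circ> a) (w \<circ> b) F" by (auto simp: edge_rel_def)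
        then show ?case using reach_step step.IH by metis
      qed (auto intro: reach_root)
    qed
  qed
  have card: "card (w ` V - w ` R) = card (V - R)"
    using inj_on_image_set_diff[OF inj Diff_subset R] card_image[OF inj_on_subset[OF inj], of "V - R"] by auto
  have sub: "w ` V \<subseteq> w ` reach a b F R \<longleftrightarrow> V \<subseteq> reach a b F R" if "F \<subseteq> E" for F
  proof
    assume w: "w ` V \<subseteq> w ` reach a b F R"
    show "V \<subseteq> reach a b F R"
    proof
      fix x assume x: "x \<in> V"
      then obtain c where c: "c \<in> reach a b F R" "w x = w c" using w by blast
      then show "x \<in> reach a b F R"
        using inj_onD[OF inj c(2) x] subsetD[OF reach_V[OF that]] by blast
    qed
  qed (rule image_mono)
  show ?thesis unfolding rooted_forests_def card
    by (intro Collect_cong conj_cong refl) (simp only: reach_w sub)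
qed

context
  fixes X :: "('a, 'b) pre_digraph" and r :: "'b \<Rightarrow> 'b" and S :: "'b set" and \<alpha> :: "'b \<Rightarrow> int"
    and g :: nat and v :: "nat \<Rightarrow> 'a"
  assumes fin: "fin_digraph X" and bi: "bidirected_digraph X r" and ori: "orientation X r S"
    and v: "bij_betw v {..<g} (verts X)"
begin

interpretation fin_digraph X by (fact fin)
interpretation bidirected_digraph X r by (fact bi)

lemma finite_orientation: "finite S"
  using orientation_subset_arcs[OF fin bi ori] finite_arcs by (rule finite_subset)

text \<open>An arc leaving \<open>x\<close> is in \<open>S\<close> or is the reversal of an arc of
  \<open>S\<close> entering \<open>x\<close>. A loop is counted in both summands, as its valency 2
  demands.\<close>

lemma out_degree_eq: "out_degree X x = card {s\<in>S. tail X s = x} + card {s\<in>S. head X s = x}"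
proof -
  have Sr: "r e \<notin> S" if "e \<in> S" for e using ori that unfolding orientation_def by blast
  have rS: "r e \<in> S" if "e \<in> arcs X" "e \<notin> S" for e using ori that unfolding orientation_def by blast
  have "out_arcs X x = {s\<in>S. tail X s = x} \<union> r ` {s\<in>S. head X s = x}"
  proof (intro Set.set_eqI iffI)
    fix e assume e: "e \<in> out_arcs X x"
    then have eX: "e \<in> arcs X" "tail X e = x" by (auto simp: out_arcs_def)
    show "e \<in> {s\<in>S. tail X s = x} \<union> r ` {s\<in>S. head X s = x}"
    proof (cases "e \<in> S")
      case False
      then have "r e \<in> {s\<in>S. head X s = x}" using rS eX by simp
      moreover have "e = r (r e)" by simp
      ultimately show ?thesis by blast
    qed (use eX in simp)
  next
    fix e assume "e \<in> {s\<in>S. tail X s = x} \<union> r ` {s\<in>S. head X s = x}"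
    then show "e \<in> out_arcs X x" using orientation_subset_arcs[OF fin bi ori] by (auto simp: out_arcs_def)
  qed
  moreover have "{s\<in>S. tail X s = x} \<inter> r ` {s\<in>S. head X s = x} = {}" using Sr by auto
  moreover have "card (r ` {s\<in>S. head X s = x}) = card {s\<in>S. head X s = x}"
    by (rule card_image) (rule inj_on_arev)
  ultimately show ?thesis
    using finite_orientation by (simp add: out_degree_def card_Un_disjoint)
qed

lemma v_eq_iff: "i < g \<Longrightarrow> j < g \<Longrightarrow> v i = v j \<longleftrightarrow> i = j"
  using v by (auto simp: bij_betw_def inj_on_def)

lemma leval_voltage_matrix:
  "map_mat (leval z) (voltage_matrix X S \<alpha> g v) = mat g g (\<lambda>(i, j). volt_entry X S \<alpha> z (v i) (v j))"
proof (rule eq_matI)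
  fix i j assume "i < dim_row (mat g g (\<lambda>(i, j). volt_entry X S \<alpha> z (v i) (v j)))"
    "j < dim_col (mat g g (\<lambda>(i, j). volt_entry X S \<alpha> z (v i) (v j)))"
  then have ij: "i < g" "j < g" by auto
  let ?t = "tail X" and ?h = "head X"
  have sum_if: "(\<Sum>s | s \<in> S \<and> P s. F s) = (\<Sum>s\<in>S. of_bool (P s) * F s)"
    for P :: "'b \<Rightarrow> bool" and F :: "'b \<Rightarrow> complex"
  proof -
    have "{s. s \<in> S \<and> P s} = {s\<in>S. P s}" by simp
    then have "(\<Sum>s | s \<in> S \<and> P s. F s) = (\<Sum>s\<in>S. if P s then F s else 0)"
      using sum.inter_filter[OF finite_orientation, of F P] by simp
    also have "\<dots> = (\<Sum>s\<in>S. of_bool (P s) * F s)" by (intro sum.cong refl) auto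
    finally show ?thesis .
  qed
  have deg: "of_nat (if i = j then out_degree X (v i) else 0) =
      (\<Sum>s\<in>S. of_bool (v i = ?t s) * of_bool (v j = ?t s) + of_bool (v i = ?h s) * of_bool (v j = ?h s) :: complex)"
  proof (cases "i = j")
    case True
    have *: "(\<Sum>s\<in>S. of_bool (v i = e s) :: complex) = of_nat (card {s\<in>S. e s = v i})" for e
    proof -
      have "{s\<in>S. e s = v i} = S \<inter> {s. v i = e s}" by auto
      then show ?thesis using finite_orientation by simp
    qed
    have "(\<Sum>s\<in>S. of_bool (v i = ?t s) * of_bool (v j = ?t s) + of_bool (v i = ?h s) * of_bool (v j = ?h s) :: complex) =
        (\<Sum>s\<in>S. of_bool (v i = ?t s) + of_bool (v i = ?h s))"
      using True by (intro sum.cong refl) auto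
    also have "\<dots> = of_nat (out_degree X (v i))"
      by (simp only: sum.distrib * out_degree_eq of_nat_add)
    finally show ?thesis using True by simp
  next
    case False
    then have "v i \<noteq> v j" using v_eq_iff ij by simp
    then have "(\<Sum>s\<in>S. of_bool (v i = ?t s) * of_bool (v j = ?t s) + of_bool (v i = ?h s) * of_bool (v j = ?h s) :: complex) = 0"
      by (intro sum.neutral) auto
    then show ?thesis using False by simp
  qed
  have "map_mat (leval z) (voltage_matrix X S \<alpha> g v) $$ (i, j) =
      of_nat (if i = j then out_degree X (v i) else 0) -
      ((\<Sum>s | s \<in> S \<and> arc_to_ends X s = (v i, v j). z powi \<alpha> s) +
       (\<Sum>s | s \<in> S \<and> arc_to_ends X s = (v j, v i). z powi (- \<alpha> s)))"
  proof -
    have "map_mat (leval z) (voltage_matrix X S \<alpha> g v) $$ (i, j) = leval z (voltage_matrix X S \<alpha> g v $$ (i, j))"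
      using ij by (simp add: voltage_matrix_def)
    also have "voltage_matrix X S \<alpha> g v $$ (i, j) = of_nat (if i = j then out_degree X (v i) else 0) -
        ((\<Sum>s | s \<in> S \<and> arc_to_ends X s = (v i, v j). T_pow (\<alpha> s)) +
         (\<Sum>s | s \<in> S \<and> arc_to_ends X s = (v j, v i). T_pow (- \<alpha> s)))"
      unfolding voltage_matrix_def by (subst index_mat) (simp_all only: ij prod.case)
    finally show ?thesis by (simp only: leval_diff leval_add leval_of_nat leval_sum leval_T_pow)
  qed
  also have "\<dots> = volt_entry X S \<alpha> z (v i) (v j)"
  proof -
    have 1: "(\<Sum>s | s \<in> S \<and> arc_to_ends X s = (v i, v j). z powi \<alpha> s) =
        (\<Sum>s\<in>S. of_bool (v i = ?t s) * of_bool (v j = ?h s) * z powi \<alpha> s)"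
      unfolding sum_if by (intro sum.cong refl) (auto simp: arc_to_ends_def)
    have 2: "(\<Sum>s | s \<in> S \<and> arc_to_ends X s = (v j, v i). z powi (- \<alpha> s)) =
        (\<Sum>s\<in>S. of_bool (v i = ?h s) * of_bool (v j = ?t s) * z powi (- \<alpha> s))"
      unfolding sum_if by (intro sum.cong refl) (auto simp: arc_to_ends_def)
    show ?thesis unfolding deg 1 2 volt_entry_def by (simp only: sum.distrib sum_subtractf diff_diff_eq)
  qed
  finally show "map_mat (leval z) (voltage_matrix X S \<alpha> g v) $$ (i, j) =
      mat g g (\<lambda>(i, j). volt_entry X S \<alpha> z (v i) (v j)) $$ (i, j)" using ij by simp
qed (auto simp: voltage_matrix_def)

text \<open>The parameter \<open>t\<close> takes three values later: 1 for the derived multigraph,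
  the order of the group for the factor at \<open>z = 1\<close>, and 0 to see that \<open>f\<close>
  vanishes at 1.\<close>

theorem matrix_tree:
  assumes g: "g > 0"
  shows "det (mat g g (\<lambda>(i, j). laplace_entry (tail X) (head X) S (v i) (v j) + t)) =
    t * int g ^ 2 * int (num_spanning_trees X r)"
proof -
  define u where "u = the_inv_into {..<g} v"
  have inj: "inj_on v {..<g}" and img: "v ` {..<g} = verts X" using v by (auto simp: bij_betw_def)
  have vu: "v (u x) = x" "u x \<in> {..<g}" if "x \<in> verts X" for x
    using that f_the_inv_into_f[OF inj] the_inv_into_into[OF inj, of x "{..<g}"] img by (auto simp: u_def)
  let ?a = "u \<circ> tail X" and ?b = "u \<circ> head X"
  have tS: "tail X s \<in> verts X" "head X s \<in> verts X" if "s \<in> S" for s using that orientation_subset_arcs[OF fin bi ori] by auto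
  have ends: "?a ` S \<subseteq> {..<g}" "?b ` S \<subseteq> {..<g}" using tS vu(2) by auto
  have lap: "laplace_entry (tail X) (head X) S (v i) (v j) = laplace_entry ?a ?b S i j" if "i < g" "j < g" for i j
  proof -
    have eq: "v m = x \<longleftrightarrow> m = u x" if "m < g" "x \<in> verts X" for m x
      using vu[OF that(2)] inj_onD[OF inj, of m "u x"] that by auto
    show ?thesis unfolding laplace_entry_def
      by (intro sum.cong refl) (use eq tS that in simp)
  qed
  have "det (mat g g (\<lambda>(i, j). laplace_entry (tail X) (head X) S (v i) (v j) + t)) =
      det (mat g g (\<lambda>(i, j). laplace_entry ?a ?b S i j + t))"
    by (rule arg_cong[of _ _ det]) (rule cong_mat, auto simp: lap)
  also have "\<dots> = t * int g ^ 2 * det (mat g g (\<lambda>(i, j). if i = 0 then of_bool (j = 0) else laplace_entry ?a ?b S i j))"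
    using det_add_const[OF g, of "laplace_entry ?a ?b S" t] laplace_entry_row_sum[OF ends, simplified]
      laplace_entry_sym[of ?a ?b S] by simp
  also have "mat g g (\<lambda>(i, j). if i = 0 then of_bool (j = 0) else laplace_entry ?a ?b S i j) =
      rooted_laplacian g ?a ?b S {0}"
    unfolding rooted_laplacian_def by (rule cong_mat) auto
  also have "det \<dots> = int (card (rooted_forests ?a ?b {..<g} {0} S))"
    using g by (intro det_rooted_laplacian[OF finite_orientation ends]) auto
  also have "rooted_forests ?a ?b {..<g} {0} S = rooted_forests (v \<circ> ?a) (v \<circ> ?b) (v ` {..<g}) (v ` {0}) S"
    using g by (intro rooted_forests_relabel[OF inj ends, symmetric]) auto
  also have "\<dots> = rooted_forests (tail X) (head X) (verts X) {v 0} S"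
    unfolding img by (simp, intro rooted_forests_cong) (auto simp: vu tS)
  also have "card \<dots> = num_spanning_trees X r"
    using img g by (intro num_spanning_trees_eq_card_rooted_forests[OF fin bi ori, symmetric]) auto
  finally show ?thesis .
qed

end

section \<open>Derived multigraphs and the Fourier transform over Z/N\<close>

context
  fixes X :: "('a, 'b) pre_digraph" and r :: "'b \<Rightarrow> 'b" and S :: "'b set" and \<alpha> :: "'b \<Rightarrow> int"
    and g :: nat and v :: "nat \<Rightarrow> 'a"
  assumes fin: "fin_digraph X" and bi: "bidirected_digraph X r" and ori: "orientation X r S"
    and v: "bij_betw v {..<g} (verts X)"
begin

interpretation fin_digraph X by (fact fin)
interpretation bidirected_digraph X r by (fact bi)

context
  fixes N :: nat
  assumes N: "N > 0"
begin

lemma fin_digraph_derived: "fin_digraph (derived X r N S \<alpha>)"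
proof -
  interpret D: bidirected_digraph "derived X r N S \<alpha>" "derived_rev r N"
    by (rule bidirected_digraph_derived[OF bi ori N])
  show ?thesis by unfold_locales (auto simp: derived_def)
qed

lemma orientation_derived: "orientation (derived X r N S \<alpha>) (derived_rev r N) (S \<times> {0..<int N})"
proof -
  have S: "e \<in> S \<longleftrightarrow> r e \<notin> S" if "e \<in> arcs X" for e using ori that unfolding orientation_def by blast
  show ?thesis unfolding orientation_def
  proof (intro conjI ballI)
    show "S \<times> {0..<int N} \<subseteq> arcs (derived X r N S \<alpha>)"
      using orientation_subset_arcs[OF fin bi ori] by (simp add: derived_def Sigma_mono)
    fix e assume "e \<in> arcs (derived X r N S \<alpha>)"
    then obtain f \<sigma> where e: "e = (f, \<sigma>)" "f \<in> arcs X" "\<sigma> \<in> {0..<int N}"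
      unfolding derived_def by auto
    show "e \<in> S \<times> {0..<int N} \<longleftrightarrow> derived_rev r N e \<notin> S \<times> {0..<int N}"
      unfolding e(1) derived_rev_def prod.case if_P[OF e(3)] mem_Sigma_iff using S[OF e(2)] e(3) by blast
  qed
qed

text \<open>Vertices are numbered sheet by sheet, so that the Laplacian falls into blocks of size
  \<open>g\<close> indexed by pairs of residues, as \<open>det_block_vandermonde\<close>
  expects.\<close>

lemma bij_derived_verts:
  assumes "g > 0"
  shows "bij_betw (\<lambda>x. (v (x mod g), int (x div g))) {..<N * g} (verts (derived X r N S \<alpha>))"
proof (rule bij_betwI')
  fix x y assume "x \<in> {..<N * g}" "y \<in> {..<N * g}"
  show "((v (x mod g), int (x div g)) = (v (y mod g), int (y div g))) = (x = y)"
  proof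
    assume "(v (x mod g), int (x div g)) = (v (y mod g), int (y div g))"
    then have eq: "v (x mod g) = v (y mod g)" "x div g = y div g" by simp_all
    have "x mod g = y mod g" using eq(1) by (subst (asm) v_eq_iff[OF fin bi ori v]) (use assms in simp_all)
    then have "x div g * g + x mod g = y div g * g + y mod g" using eq(2) by (simp only:)
    then show "x = y" by (simp only: div_mult_mod_eq)
  qed (simp only:)
next
  fix x assume x: "x \<in> {..<N * g}"
  have "v (x mod g) \<in> verts X" using v assms by (auto simp: bij_betw_def)
  moreover have "x div g < N" using x by (simp add: less_mult_imp_div_less)
  ultimately show "(v (x mod g), int (x div g)) \<in> verts (derived X r N S \<alpha>)"
    by (simp add: derived_def)
next
  fix y assume "y \<in> verts (derived X r N S \<alpha>)"
  then obtain u \<sigma> where y: "y = (u, \<sigma>)" "u \<in> verts X" "0 \<le> \<sigma>" "\<sigma> < int N" by (auto simp: derived_def)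
  obtain i where i: "i < g" "u = v i" using v y(2) by (auto simp: bij_betw_def)
  define x where "x = nat \<sigma> * g + i"
  have "nat \<sigma> < N" using y by simp
  then have "x < Suc (nat \<sigma>) * g" "Suc (nat \<sigma>) * g \<le> N * g"
    using i by (simp add: x_def, intro mult_le_mono1) simp
  then have "x \<in> {..<N * g}" by simp
  moreover have "y = (v (x mod g), int (x div g))" using i y by (simp add: x_def)
  ultimately show "\<exists>x\<in>{..<N * g}. y = (v (x mod g), int (x div g))" by blast
qed

text \<open>The Laplacian commutes with the translation of sheets, so the character sending
  \<open>\<tau>\<close> to \<open>z ^ \<tau>\<close> reduces it to a matrix on the vertices of
  \<open>X\<close>: the voltage matrix at \<open>z\<close>.\<close>

lemma fourier_laplace_derived:
  fixes z :: complex
  assumes z: "z ^ N = 1" and \<sigma>: "\<sigma> < N"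
  shows "(\<Sum>\<tau><N. of_int (laplace_entry (tail (derived X r N S \<alpha>)) (head (derived X r N S \<alpha>)) (S \<times> {0..<int N})
      (x, int \<sigma>) (y, int \<tau>)) * z ^ \<tau>) = z ^ \<sigma> * volt_entry X S \<alpha> z x y"
proof -
  let ?t = "tail X" and ?h = "head X" and ?I = "{0..<int N}"
  have z0: "z \<noteq> 0" using z N by (auto simp: power_0_left)
  \<comment> \<open>\<open>P\<close> and \<open>Q\<close> are the signed incidences of the edge
    \<open>(s, \<rho>)\<close> with the row and the column vertex; \<open>F\<close> is the transform
    of \<open>Q\<close> over the sheets.\<close>
  define P :: "'b \<Rightarrow> int \<Rightarrow> complex" where "P s \<rho> = of_bool ((x, int \<sigma>) = (?t s, \<rho>)) - of_bool ((x, int \<sigma>) = (?h s, (\<rho> + \<alpha> s) mod int N))" for s \<rho>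
  define Q :: "'b \<Rightarrow> int \<Rightarrow> nat \<Rightarrow> complex" where "Q s \<rho> \<tau> = of_bool ((y, int \<tau>) = (?t s, \<rho>)) - of_bool ((y, int \<tau>) = (?h s, (\<rho> + \<alpha> s) mod int N))" for s \<rho> \<tau>
  define F :: "'b \<Rightarrow> int \<Rightarrow> complex" where "F s \<rho> = of_bool (y = ?t s) * z powi \<rho> - of_bool (y = ?h s) * z powi (\<rho> + \<alpha> s)" for s \<rho>
  \<comment> \<open>Heads wrap around modulo \<open>N\<close>, and \<open>z ^ N = 1\<close> makes
    \<open>F\<close> blind to this.\<close>
  have per: "F s (m mod int N) = F s m" for s m
    using z0 by (simp add: F_def power_int_add powi_mod[OF N z])
  have sumQ: "(\<Sum>\<tau><N. Q s \<rho> \<tau> * z ^ \<tau>) = F s \<rho>" if \<rho>: "\<rho> \<in> ?I" for s \<rho>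
  proof -
    have delta: "(\<Sum>\<tau><N. of_bool ((y, int \<tau>) = (c, m)) * z ^ \<tau>) = of_bool (y = c) * z powi m"
      if m: "m \<in> ?I" for c m
    proof -
      have "(\<Sum>\<tau><N. of_bool ((y, int \<tau>) = (c, m)) * z ^ \<tau>) =
          (\<Sum>\<tau><N. if \<tau> = nat m then of_bool (y = c) * z ^ \<tau> else 0)"
        using m by (intro sum.cong refl) auto
      also have "\<dots> = of_bool (y = c) * z ^ nat m" using m by (simp add: sum.delta nat_less_iff)
      also have "z ^ nat m = z powi m" using m by (simp add: power_int_def)
      finally show ?thesis .
    qed
    have "(\<rho> + \<alpha> s) mod int N \<in> ?I" using N by simp
    then show ?thesis
      by (simp only: Q_def left_diff_distrib sum_subtractf delta delta[OF \<rho>] F_def powi_mod[OF N z])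
  qed
  have sumP: "(\<Sum>\<rho>\<in>?I. P s \<rho> * F s \<rho>) = of_bool (x = ?t s) * F s (int \<sigma>) - of_bool (x = ?h s) * F s (int \<sigma> - \<alpha> s)" for s
  proof -
    have "(\<Sum>\<rho>\<in>?I. P s \<rho> * F s \<rho>) = (\<Sum>\<rho>\<in>?I. of_bool (x = ?t s) * (if \<rho> = int \<sigma> then F s \<rho> else 0)) -
        (\<Sum>\<rho>\<in>?I. of_bool (x = ?h s) * (of_bool (int \<sigma> = (\<rho> + \<alpha> s) mod int N) * F s \<rho>))"
      unfolding sum_subtractf[symmetric] by (intro sum.cong refl) (auto simp: P_def)
    also have "\<dots> = of_bool (x = ?t s) * F s (int \<sigma>) - of_bool (x = ?h s) * F s (int \<sigma> - \<alpha> s)"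
      unfolding sum_distrib_left[symmetric]
      using \<sigma> N sum_periodic_delta[of "int N" "int \<sigma>" "F s" "\<alpha> s", OF _ _ per] by (simp add: sum.delta)
    finally show ?thesis .
  qed
  have "(\<Sum>\<tau><N. of_int (laplace_entry (tail (derived X r N S \<alpha>)) (head (derived X r N S \<alpha>)) (S \<times> ?I)
      (x, int \<sigma>) (y, int \<tau>)) * z ^ \<tau>) = (\<Sum>\<tau><N. \<Sum>s\<in>S. \<Sum>\<rho>\<in>?I. P s \<rho> * (Q s \<rho> \<tau> * z ^ \<tau>))"
  proof (intro sum.cong refl)
    fix \<tau>
    have "of_int (laplace_entry (tail (derived X r N S \<alpha>)) (head (derived X r N S \<alpha>)) (S \<times> ?I)
        (x, int \<sigma>) (y, int \<tau>)) = (\<Sum>(s, \<rho>)\<in>S \<times> ?I. P s \<rho> * Q s \<rho> \<tau>)"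
      unfolding laplace_entry_def of_int_sum
      by (intro sum.cong refl) (auto simp: derived_def P_def Q_def)
    also have "\<dots> = (\<Sum>s\<in>S. \<Sum>\<rho>\<in>?I. P s \<rho> * Q s \<rho> \<tau>)" by (rule sum.cartesian_product[symmetric])
    finally show "of_int (laplace_entry (tail (derived X r N S \<alpha>)) (head (derived X r N S \<alpha>)) (S \<times> ?I)
        (x, int \<sigma>) (y, int \<tau>)) * z ^ \<tau> = (\<Sum>s\<in>S. \<Sum>\<rho>\<in>?I. P s \<rho> * (Q s \<rho> \<tau> * z ^ \<tau>))"
      by (simp add: sum_distrib_right mult.assoc)
  qed
  also have "\<dots> = (\<Sum>s\<in>S. \<Sum>\<tau><N. \<Sum>\<rho>\<in>?I. P s \<rho> * (Q s \<rho> \<tau> * z ^ \<tau>))" by (rule sum.swap)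
  also have "\<dots> = (\<Sum>s\<in>S. \<Sum>\<rho>\<in>?I. \<Sum>\<tau><N. P s \<rho> * (Q s \<rho> \<tau> * z ^ \<tau>))"
    by (intro sum.cong refl sum.swap)
  also have "\<dots> = (\<Sum>s\<in>S. \<Sum>\<rho>\<in>?I. P s \<rho> * F s \<rho>)"
    by (intro sum.cong refl) (simp add: sumQ flip: sum_distrib_left)
  also have "\<dots> = (\<Sum>s\<in>S. of_bool (x = ?t s) * F s (int \<sigma>) - of_bool (x = ?h s) * F s (int \<sigma> - \<alpha> s))"
    by (simp only: sumP)
  also have "\<dots> = z ^ \<sigma> * volt_entry X S \<alpha> z x y"
    unfolding volt_entry_def sum_distrib_left
    by (intro sum.cong refl)
       (use z0 in \<open>simp add: F_def power_int_add power_int_diff power_int_minus field_simps\<close>)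
  finally show ?thesis .
qed

text \<open>The matrix-tree theorem with \<open>t = 1\<close> on \<open>N g\<close> vertices. The
  all-ones matrix turns into the geometric sum, which vanishes for \<open>z \<noteq> 1\<close>, so
  it only rescues the factor at \<open>z = 1\<close>, which would otherwise be 0.\<close>

lemma num_spanning_trees_derived:
  assumes g: "g > 0"
  shows "of_nat ((N * g) ^ 2 * num_spanning_trees (derived X r N S \<alpha>) (derived_rev r N)) =
    (\<Prod>z | z ^ N = 1. det (mat g g (\<lambda>(i, j). volt_entry X S \<alpha> z (v i) (v j) + (\<Sum>\<tau><N. z ^ \<tau>))))"
proof -
  let ?D = "derived X r N S \<alpha>" and ?SD = "S \<times> {0..<int N}" and ?w = "\<lambda>x. (v (x mod g), int (x div g))"
  define h :: "nat \<Rightarrow> complex" where "h k = cis (2 * pi * real k / real N)" for k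
  have h: "bij_betw h {..<N} {z. z ^ N = 1}" unfolding h_def by (rule bij_betw_roots_unity[OF N])
  let ?A = "mat (N * g) (N * g) (\<lambda>(x, y). laplace_entry (tail ?D) (head ?D) ?SD (?w x) (?w y) + 1)"
  let ?B = "\<lambda>z::complex. mat g g (\<lambda>(i, j). volt_entry X S \<alpha> z (v i) (v j) + (\<Sum>\<tau><N. z ^ \<tau>))"
  have "det ?A = 1 * int (N * g) ^ 2 * int (num_spanning_trees ?D (derived_rev r N))"
    by (rule matrix_tree[OF fin_digraph_derived bidirected_digraph_derived[OF bi ori N] orientation_derived
      bij_derived_verts[OF g]]) (use N g in simp)
  then have "of_nat ((N * g) ^ 2 * num_spanning_trees ?D (derived_rev r N)) = complex_of_int (det ?A)" by simp
  also have "\<dots> = det (map_mat of_int ?A)" by (simp add: of_int_hom.hom_det)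
  also have "\<dots> = (\<Prod>k<N. det (?B (h k)))"
  proof (rule det_block_vandermonde[where z = h])
    show "inj_on h {..<N}" using h by (simp add: bij_betw_def)
    fix \<sigma> i j k assume *: "\<sigma> < N" "i < g" "j < g" "k < N"
    have hk: "h k ^ N = 1" using h *(4) by (auto simp: bij_betw_def)
    have idx: "t * g + m < N * g" if "t < N" "m < g" for t m
    proof -
      have "t * g + m < Suc t * g" using that by simp
      also have "\<dots> \<le> N * g" using that by (intro mult_le_mono1) auto
      finally show ?thesis .
    qed
    have "(\<Sum>t<N. map_mat complex_of_int ?A $$ (\<sigma> * g + i, t * g + j) * h k ^ t) =
        (\<Sum>t<N. (of_int (laplace_entry (tail ?D) (head ?D) ?SD (v i, int \<sigma>) (v j, int t)) + 1) * h k ^ t)"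
      using * idx by (intro sum.cong refl) simp
    also have "\<dots> = h k ^ \<sigma> * volt_entry X S \<alpha> (h k) (v i) (v j) + (\<Sum>t<N. h k ^ t)"
      by (simp add: distrib_right sum.distrib fourier_laplace_derived[OF hk *(1)])
    also have "(\<Sum>t<N. h k ^ t) = h k ^ \<sigma> * (\<Sum>t<N. h k ^ t)"
      using hk by (cases "h k = 1") (simp_all add: geometric_sum)
    finally show "(\<Sum>t<N. map_mat complex_of_int ?A $$ (\<sigma> * g + i, t * g + j) * h k ^ t) =
        h k ^ \<sigma> * ?B (h k) $$ (i, j)" using * by (simp add: distrib_left)
  qed auto
  also have "\<dots> = (\<Prod>z | z ^ N = 1. det (?B z))" by (rule prod.reindex_bij_betw[OF h])
  finally show ?thesis .
qed

end

text \<open>The factor at \<open>z = 1\<close> is \<open>N g ^ 2\<close> times the tree number of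
  \<open>X\<close>, by the matrix-tree theorem with \<open>t = N\<close>. Cancelling
  \<open>N g ^ 2\<close> against \<open>(N g) ^ 2\<close> leaves \<open>N = l ^ n\<close> on the
  left.\<close>

lemma spanning_trees_product_formula:
  assumes g: "g > 0" and l: "prime l"
  shows "of_nat (l ^ n * num_spanning_trees (derived X r (l ^ n) S \<alpha>) (derived_rev r (l ^ n))) =
    of_nat (num_spanning_trees X r) *
      (\<Prod>k=1..n. \<Prod>z\<in>prim_roots l k. leval z (det (voltage_matrix X S \<alpha> g v)))"
proof -
  define N where "N = l ^ n"
  have N: "N > 0" using prime_gt_0_nat[OF l] by (simp add: N_def)
  let ?\<kappa> = "num_spanning_trees (derived X r N S \<alpha>) (derived_rev r N)"
  let ?M = "\<lambda>z::complex. det (mat g g (\<lambda>(i, j). volt_entry X S \<alpha> z (v i) (v j) + (\<Sum>\<tau><N. z ^ \<tau>)))"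
  have one: "?M 1 = of_nat N * of_nat g ^ 2 * of_nat (num_spanning_trees X r)"
  proof -
    let ?L = "mat g g (\<lambda>(i, j). laplace_entry (tail X) (head X) S (v i) (v j) + int N)"
    have "mat g g (\<lambda>(i, j). volt_entry X S \<alpha> 1 (v i) (v j) + (\<Sum>\<tau><N. 1 ^ \<tau>)) = map_mat of_int ?L"
      by (rule eq_matI) (auto simp: volt_entry_1)
    then have "?M 1 = complex_of_int (det ?L)" by (simp add: of_int_hom.hom_det)
    then show ?thesis by (simp add: matrix_tree[OF fin bi ori v g])
  qed
  have prim: "?M z = leval z (det (voltage_matrix X S \<alpha> g v))" if "z \<in> prim_roots l k" "k \<in> {1..n}" for z k
  proof -
    have zk: "z ^ (l ^ k) = 1" "z \<noteq> 1" using that by (auto simp: prim_roots_def)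
    have z0: "z \<noteq> 0" using zk prime_gt_0_nat[OF l] by (auto simp: power_0_left)
    have "N = l ^ k * l ^ (n - k)" using that(2) by (simp add: N_def flip: power_add)
    then have "z ^ N = 1" using zk by (simp add: power_mult)
    then have "(\<Sum>\<tau><N. z ^ \<tau>) = 0" using zk(2) by (simp add: geometric_sum)
    then show ?thesis by (simp add: leval_det[OF z0] leval_voltage_matrix[OF fin bi ori v])
  qed
  have "of_nat ((N * g) ^ 2 * ?\<kappa>) = (\<Prod>z | z ^ (l ^ n) = 1. ?M z)"
    using num_spanning_trees_derived[OF N g] by (simp add: N_def)
  also have "\<dots> = ?M 1 * (\<Prod>k=1..n. \<Prod>z\<in>prim_roots l k. ?M z)" by (rule prod_l_power_roots_unity[OF l])
  also have "(\<Prod>k=1..n. \<Prod>z\<in>prim_roots l k. ?M z) =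
      (\<Prod>k=1..n. \<Prod>z\<in>prim_roots l k. leval z (det (voltage_matrix X S \<alpha> g v)))"
    by (intro prod.cong refl prim)
  finally have "of_nat N * of_nat g ^ 2 * of_nat (N * ?\<kappa>) = of_nat N * of_nat g ^ 2 *
      (of_nat (num_spanning_trees X r) * (\<Prod>k=1..n. \<Prod>z\<in>prim_roots l k. leval z (det (voltage_matrix X S \<alpha> g v))))"
    unfolding one by (simp add: power2_eq_square mult_ac)
  then show ?thesis using prime_gt_0_nat[OF l] g by (simp add: N_def)
qed

end

section \<open>The product formula in terms of U, and the nonvanishing of U at 0\<close>

theorem theorem3p2:
  fixes X :: "('a, 'b) pre_digraph" and r :: "'b \<Rightarrow> 'b"
    and S :: "'b set" and \<alpha> :: "'b \<Rightarrow> int"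
    and l g b :: nat and v :: "nat \<Rightarrow> 'a"
    and \<kappa> :: "nat \<Rightarrow> nat" and f :: laurent and U :: "int poly"
  assumes "prime l"
    and "fin_digraph X" and "bidirected_digraph X r"
    and "Digraph_Component.connected X"
    and "\<And>x. x \<in> verts X \<Longrightarrow> out_degree X x \<noteq> 1"
    and "euler_char X r \<noteq> 0"
    and "bij_betw v {..<g} (verts X)"
    and "orientation X r S"
    and "\<And>n. n \<ge> 1 \<Longrightarrow> Digraph_Component.connected (derived X r (l ^ n) S \<alpha>)"
    and "\<And>n. \<kappa> n = num_spanning_trees (derived X r (l ^ n) S \<alpha>) (derived_rev r (l ^ n))"
    and "f = Determinant.det (voltage_matrix X S \<alpha> g v)"
    and "b = (LEAST k. T_pow (int k) * f \<in> range laurent_of_poly)"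
    and "laurent_of_poly U = T_pow (int b) * f"
  shows "filterlim (\<lambda>n. card (prime_factors (\<kappa> n))) at_top sequentially \<longleftrightarrow>
    (\<exists>z :: complex. algebraic z \<and> poly (map_poly of_int U) z = 0 \<and> \<not> (\<exists>k>0. z ^ k = 1))"
proof -
  note l = assms(1) and fin = assms(2) and bi = assms(3) and v = assms(7) and ori = assms(8)
  define m0 where "m0 = int (num_spanning_trees X r)"
  have "verts X \<noteq> {}" using assms(4) by (auto simp: connected_def strongly_connected_def)
  then have g: "g > 0" using v by (auto simp: bij_betw_def)
  have N: "l ^ n > 0" for n using prime_gt_0_nat[OF l] by simp
  have \<kappa>_pos: "\<kappa> n > 0" if "n \<ge> 1" for n
    unfolding assms(10)
    by (rule num_spanning_trees_pos[OF fin_digraph_derived[OF fin bi ori v N]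
      bidirected_digraph_derived[OF bi ori N] orientation_derived[OF fin bi ori v N] assms(9)[OF that]])
  have U_leval: "peval U z = z ^ b * leval z f" if "z \<noteq> 0" for z
    using arg_cong[OF assms(13), of "leval z"] that
    by (simp add: leval_laurent_of_poly leval_mult leval_T_pow)
  have \<kappa>_eq: "int (l ^ n * \<kappa> n) = \<bar>m0\<bar> * (\<Prod>k=1..n. \<bar>cyc_norm l k U\<bar>)" if "n \<ge> 1" for n
  proof -
    \<comment> \<open>\<open>f\<close> and \<open>U\<close> differ by a power of \<open>T\<close>,
      which has absolute value 1 at roots of unity.\<close>
    have "norm (leval z f) = norm (peval U z)" if z: "z \<in> prim_roots l k" for z k
    proof -
      have "norm z ^ (l ^ k) = 1 ^ (l ^ k)" using z by (simp add: prim_roots_def norm_power[symmetric])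
      then have "norm z = 1" by (rule power_eq_imp_eq_base) (use N in auto)
      moreover from this have "z \<noteq> 0" by auto
      ultimately show ?thesis by (simp add: U_leval norm_mult norm_power)
    qed
    then have leval_peval: "(\<Prod>z\<in>prim_roots l k. norm (leval z f)) = (\<Prod>z\<in>prim_roots l k. norm (peval U z))" for k
      by (intro prod.cong refl)
    have "norm (\<Prod>z\<in>prim_roots l k. leval z f) = real_of_int \<bar>cyc_norm l k U\<bar>" if "k \<in> {1..n}" for k
    proof -
      have "norm (\<Prod>z\<in>prim_roots l k. leval z f) = norm (\<Prod>z\<in>prim_roots l k. peval U z)"
        by (simp only: prod_norm[symmetric] leval_peval)
      also have "\<dots> = norm (complex_of_int (cyc_norm l k U))" using that by (simp add: cyc_norm_eq[OF l])
      finally show ?thesis by simp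
    qed
    then have "norm (\<Prod>k=1..n. \<Prod>z\<in>prim_roots l k. leval z f) = real_of_int (\<Prod>k=1..n. \<bar>cyc_norm l k U\<bar>)"
      by (simp flip: prod_norm)
    moreover have "norm (complex_of_nat (l ^ n * \<kappa> n)) =
        real (num_spanning_trees X r) * norm (\<Prod>k=1..n. \<Prod>z\<in>prim_roots l k. leval z f)"
      unfolding assms(10,11) spanning_trees_product_formula[OF fin bi ori v g l] by (simp add: norm_mult)
    ultimately have "real_of_int (int (l ^ n * \<kappa> n)) =
        real_of_int (\<bar>m0\<bar> * (\<Prod>k=1..n. \<bar>cyc_norm l k U\<bar>))"
      by (simp only: norm_of_nat m0_def of_int_mult of_int_of_nat_eq abs_of_nat)
    then show ?thesis by (simp only: of_int_eq_iff)
  qed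
  have U: "U \<noteq> 0" by (rule norm_poly_nonzero[OF l \<kappa>_pos \<kappa>_eq])
  have f_det: "leval z f = det (mat g g (\<lambda>(i, j). volt_entry X S \<alpha> z (v i) (v j)))" if "z \<noteq> 0" for z
    unfolding assms(11) by (simp add: leval_det[OF that] leval_voltage_matrix[OF fin bi ori v])
  \<comment> \<open>For \<open>b = 0\<close> minimality does not exclude divisibility by
    \<open>T\<close>. But then \<open>U\<close> is invariant under inversion, hence constant, and
    vanishes at 1, against \<open>U \<noteq> 0\<close>; so this case cannot occur.\<close>
  have "coeff U 0 \<noteq> 0"
  proof (cases "b = 0")
    case True
    have "leval (inverse z) f = leval z f" if "z \<noteq> 0" for z
    proof -
      let ?M = "mat g g (\<lambda>(i, j). volt_entry X S \<alpha> z (v i) (v j))"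
      have "leval (inverse z) f = det (mat g g (\<lambda>(i, j). volt_entry X S \<alpha> z (v j) (v i)))"
        using that by (simp add: f_det volt_entry_sym)
      also have "mat g g (\<lambda>(i, j). volt_entry X S \<alpha> z (v j) (v i)) = ?M\<^sup>T"
        by (rule eq_matI) auto
      also have "det (?M\<^sup>T) = det ?M" by (rule det_transpose[of _ g]) simp
      finally show ?thesis using that by (simp add: f_det)
    qed
    then have "degree U = 0" using U_leval True by (intro reciprocal_poly_const) simp
    then obtain c where c: "U = [:c:]" by (rule degree_eq_zeroE)
    have "leval 1 f = 0"
    proof -
      let ?L = "mat g g (\<lambda>(i, j). laplace_entry (tail X) (head X) S (v i) (v j) + 0)"
      have "mat g g (\<lambda>(i, j). volt_entry X S \<alpha> 1 (v i) (v j)) = map_mat of_int ?L"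
        by (rule eq_matI) (auto simp: volt_entry_1)
      then have "leval 1 f = of_int (det ?L)" by (simp add: f_det of_int_hom.hom_det)
      then show ?thesis by (simp only: matrix_tree[OF fin bi ori v g] mult_zero_left of_int_0)
    qed
    then show ?thesis using U_leval[of 1] U by (simp add: c)
  next
    case False
    then show ?thesis using least_shift_nonzero_constant_term[OF assms(12) _ assms(13)] by simp
  qed
  then have U0: "peval U 0 \<noteq> 0" by (cases U) (simp add: peval_pCons)
  have "algebraic z" if "peval U z = 0" for z
    unfolding algebraic_def using that U
    by (intro exI[of _ "map_poly of_int U"]) (auto simp: peval_def coeff_map_poly)
  then have "algebraic z \<and> poly (map_poly of_int U) z = 0 \<longleftrightarrow> peval U z = 0" for z
    by (auto simp: peval_def)
  then show ?thesis
    using omega_limit_iff[OF l \<kappa>_pos \<kappa>_eq U0] by (simp only: conj_assoc[symmetric])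
qed

end
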